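(* There is a classical oracle $O_1$ such that $\mathsf{BPP}^{O_1} \subsetneq \mathsf{NISQ}^{O_1}$.
   Context: **Noise and circuits.** For $\lambda\in[0,1]$ the single-qubit depolarizing channel is $D_\lambda[\rho] = (1-\lambda)\rho + \lambda I/2$. An $n'$-qubit unitary is depth-1 if it is a tensor product of two-qubit unitaries. **Oracles.** A classical oracle is a function $O:\{0,1\}^n\to\{0,1\}^m$ (more precisely a sequence of functions $O:\{0,1\}^n\to\{0,1\}^{m(n)}$ parametrized by $n\in\mathbb{N}$), with associated unitary $U_O|x\rangle|y\rangle = |x\rangle|y\oplus O(x)\rangle$. A classical algorithm with access to $O$ is a probabilistic Turing machine that can query $O$ at any $x$ to get $O(x)$; $\mathsf{BPP}^O$ is the class of languages decided by such algorithms in polynomial time with success probability at least $2/3$. **Noisy circuit oracle.** $\mathrm{NQC}^O_\lambda$ takes an integer $n'$ and a sequence $U_1,\dots,U_T$ ($T\in\mathbb{N}$ arbitrary) of $n'$-qubit unitaries, each either depth-1 or of the form $U_O\otimes I$, and returns a random string $s\in\{0,1\}^{n'}$ with probability $$p(s)=\langle s| D_\lambda^{\otimes n'}[U_T\cdots D_\lambda^{\otimes n'}[U_2 D_\lambda^{\otimes n'}[U_1 D_\lambda^{\otimes n'}[|0^{n'}\rangle\langle 0^{n'}|]U_1^\dagger]U_2^\dagger]\cdots U_T^\dagger]|s\rangle .$$ Such a query takes time $\Theta(n'T)$. **NISQ.** A $\mathsf{NISQ}_\lambda$ algorithm with access to $O$ is a probabilistic Turing machine that can (adaptively) query $O$ classically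 and query $\mathrm{NQC}^O_\lambda$. Its runtime is its classical runtime plus the number of classical queries to $O$ plus the total time of its queries to $\mathrm{NQC}^O_\lambda$. A language $L\subseteq\{0,1\}^*$ is in $\mathsf{NISQ}^O$ if there are a constant $\lambda>0$ and a $\mathsf{NISQ}_\lambda$ algorithm with access to $O$ that, on every $x$, runs in time $\mathrm{poly}(|x|)$, outputs $1$ with probability at least $2/3$ if $x\in L$, and outputs $0$ with probability at least $2/3$ if $x\notin L$. *)

theory Defs
  imports
    "HOL-Probability.Probability"
    "Jordan_Normal_Form.Schur_Decomposition"
begin

section \<open>Classical oracles\<close>

type_synonym bits = "bool list"

text \<open>An oracle is a family of functions from \<open>{0,1}^n\<close> to \<open>{0,1}^{m(n)}\<close>, given as one function
  on all bit strings.\<close>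

definition classical_oracle :: "(bits \<Rightarrow> bits) \<Rightarrow> bool" where
  "classical_oracle Or \<longleftrightarrow> (\<exists>m :: nat \<Rightarrow> nat. \<forall>x. length (Or x) = m (length x))"

definition out_len :: "(bits \<Rightarrow> bits) \<Rightarrow> nat \<Rightarrow> nat" where
  "out_len Or n = length (Or (replicate n False))"


section \<open>Noisy circuits\<close>

text \<open>An operator on \<open>N\<close> qubits is a complex matrix of size \<open>2^N\<close>. The basis vector
  \<open>|s\<rangle>\<close> has the index whose \<open>i\<close>-th binary digit, least significant first,
  is the value \<open>s ! i\<close> of qubit \<open>i\<close>.\<close>

definition index_of_bits :: "bits \<Rightarrow> nat" where
  "index_of_bits s = horner_sum of_bool 2 s"

definition bits_of_index :: "nat \<Rightarrow> nat \<Rightarrow> bits" where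
  "bits_of_index n z = map (bit z) [0..<n]"

definition unitary_mat :: "nat \<Rightarrow> complex mat \<Rightarrow> bool" where
  "unitary_mat d U \<longleftrightarrow> U \<in> carrier_mat d d \<and> U * mat_adjoint U = 1\<^sub>m d \<and> mat_adjoint U * U = 1\<^sub>m d"

text \<open>The depolarizing channel on qubit \<open>i\<close>, tensored with the identity channel on the other qubits.
  The linear extension of \<open>\<rho> \<mapsto> (1 - \<lambda>) \<rho> + \<lambda> I/2\<close> from density matrices to all matrices is
  \<open>\<rho> \<mapsto> (1 - \<lambda>) \<rho> + \<lambda> tr(\<rho>) I/2\<close>, so the partial trace over qubit \<open>i\<close> appears.\<close>

definition depolarize_qubit :: "real \<Rightarrow> nat \<Rightarrow> nat \<Rightarrow> complex mat \<Rightarrow> complex mat" where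
  "depolarize_qubit lam N i \<rho> = mat (2 ^ N) (2 ^ N) (\<lambda>(x, y).
     complex_of_real (1 - lam) * \<rho> $$ (x, y) +
     complex_of_real lam *
       ((if bit x i = bit y i then 1 / 2 else 0) *
        (\<rho> $$ (unset_bit i x, unset_bit i y) + \<rho> $$ (set_bit i x, set_bit i y))))"

definition depolarize :: "real \<Rightarrow> nat \<Rightarrow> complex mat \<Rightarrow> complex mat" where
  "depolarize lam N = fold (depolarize_qubit lam N) [0..<N]"

definition zero_state :: "nat \<Rightarrow> complex mat" where
  "zero_state N = mat (2 ^ N) (2 ^ N) (\<lambda>(x, y). if x = 0 \<and> y = 0 then 1 else 0)"

definition noisy_state :: "real \<Rightarrow> nat \<Rightarrow> complex mat list \<Rightarrow> complex mat" where
  "noisy_state lam N Us =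
     fold (\<lambda>U \<rho>. depolarize lam N (U * \<rho> * mat_adjoint U)) Us (depolarize lam N (zero_state N))"

definition noisy_prob :: "real \<Rightarrow> nat \<Rightarrow> complex mat list \<Rightarrow> bits \<Rightarrow> real" where
  "noisy_prob lam N Us s =
     (if length s = N
      then Re (noisy_state lam N Us $$ (index_of_bits s, index_of_bits s)) else 0)"

definition noisy_outcome :: "real \<Rightarrow> nat \<Rightarrow> complex mat list \<Rightarrow> bits pmf" where
  "noisy_outcome lam N Us = embed_pmf (noisy_prob lam N Us)"

text \<open>The tensor product of two-qubit operators, where \<open>(i, j, G)\<close> stands for \<open>G\<close> acting on the
  qubits \<open>i, j\<close>, with \<open>|x\<^sub>i x\<^sub>j\<rangle>\<close> as basis vector number \<open>2 x\<^sub>i + x\<^sub>j\<close> of the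
  matrix \<open>G\<close>. Any two qubits may be paired. A qubit outside all pairs is idle; such idle qubits can
  be paired up with the identity, except for one left over when \<open>N\<close> is odd.\<close>

definition pair_index :: "nat \<Rightarrow> nat \<Rightarrow> nat \<Rightarrow> nat" where
  "pair_index i j x = 2 * of_bool (bit x i) + of_bool (bit x j)"

type_synonym gates = "(nat \<times> nat \<times> complex mat) list"

definition touched_qubits :: "gates \<Rightarrow> nat list" where
  "touched_qubits gs = concat (map (\<lambda>(i, j, G). [i, j]) gs)"

definition depth1_gates :: "nat \<Rightarrow> gates \<Rightarrow> bool" where
  "depth1_gates N gs \<longleftrightarrow>
     distinct (touched_qubits gs) \<and> set (touched_qubits gs) \<subseteq> {..<N} \<and>
     (\<forall>(i, j, G) \<in> set gs. unitary_mat 4 G)"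

definition depth1_unitary :: "nat \<Rightarrow> gates \<Rightarrow> complex mat" where
  "depth1_unitary N gs = mat (2 ^ N) (2 ^ N) (\<lambda>(x, y).
     (\<Prod>(i, j, G) \<leftarrow> gs. G $$ (pair_index i j x, pair_index i j y)) *
     (if \<forall>k < N. k \<notin> set (touched_qubits gs) \<longrightarrow> bit x k = bit y k then 1 else 0))"

text \<open>The operator \<open>U\<^sub>O \<otimes> I\<close> for the oracle on inputs of length \<open>n\<close>: qubits \<open>0, \<dots>, n - 1\<close> hold the
  query and the next \<open>out_len Or n\<close> qubits receive the answer.\<close>

definition oracle_unitary :: "(bits \<Rightarrow> bits) \<Rightarrow> nat \<Rightarrow> nat \<Rightarrow> complex mat" where
  "oracle_unitary Or N n = mat (2 ^ N) (2 ^ N) (\<lambda>(x, y).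
     if x = xor y (push_bit n (index_of_bits (Or (bits_of_index n y)))) then 1 else 0)"


section \<open>Descriptions of noisy circuits as bit strings\<close>

text \<open>A Turing machine can only name countably many unitaries. It may use every two-qubit unitary
  with algebraic entries, in particular a dense set of unitaries that contains the usual gates. (With
  arbitrary complex numbers as entries, a machine could have non-computable advice built in.)

  \<open>Alg cs q a b c d\<close> describes the complex number that is the only root of the integer polynomial
  with coefficient list \<open>cs\<close> (constant term first) in the rectangle
  \<open>[a/q, b/q] \<times> [c/q, d/q]\<close>, if there is exactly one.\<close>

datatype alg = Alg "int list" nat int int int int

fun alg_denotes :: "alg \<Rightarrow> complex \<Rightarrow> bool" where
  "alg_denotes (Alg cs q a b c d) z \<longleftrightarrow>
     poly (map_poly of_int (Poly cs)) z = 0 \<and>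
     of_int a \<le> of_nat q * Re z \<and> of_nat q * Re z \<le> of_int b \<and>
     of_int c \<le> of_nat q * Im z \<and> of_nat q * Im z \<le> of_int d"

definition alg_val :: "alg \<Rightarrow> complex" where
  "alg_val r = (THE z. alg_denotes r z)"

text \<open>The 16 entries of a two-qubit gate are listed row by row.\<close>

type_synonym gate_desc = "nat \<times> nat \<times> alg list"

datatype layer_desc = Depth1 "gate_desc list" | Oracle nat

type_synonym circuit_desc = "nat \<times> layer_desc list"

definition gate_of_desc :: "gate_desc \<Rightarrow> nat \<times> nat \<times> complex mat" where
  "gate_of_desc = (\<lambda>(i, j, es). (i, j, mat 4 4 (\<lambda>(r, c). alg_val (es ! (4 * r + c)))))"

fun valid_layer :: "(bits \<Rightarrow> bits) \<Rightarrow> nat \<Rightarrow> layer_desc \<Rightarrow> bool" where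
  "valid_layer Or N (Depth1 ds) \<longleftrightarrow>
     (\<forall>(i, j, es) \<in> set ds. length es = 16 \<and> (\<forall>r \<in> set es. \<exists>!z. alg_denotes r z)) \<and>
     depth1_gates N (map gate_of_desc ds)"
| "valid_layer Or N (Oracle n) \<longleftrightarrow> n + out_len Or n \<le> N"

fun layer_unitary :: "(bits \<Rightarrow> bits) \<Rightarrow> nat \<Rightarrow> layer_desc \<Rightarrow> complex mat" where
  "layer_unitary Or N (Depth1 ds) = depth1_unitary N (map gate_of_desc ds)"
| "layer_unitary Or N (Oracle n) = oracle_unitary Or N n"

definition valid_circuit :: "(bits \<Rightarrow> bits) \<Rightarrow> circuit_desc \<Rightarrow> bool" where
  "valid_circuit Or = (\<lambda>(N, ls). \<forall>l \<in> set ls. valid_layer Or N l)"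

text \<open>A self-delimiting encoding. Numbers of qubits and qubit positions are in unary, the
  integers that describe matrix entries in binary.\<close>

definition enc_unary :: "nat \<Rightarrow> bits" where
  "enc_unary n = replicate n True @ [False]"

fun enc_nat :: "nat \<Rightarrow> bits" where
  "enc_nat n = (if n = 0 then [False] else True # odd n # enc_nat (n div 2))"

declare enc_nat.simps [simp del]

definition enc_int :: "int \<Rightarrow> bits" where
  "enc_int k = (k < 0) # enc_nat (nat \<bar>k\<bar>)"

definition enc_list :: "('a \<Rightarrow> bits) \<Rightarrow> 'a list \<Rightarrow> bits" where
  "enc_list e xs = concat (map (\<lambda>x. True # e x) xs) @ [False]"

fun enc_alg :: "alg \<Rightarrow> bits" where
  "enc_alg (Alg cs q a b c d) =
     enc_list enc_int cs @ enc_nat q @ enc_int a @ enc_int b @ enc_int c @ enc_int d"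

definition enc_gate :: "gate_desc \<Rightarrow> bits" where
  "enc_gate = (\<lambda>(i, j, es). enc_unary i @ enc_unary j @ enc_list enc_alg es)"

fun enc_layer :: "layer_desc \<Rightarrow> bits" where
  "enc_layer (Depth1 ds) = True # enc_list enc_gate ds"
| "enc_layer (Oracle n) = False # enc_unary n"

definition enc_circuit :: "circuit_desc \<Rightarrow> bits" where
  "enc_circuit = (\<lambda>(N, ls). enc_unary N @ enc_list enc_layer ls)"

definition prefix_code :: "('a \<Rightarrow> bits) \<Rightarrow> bool" where
  "prefix_code e \<longleftrightarrow> (\<forall>a b u v. e a @ u = e b @ v \<longrightarrow> a = b \<and> u = v)"

lemma prefix_codeD: "prefix_code e \<Longrightarrow> e a @ u = e b @ v \<longleftrightarrow> a = b \<and> u = v"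
  unfolding prefix_code_def by blast

lemma prefix_code_unary: "prefix_code enc_unary"
proof -
  have "enc_unary a @ u = enc_unary b @ v \<Longrightarrow> a = b \<and> u = v" for a b u v
    unfolding enc_unary_def
  proof (induction a arbitrary: b)
    case 0 then show ?case by (cases b) auto
  next
    case (Suc a) then show ?case by (cases b) auto
  qed
  then show ?thesis unfolding prefix_code_def by blast
qed

lemma prefix_code_nat: "prefix_code enc_nat"
proof -
  have "enc_nat a @ u = enc_nat b @ v \<Longrightarrow> a = b \<and> u = v" for a b u v
  proof (induction a arbitrary: b rule: enc_nat.induct)
    case (1 a)
    show ?case
    proof (cases "a = 0 \<or> b = 0")
      case True
      then show ?thesis
        using "1.prems" by (subst (asm) (1 2) enc_nat.simps) (auto split: if_splits)
    next
      case False
      then have "odd a = odd b" "enc_nat (a div 2) @ u = enc_nat (b div 2) @ v"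
        using "1.prems" by (subst (asm) (1 2) enc_nat.simps, simp)+
      moreover from this have "a div 2 = b div 2" "u = v"
        using "1.IH"[of "b div 2"] False by auto
      ultimately show ?thesis
        by (metis even_two_times_div_two odd_two_times_div_two_succ)
    qed
  qed
  then show ?thesis unfolding prefix_code_def by blast
qed

lemma prefix_code_int: "prefix_code enc_int"
  unfolding prefix_code_def enc_int_def
  by (auto simp: prefix_codeD[OF prefix_code_nat] abs_if split: if_splits)

lemma prefix_code_list:
  assumes "prefix_code e"
  shows "prefix_code (enc_list e)"
proof -
  have "enc_list e xs @ u = enc_list e ys @ v \<Longrightarrow> xs = ys \<and> u = v" for xs ys u v
    unfolding enc_list_def
  proof (induction xs arbitrary: ys)
    case Nil then show ?case by (cases ys) auto
  next
    case (Cons x xs) then show ?case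
      by (cases ys) (auto simp: prefix_codeD[OF assms])
  qed
  then show ?thesis unfolding prefix_code_def by blast
qed

lemma prefix_code_alg: "prefix_code enc_alg"
proof -
  have "enc_alg r @ u = enc_alg r' @ v \<Longrightarrow> r = r' \<and> u = v" for r r' u v
    by (cases r; cases r')
      (simp add: prefix_codeD[OF prefix_code_nat] prefix_codeD[OF prefix_code_int]
        prefix_codeD[OF prefix_code_list[OF prefix_code_int]])
  then show ?thesis unfolding prefix_code_def by blast
qed

lemma prefix_code_gate: "prefix_code enc_gate"
  unfolding prefix_code_def enc_gate_def
  by (auto simp: prefix_codeD[OF prefix_code_unary]
      prefix_codeD[OF prefix_code_list[OF prefix_code_alg]])

lemma prefix_code_layer: "prefix_code enc_layer"
proof -
  have "enc_layer l @ u = enc_layer l' @ v \<Longrightarrow> l = l' \<and> u = v" for l l' u v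
    by (cases l; cases l')
      (simp_all add: prefix_codeD[OF prefix_code_unary]
        prefix_codeD[OF prefix_code_list[OF prefix_code_gate]])
  then show ?thesis unfolding prefix_code_def by blast
qed

lemma prefix_code_circuit: "prefix_code enc_circuit"
  unfolding prefix_code_def enc_circuit_def
  by (auto simp: prefix_codeD[OF prefix_code_unary]
      prefix_codeD[OF prefix_code_list[OF prefix_code_layer]])

lemma inj_enc_circuit: "inj enc_circuit"
  by (rule injI) (metis prefix_codeD[OF prefix_code_circuit])

text \<open>The noisy circuit oracle on query strings: the distribution of the answer and the time that
  the query takes. A string that is not the code of a circuit gets the empty answer.\<close>

definition nqc :: "real \<Rightarrow> (bits \<Rightarrow> bits) \<Rightarrow> bits \<Rightarrow> bits pmf \<times> nat" where
  "nqc lam Or w =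
     (if \<exists>C. valid_circuit Or C \<and> enc_circuit C = w then
        (case the_inv enc_circuit w of (N, ls) \<Rightarrow>
           (noisy_outcome lam N (map (layer_unitary Or N) ls), N * length ls))
      else (return_pmf [], 0))"


section \<open>Probabilistic Turing machines with oracle access\<close>

text \<open>Tapes are infinite to the right; a tape is its content together with the head position.
  Symbols are numbers: blank \<open>0\<close>, left end marker \<open>1\<close>, bits \<open>2\<close> and \<open>3\<close>, and further work symbols.\<close>

type_synonym tape = "(nat \<Rightarrow> nat) \<times> nat"

definition tape_of_bits :: "bits \<Rightarrow> tape" where
  "tape_of_bits w =
     (\<lambda>i. if i = 0 then 1 else if i \<le> length w then (if w ! (i - 1) then 3 else 2) else 0, 0)"

definition bits_of_tape :: "tape \<Rightarrow> bits" where
  "bits_of_tape = (\<lambda>(t, h).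
     map (\<lambda>i. t (Suc i) = 3) [0..<(LEAST n. t (Suc n) \<notin> {2, 3})])"

datatype move = Left | Stay | Right

fun move_head :: "move \<Rightarrow> nat \<Rightarrow> nat" where
  "move_head Left h = h - 1"
| "move_head Stay h = h"
| "move_head Right h = h + 1"

definition read_tape :: "tape \<Rightarrow> nat" where
  "read_tape = (\<lambda>(t, h). t h)"

definition write_tape :: "nat \<times> move \<Rightarrow> tape \<Rightarrow> tape" where
  "write_tape = (\<lambda>(a, mv) (t, h). (t(h := a), move_head mv h))"

text \<open>The finite control is a list with one instruction per state; state \<open>0\<close> is initial. In a state
  \<open>Step \<delta>\<close> the machine tosses a fair coin and applies \<open>\<delta>\<close> to the outcome and to the symbols under the
  heads. A query state submits the content of tape 1, places the answer on tape 2, and names the next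
  state. The halting states \<open>Halt True\<close> and \<open>Halt False\<close> output 1 and 0. The input is on tape 0.\<close>

datatype instr =
    Step "bool \<Rightarrow> nat list \<Rightarrow> nat \<times> (nat \<times> move) list"
  | Query nat
  | Query_NQC nat
  | Halt bool

record ptm =
  num_tapes :: nat
  num_symbols :: nat
  program :: "instr list"

fun wf_instr :: "nat \<Rightarrow> nat \<Rightarrow> nat \<Rightarrow> instr \<Rightarrow> bool" where
  "wf_instr k g n (Step \<delta>) \<longleftrightarrow>
     (\<forall>coin as. length as = k \<and> set as \<subseteq> {..<g} \<longrightarrow>
        fst (\<delta> coin as) < n \<and> length (snd (\<delta> coin as)) = k \<and>
        fst ` set (snd (\<delta> coin as)) \<subseteq> {..<g})"
| "wf_instr k g n (Query q) \<longleftrightarrow> q < n"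
| "wf_instr k g n (Query_NQC q) \<longleftrightarrow> q < n"
| "wf_instr k g n (Halt b) \<longleftrightarrow> True"

definition wf_ptm :: "ptm \<Rightarrow> bool" where
  "wf_ptm M \<longleftrightarrow> num_tapes M \<ge> 3 \<and> num_symbols M \<ge> 4 \<and> program M \<noteq> [] \<and>
     (\<forall>I \<in> set (program M). wf_instr (num_tapes M) (num_symbols M) (length (program M)) I)"

definition no_nqc :: "ptm \<Rightarrow> bool" where
  "no_nqc M \<longleftrightarrow> (\<forall>q. Query_NQC q \<notin> set (program M))"

text \<open>A configuration records the time used so far.\<close>

record config =
  state :: nat
  tapes :: "tape list"
  time_used :: nat

definition init_config :: "ptm \<Rightarrow> bits \<Rightarrow> config" where
  "init_config M x =
     \<lparr>state = 0, tapes = tape_of_bits x # replicate (num_tapes M - 1) (tape_of_bits []),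
      time_used = 0\<rparr>"

definition answer_query :: "nat \<Rightarrow> nat \<Rightarrow> config \<Rightarrow> bits \<Rightarrow> config" where
  "answer_query q t c s =
     \<lparr>state = q, tapes = (tapes c)[2 := tape_of_bits s], time_used = time_used c + t\<rparr>"

text \<open>\<open>R\<close> is a randomized oracle that returns a distribution of answers and the time of the query.
  Each step takes time 1; a classical query takes time 1 in addition.\<close>

definition step ::
    "ptm \<Rightarrow> (bits \<Rightarrow> bits) \<Rightarrow> (bits \<Rightarrow> bits pmf \<times> nat) \<Rightarrow> config \<Rightarrow> config pmf" where
  "step M Or R c =
     (case program M ! state c of
        Step \<delta> \<Rightarrow>
          map_pmf (\<lambda>coin. let (q, acts) = \<delta> coin (map read_tape (tapes c)) in
             \<lparr>state = q, tapes = map2 write_tape acts (tapes c), time_used = time_used c + 1\<rparr>)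
            (bernoulli_pmf (1 / 2))
      | Query q \<Rightarrow> return_pmf (answer_query q 2 c (Or (bits_of_tape (tapes c ! 1))))
      | Query_NQC q \<Rightarrow>
          (case R (bits_of_tape (tapes c ! 1)) of (D, t) \<Rightarrow> map_pmf (answer_query q (1 + t) c) D)
      | Halt b \<Rightarrow> return_pmf c)"

definition run ::
    "ptm \<Rightarrow> (bits \<Rightarrow> bits) \<Rightarrow> (bits \<Rightarrow> bits pmf \<times> nat) \<Rightarrow> bits \<Rightarrow> nat \<Rightarrow> config pmf" where
  "run M Or R x t = ((\<lambda>D. bind_pmf D (step M Or R)) ^^ t) (return_pmf (init_config M x))"

definition outputs :: "ptm \<Rightarrow> bool \<Rightarrow> config set" where
  "outputs M b = {c. program M ! state c = Halt b}"

text \<open>Running time is worst case over all random outcomes. Every step takes time at least 1, so a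
  computation of total time at most \<open>T\<close> has halted after \<open>T\<close> steps.\<close>

definition decides_poly_time ::
    "ptm \<Rightarrow> (bits \<Rightarrow> bits) \<Rightarrow> (bits \<Rightarrow> bits pmf \<times> nat) \<Rightarrow> bits set \<Rightarrow> bool" where
  "decides_poly_time M Or R L \<longleftrightarrow> (\<exists>p :: nat poly. \<forall>x.
     (let T = poly p (length x); D = run M Or R x T in
       (\<forall>c \<in> set_pmf D. c \<in> outputs M True \<union> outputs M False \<and> time_used c \<le> T) \<and>
       (x \<in> L \<longrightarrow> measure_pmf.prob D (outputs M True) \<ge> 2 / 3) \<and>
       (x \<notin> L \<longrightarrow> measure_pmf.prob D (outputs M False) \<ge> 2 / 3)))"


section \<open>Complexity classes\<close>

text \<open>The randomized oracle in the definition of BPP is a dummy, as \<open>no_nqc\<close> excludes its use.\<close>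

definition BPP :: "(bits \<Rightarrow> bits) \<Rightarrow> bits set set" where
  "BPP Or = {L. \<exists>M. wf_ptm M \<and> no_nqc M \<and> decides_poly_time M Or (\<lambda>_. (return_pmf [], 0)) L}"

definition NISQ :: "(bits \<Rightarrow> bits) \<Rightarrow> bits set set" where
  "NISQ Or = {L. \<exists>lam :: real. 0 < lam \<and> lam \<le> 1 \<and>
     (\<exists>M. wf_ptm M \<and> decides_poly_time M Or (nqc lam Or) L)}"

end

theory Submission
  imports Defs "HOL-Real_Asymp.Real_Asymp"
begin

text \<open>The oracle hides, at sparse input lengths \<open>n\<close>, a random binary matrix \<open>A\<close> with \<open>n\<close> rows and
  \<open>K = 8 n\<close> columns: it labels the points of \<open>{0,1}^K\<close> by their cosets of \<open>ker A\<close>, with labels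
  scrambled by a random permutation. One query between two layers of Hadamard gates samples a uniformly
  random codeword \<open>A^T u\<close>. Depolarizing noise damps the Pauli expectations that matter by a constant
  factor per qubit, so it merely flips the bits of the codeword independently with small constant
  probability. Hence the outcome is with high probability close to a codeword with \<open>u \<noteq> 0\<close>, and to
  whoever presents such a string the oracle reveals one secret bit; the decoding is left to the oracle,
  which also supplies the code of the circuit.

  A classical machine sees fresh random labels until it queries two points of one coset, and any fixed
  string is close to a codeword with \<open>u \<noteq> 0\<close> with probability at most \<open>2^(-n)\<close> over \<open>A\<close>. So with few
  queries it misses the secret bit for some choice of matrix, permutation and bit, and a diagonalization
  over machines and polynomials gives a language that no such machine decides in polynomial time.\<close>

section \<open>Characters and Pauli expectations\<close>

text \<open>The classical obstacle is adaptivity: the queries depend on the labels and the labels on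
  the matrix \<open>A\<close>, so a union bound over \<open>A\<close> does not apply directly. The
  counting therefore compares two labellings. If the permutation labels points instead of cosets,
  the run does not depend on \<open>A\<close> and the union bound works; an injection between
  permutations transfers the estimate to coset labels.

  The code parameters meet two opposing demands. The decoding radius \<open>n\<close> must exceed
  the number of flipped bits, whose expectation at noise rate \<open>1 / 256\<close> is at most
  \<open>n / 16\<close>. Yet about \<open>2^n\<close> balls of radius \<open>n\<close> must cover at
  most a fraction \<open>2^(-n)\<close> of all strings on average; with \<open>K = 8 n\<close> this
  reads \<open>8 * (3 / 4)^8 < 1\<close>.

  Stage lengths are iterated powers of 2, so a run defeated at one stage is too short to query a
  later one, and the choices can be made one stage after another.\<close>

lemma bit_nat_bound: "bit (x::nat) i \<Longrightarrow> x < 2 ^ N \<Longrightarrow> i < N"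
  by (metis bit_take_bit_iff take_bit_nat_eq_self)

lemma nat_eq_bitwiseI:
  assumes "(x::nat) < 2 ^ N" "y < 2 ^ N" "\<And>i. i < N \<Longrightarrow> bit x i = bit y i"
  shows "x = y"
  by (rule bit_eqI) (metis assms bit_nat_bound)

lemma xor_nat_less: "(x::nat) < 2 ^ N \<Longrightarrow> y < 2 ^ N \<Longrightarrow> xor x y < 2 ^ N"
  by (metis take_bit_nat_eq_self take_bit_nat_less_exp take_bit_xor)

lemma xor_nat_cancel: "xor (xor x y) y = (x::nat)" "xor y (xor x y) = x" "xor y (xor y x) = x"
  by (auto intro!: bit_eqI simp: bit_xor_iff)

lemma sum_lessThan_double:
  fixes f :: "nat \<Rightarrow> 'a::comm_monoid_add"
  shows "(\<Sum>x<2 * m. f x) = (\<Sum>y<m. f (2 * y) + f (2 * y + 1))"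
  by (induction m) (simp_all add: ac_simps)

text \<open>The distributive law, with the choice of one term per factor recorded in the bits of
  \<open>x\<close>; the induction peels off the lowest bit. Character sums, the Hadamard kernel and
  the channel sums all reduce to it.\<close>

lemma sum_prod_bits:
  fixes F :: "nat \<Rightarrow> bool \<Rightarrow> 'a::comm_semiring_1"
  shows "(\<Sum>x<(2::nat) ^ K. \<Prod>i<K. F i (bit x i)) = (\<Prod>i<K. F i False + F i True)"
proof (induction K arbitrary: F)
  case 0
  then show ?case by simp
next
  case (Suc K)
  have "(\<Sum>x<(2::nat) ^ Suc K. \<Prod>i<Suc K. F i (bit x i))
      = (\<Sum>y<(2::nat) ^ K. (F 0 False + F 0 True) * (\<Prod>i<K. F (Suc i) (bit y i)))"
    by (simp only: power_Suc sum_lessThan_double prod.lessThan_Suc_shift)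
      (simp add: bit_Suc bit_0 distrib_right)
  also have "\<dots> = (F 0 False + F 0 True) * (\<Prod>i<K. F (Suc i) False + F (Suc i) True)"
    using Suc.IH[of "\<lambda>i. F (Suc i)"] by (simp only: sum_distrib_left[symmetric])
  finally show ?case
    by (simp only: prod.lessThan_Suc_shift)
qed

lemma sum_xor_reindex:
  assumes "h < 2 ^ N"
  shows "(\<Sum>x<2 ^ N. f (xor x h)) = (\<Sum>x<(2::nat) ^ N. f x)"
  by (rule sum.reindex_bij_witness[of _ "\<lambda>x. xor x h" "\<lambda>x. xor x h"])
    (use assms in \<open>auto simp: xor_nat_cancel xor_nat_less\<close>)

text \<open>The character \<open>(-1)^(x . y)\<close> of \<open>(Z/2)^K\<close>, as a product over
  bit positions so that \<open>sum_prod_bits\<close> applies.\<close>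

definition chi :: "nat \<Rightarrow> nat \<Rightarrow> nat \<Rightarrow> real" where
  "chi K x y = (\<Prod>i<K. if bit x i \<and> bit y i then - 1 else 1)"

lemma chi_commute: "chi K x y = chi K y x"
  unfolding chi_def by (simp add: conj_commute)

lemma chi_0 [simp]: "chi K 0 y = 1" "chi K y 0 = 1"
  by (simp_all add: chi_def)

lemma chi_xor: "chi K (xor x y) z = chi K x z * chi K y z" "chi K z (xor x y) = chi K z x * chi K z y"
  unfolding chi_def prod.distrib[symmetric] bit_xor_iff by (rule prod.cong; auto)+

lemma chi_cases: "chi K x y = 1 \<or> chi K x y = - 1"
proof -
  have "chi K x y * chi K x y = 1"
    unfolding chi_def prod.distrib[symmetric] by (rule prod.neutral) auto
  then show ?thesis by (simp add: square_eq_1_iff)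
qed

lemma chi_take_bit: "chi K (take_bit K x) y = chi K x y" "chi K y (take_bit K x) = chi K y x"
  unfolding chi_def by (auto intro!: prod.cong simp: bit_take_bit_iff)

lemma chi_extend:
  assumes "x < 2 ^ K" "K \<le> N"
  shows "chi N x y = chi K x y"
  unfolding chi_def
  by (rule prod.mono_neutral_right) (use assms(2) bit_nat_bound[OF _ assms(1)] in force)+

lemma prod_ind:
  "finite I \<Longrightarrow> (\<Prod>i\<in>I. if P i then f i else (0::'a::comm_semiring_1)) = (if \<forall>i\<in>I. P i then \<Prod>i\<in>I. f i else 0)"
  by (induction I rule: finite_induct) auto

lemma sum_chi:
  assumes "x < 2 ^ K"
  shows "(\<Sum>y<2 ^ K. chi K x y) = (if x = 0 then 2 ^ K else 0)"
proof -
  have "(\<Sum>y<2 ^ K. chi K x y) = (\<Prod>i<K. (if bit x i \<and> False then - 1 else 1) + (if bit x i \<and> True then - 1 else 1))"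
    unfolding chi_def by (rule sum_prod_bits[where K = K and F = "\<lambda>i b. if bit x i \<and> b then - 1 else 1"])
  also have "\<dots> = (\<Prod>i<K. if \<not> bit x i then 2 else 0)"
    by (intro prod.cong) auto
  also have "\<dots> = (if \<forall>i<K. \<not> bit x i then 2 ^ K else 0)"
    by (subst prod_ind) auto
  also have "(\<forall>i<K. \<not> bit x i) \<longleftrightarrow> x = 0"
    using nat_eq_bitwiseI[OF assms, of 0] by auto
  finally show ?thesis .
qed

text \<open>Up to sign, the expectation of the Pauli operator \<open>Z\<^sup>g X\<^sup>h\<close>, with bit masks \<open>g\<close>, \<open>h\<close>.\<close>

definition pexp :: "nat \<Rightarrow> nat \<Rightarrow> nat \<Rightarrow> complex mat \<Rightarrow> complex" where
  "pexp N g h \<rho> = (\<Sum>x<2 ^ N. complex_of_real (chi N g x) * \<rho> $$ (x, xor x h))"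

text \<open>Depolarizing is diagonal in the Pauli basis: the term with the partial trace annihilates
  every Pauli operator that acts on qubit \<open>i\<close> and fixes the others, for which the
  factor is \<open>(1 - lam) + lam\<close>.\<close>

lemma pexp_depolarize_qubit:
  assumes i: "i < N" and h: "h < 2 ^ N"
  shows "pexp N g h (depolarize_qubit lam N i \<rho>)
    = complex_of_real (if bit g i \<or> bit h i then 1 - lam else 1) * pexp N g h \<rho>"
proof -
  let ?c = "complex_of_real"
  let ?R = "\<lambda>x. \<rho> $$ (unset_bit i x, unset_bit i (xor x h)) + \<rho> $$ (set_bit i x, set_bit i (xor x h))"
  define S where "S = (\<Sum>x<2 ^ N. ?c (chi N g x) * ?R x)"
  have "pexp N g h (depolarize_qubit lam N i \<rho>) = (\<Sum>x<2 ^ N. ?c (chi N g x) *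
      (?c (1 - lam) * \<rho> $$ (x, xor x h) + ?c lam * ((if bit h i then 0 else 1 / 2) * ?R x)))"
    unfolding pexp_def depolarize_qubit_def
    by (intro sum.cong) (auto simp: xor_nat_less h bit_xor_iff)
  also have "\<dots> = ?c (1 - lam) * pexp N g h \<rho> + ?c lam * ((if bit h i then 0 else 1 / 2) * S)"
    unfolding pexp_def S_def
    by (simp add: sum_distrib_left sum.distrib distrib_left ac_simps)
  finally have 1: "pexp N g h (depolarize_qubit lam N i \<rho>)
    = ?c (1 - lam) * pexp N g h \<rho> + ?c lam * ((if bit h i then 0 else 1 / 2) * S)" .
  \<comment> \<open>For \<open>bit h i\<close> the partial trace contributes nothing. Otherwise the
    two entries traced are those at \<open>x\<close> and at its flip in bit \<open>i\<close>, and
    their \<open>chi N g\<close> signs are opposite exactly if \<open>bit g i\<close>.\<close>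
  have S: "S = (if bit g i then 0 else 2 * pexp N g h \<rho>)" if "\<not> bit h i"
  proof -
    have R: "?R x = \<rho> $$ (x, xor x h) + \<rho> $$ (flip_bit i x, xor (flip_bit i x) h)" for x
    proof (cases "bit x i")
      case True
      then have "set_bit i x = x" "set_bit i (xor x h) = xor x h" "unset_bit i x = flip_bit i x"
        "unset_bit i (xor x h) = xor (flip_bit i x) h" using that
        by (auto intro!: bit_eqI simp: bit_set_bit_iff bit_unset_bit_iff bit_flip_bit_iff bit_xor_iff)
      then show ?thesis by simp
    next
      case False
      then have "unset_bit i x = x" "unset_bit i (xor x h) = xor x h" "set_bit i x = flip_bit i x"
        "set_bit i (xor x h) = xor (flip_bit i x) h" using that
        by (auto intro!: bit_eqI simp: bit_set_bit_iff bit_unset_bit_iff bit_flip_bit_iff bit_xor_iff)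
      then show ?thesis by simp
    qed
    have lt: "2 ^ i < (2::nat) ^ N" using i by simp
    have flip: "flip_bit i x = xor x (2 ^ i)" for x :: nat
      by (simp add: flip_bit_eq_xor)
    have chi_i: "chi N g (2 ^ i) = (if bit g i then - 1 else 1)"
      unfolding chi_def using i
      by (subst prod.remove[of _ i]) (auto simp: bit_exp_iff intro!: prod.neutral)
    have "(\<Sum>x<2 ^ N. ?c (chi N g x) * \<rho> $$ (flip_bit i x, xor (flip_bit i x) h))
      = (\<Sum>x<2 ^ N. ?c (chi N g (xor x (2 ^ i))) * \<rho> $$ (x, xor x h))"
      using sum_xor_reindex[OF lt, of "\<lambda>x. ?c (chi N g (xor x (2 ^ i))) * \<rho> $$ (x, xor x h)"]
      unfolding flip xor_nat_cancel .
    also have "\<dots> = ?c (if bit g i then - 1 else 1) * pexp N g h \<rho>"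
      unfolding pexp_def chi_xor chi_i by (simp add: sum_distrib_left sum_negf)
    finally have "(\<Sum>x<2 ^ N. ?c (chi N g x) * \<rho> $$ (flip_bit i x, xor (flip_bit i x) h))
      = ?c (if bit g i then - 1 else 1) * pexp N g h \<rho>" .
    then show ?thesis
      unfolding S_def R by (simp add: distrib_left sum.distrib) (simp add: pexp_def)
  qed
  show ?thesis
    unfolding 1 using S by (auto simp: algebra_simps)
qed

text \<open>The damping of \<open>Z^g X^h\<close> by one round of noise: one factor per qubit on
  which the operator acts.\<close>

definition wt :: "real \<Rightarrow> nat \<Rightarrow> nat \<Rightarrow> nat \<Rightarrow> real" where
  "wt lam N g h = (\<Prod>i<N. if bit g i \<or> bit h i then 1 - lam else 1)"

lemma pexp_depolarize:
  assumes "h < 2 ^ N"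
  shows "pexp N g h (depolarize lam N \<rho>) = complex_of_real (wt lam N g h) * pexp N g h \<rho>"
proof -
  have "pexp N g h (fold (depolarize_qubit lam N) [0..<k] \<rho>)
    = complex_of_real (\<Prod>i<k. if bit g i \<or> bit h i then 1 - lam else 1) * pexp N g h \<rho>" if "k \<le> N" for k
    using that by (induction k) (auto simp: pexp_depolarize_qubit[OF _ assms])
  then show ?thesis unfolding depolarize_def wt_def by simp
qed

section \<open>Hadamard layers\<close>

definition hadamard2 :: "complex mat" where
  "hadamard2 = mat 4 4 (\<lambda>(r, c). if odd (of_bool (bit r 0 \<and> bit c 0) + of_bool (bit r 1 \<and> bit c 1) :: nat) then - 1 / 2 else 1 / 2)"

text \<open>Pairing neighbouring qubits respects the two-qubit form of a layer. The tensor square of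
  the Hadamard gate has entries \<open>1 / 2\<close> up to sign, so no square root of 2 has to be
  described.\<close>

definition hadamard_gates :: "nat \<Rightarrow> gates" where
  "hadamard_gates k = map (\<lambda>i. (2 * i, 2 * i + 1, hadamard2)) [0..<k]"

lemma pair_index_less: "pair_index i j x < 4"
  by (auto simp: pair_index_def)

lemma hadamard2_pair_index:
  "hadamard2 $$ (pair_index i j x, pair_index i j y) =
     1 / 2 * ((if bit x i \<and> bit y i then - 1 else 1) * (if bit x j \<and> bit y j then - 1 else 1))"
  unfolding hadamard2_def using pair_index_less[of i j]
  by (auto simp: pair_index_def bit_0 bit_Suc)

lemma touched_hadamard_gates: "set (touched_qubits (hadamard_gates k)) = {..<2 * k}"
proof -
  have "x \<in> (\<Union>i<k. {2 * i, Suc (2 * i)})" if "x < 2 * k" for x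
  proof (rule UN_I)
    show "x div 2 \<in> {..<k}" using that by auto
    show "x \<in> {2 * (x div 2), Suc (2 * (x div 2))}" by (cases "even x") auto
  qed
  then show ?thesis
    by (auto simp: touched_qubits_def hadamard_gates_def atLeast0LessThan)
qed

lemma distinct_touched_hadamard_gates: "distinct (touched_qubits (hadamard_gates k))"
proof (induction k)
  case 0
  then show ?case by (simp add: touched_qubits_def hadamard_gates_def)
next
  case (Suc k)
  have "touched_qubits (hadamard_gates (Suc k)) = touched_qubits (hadamard_gates k) @ [2 * k, 2 * k + 1]"
    by (simp add: touched_qubits_def hadamard_gates_def)
  then show ?case using Suc touched_hadamard_gates[of k] by auto
qed

lemma prod_lessThan_double:
  fixes f :: "nat \<Rightarrow> 'a::comm_monoid_mult"
  shows "(\<Prod>x<2 * m. f x) = (\<Prod>y<m. f (2 * y) * f (2 * y + 1))"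
  by (induction m) (simp_all add: ac_simps)

text \<open>The Hadamard transform on the first \<open>K\<close> of \<open>N\<close> qubits without
  its normalization, again in product form.\<close>

definition hkernel :: "nat \<Rightarrow> nat \<Rightarrow> nat \<Rightarrow> nat \<Rightarrow> complex" where
  "hkernel N K x y = (\<Prod>i<N. if i < K then (if bit x i \<and> bit y i then - 1 else 1) else of_bool (bit x i = bit y i))"

lemma hadamard_unitary_entry:
  assumes "x < 2 ^ N" "y < 2 ^ N" "2 * k \<le> N"
  shows "depth1_unitary N (hadamard_gates k) $$ (x, y) = (1 / 2) ^ k * hkernel N (2 * k) x y"
proof -
  have 1: "(\<Prod>(i, j, G) \<leftarrow> hadamard_gates k. G $$ (pair_index i j x, pair_index i j y))
     = (\<Prod>i<k. 1 / 2 * ((if bit x (2 * i) \<and> bit y (2 * i) then - 1 else 1)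
        * (if bit x (2 * i + 1) \<and> bit y (2 * i + 1) then - 1 else 1)))"
    unfolding hadamard_gates_def map_map o_def case_prod_conv hadamard2_pair_index
    by (simp add: interv_sum_list_conv_sum_set_nat prod.distinct_set_conv_list[symmetric] atLeast0LessThan)
  also have "\<dots> = (1 / 2) ^ k * (\<Prod>i<2 * k. if bit x i \<and> bit y i then - 1 else 1)"
    by (subst prod_lessThan_double) (simp only: prod.distrib prod_constant card_lessThan)
  finally have 2: "(\<Prod>(i, j, G) \<leftarrow> hadamard_gates k. G $$ (pair_index i j x, pair_index i j y))
    = (1 / 2) ^ k * (\<Prod>i<2 * k. if bit x i \<and> bit y i then - 1 else 1)" .
  have "hkernel N (2 * k) x y
     = (\<Prod>i<N. if i < 2 * k then (if bit x i \<and> bit y i then - 1 else 1) else 1)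
       * (\<Prod>i<N. if i < 2 * k \<or> bit x i = bit y i then 1 else 0)"
    unfolding hkernel_def prod.distrib[symmetric] by (rule prod.cong) auto
  also have "(\<Prod>i<N. if i < 2 * k then (if bit x i \<and> bit y i then - 1 else 1) else 1)
     = (\<Prod>i<2 * k. if bit x i \<and> bit y i then - 1 else (1 :: complex))"
    by (rule prod.mono_neutral_cong_right) (use assms(3) in auto)
  also have "(\<Prod>i<N. if i < 2 * k \<or> bit x i = bit y i then 1 else 0)
     = (if \<forall>i<N. i \<notin> {..<2 * k} \<longrightarrow> bit x i = bit y i then 1 else (0::complex))"
    by (subst prod_ind) auto
  finally show ?thesis
    unfolding depth1_unitary_def touched_hadamard_gates 2 using assms by (simp add: 2)
qed

lemma mat_mult_adjoint_entry:
  fixes U \<rho> :: "complex mat"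
  assumes "U \<in> carrier_mat d d" "\<rho> \<in> carrier_mat d d" "x < d" "y < d"
  shows "(U * \<rho> * mat_adjoint U) $$ (x, y) = (\<Sum>u<d. \<Sum>v<d. U $$ (x, u) * \<rho> $$ (u, v) * cnj (U $$ (y, v)))"
proof -
  have "(U * \<rho> * mat_adjoint U) $$ (x, y) = (\<Sum>v<d. (\<Sum>u<d. U $$ (x, u) * \<rho> $$ (u, v)) * cnj (U $$ (y, v)))"
    using assms by (simp add: mat_adjoint_def scalar_prod_def atLeast0LessThan mat_of_rows_def conjugate_vec_def)
  also have "\<dots> = (\<Sum>v<d. \<Sum>u<d. U $$ (x, u) * \<rho> $$ (u, v) * cnj (U $$ (y, v)))"
    by (simp add: sum_distrib_right)
  finally show ?thesis by (subst sum.swap)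
qed

lemma depth1_unitary_carrier [simp]: "depth1_unitary N gs \<in> carrier_mat (2 ^ N) (2 ^ N)"
  by (simp add: depth1_unitary_def)

lemma oracle_unitary_carrier [simp]: "oracle_unitary Or N n \<in> carrier_mat (2 ^ N) (2 ^ N)"
  by (simp add: oracle_unitary_def)

lemma cnj_hkernel [simp]: "cnj (hkernel N K x y) = hkernel N K x y"
  unfolding hkernel_def by (auto intro!: prod.cong)

text \<open>The masks after a layer of Hadamard gates on the first \<open>K\<close> qubits: there \<open>X\<close> and \<open>Z\<close> are exchanged.\<close>

definition hswap :: "nat \<Rightarrow> nat \<Rightarrow> nat \<Rightarrow> nat" where
  "hswap K g h = xor g (push_bit K (drop_bit K h))"

lemma bit_hswap: "g < 2 ^ K \<Longrightarrow> bit (hswap K g h) i = (if i < K then bit g i else bit h i)"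
  using bit_nat_bound[of g i K] by (auto simp: hswap_def bit_xor_iff bit_push_bit_iff bit_drop_bit_eq)

lemma hswap_less: "g < 2 ^ K \<Longrightarrow> h < 2 ^ N \<Longrightarrow> K \<le> N \<Longrightarrow> hswap K g h < 2 ^ N"
proof -
  assume a: "g < 2 ^ K" "h < 2 ^ N" "K \<le> N"
  have "hswap K g h = take_bit N (hswap K g h)"
    using a bit_nat_bound[OF _ a(2)] by (intro bit_eqI) (auto simp: bit_hswap bit_take_bit_iff)
  also have "\<dots> < 2 ^ N" by simp
  finally show ?thesis .
qed

text \<open>For fixed \<open>u\<close> and \<open>v\<close> the sum over \<open>x\<close>
  factorizes. A bit of \<open>x\<close> below \<open>K\<close> is free and gives 2 up to sign or
  cancels; a bit above is forced to be that of \<open>u\<close>. What survives is the single shift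
  \<open>hswap K g h\<close>.\<close>

lemma hkernel_sum:
  assumes g: "g < 2 ^ K" and h: "h < 2 ^ N" and u: "u < 2 ^ N" and v: "v < 2 ^ N" and K: "K \<le> N"
  shows "(\<Sum>x<(2::nat) ^ N. complex_of_real (chi N g x) * (hkernel N K x u * hkernel N K (xor x h) v))
    = (if v = xor u (hswap K g h) then 2 ^ K * complex_of_real (chi K h v) else 0)"
proof -
  define F :: "nat \<Rightarrow> bool \<Rightarrow> complex" where "F i b = (if bit g i \<and> b then - 1 else 1) *
     ((if i < K then (if b \<and> bit u i then - 1 else 1) else of_bool (b = bit u i)) *
      (if i < K then (if (b \<noteq> bit h i) \<and> bit v i then - 1 else 1) else of_bool ((b \<noteq> bit h i) = bit v i)))" for i b
  have "(\<Sum>x<(2::nat) ^ N. complex_of_real (chi N g x) * (hkernel N K x u * hkernel N K (xor x h) v))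
    = (\<Sum>x<(2::nat) ^ N. \<Prod>i<N. F i (bit x i))"
    unfolding chi_def hkernel_def of_real_prod prod.distrib[symmetric]
    by (intro sum.cong prod.cong refl) (simp add: F_def bit_xor_iff)
  also have "\<dots> = (\<Prod>i<N. F i False + F i True)"
    by (rule sum_prod_bits)
  also have "\<dots> = (\<Prod>i<N. if bit v i = (bit u i \<noteq> bit (hswap K g h) i)
      then (if i < K then 2 * (if bit h i \<and> bit v i then - 1 else 1) else 1) else 0)"
  proof (intro prod.cong refl)
    fix i
    \<comment> \<open>\<open>g\<close> has no bit beyond \<open>K\<close>, so no sign arises outside
      the Hadamard qubits.\<close>
    have "bit g i \<Longrightarrow> i < K" using bit_nat_bound[OF _ g] .
    then show "F i False + F i True = (if bit v i = (bit u i \<noteq> bit (hswap K g h) i)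
      then (if i < K then 2 * (if bit h i \<and> bit v i then - 1 else 1) else 1) else 0)"
      unfolding bit_hswap[OF g] F_def
      by (cases "i < K"; cases "bit g i"; cases "bit h i"; cases "bit u i"; cases "bit v i") simp_all
  qed
  also have "\<dots> = (if \<forall>i<N. bit v i = (bit u i \<noteq> bit (hswap K g h) i)
      then (\<Prod>i<N. if i < K then 2 * (if bit h i \<and> bit v i then - 1 else 1) else 1) else 0)"
    by (subst prod_ind) auto
  also have "(\<Prod>i<N. if i < K then 2 * (if bit h i \<and> bit v i then - 1 else 1) else 1)
      = (\<Prod>i<K. 2 * (if bit h i \<and> bit v i then - 1 else (1::complex)))"
    by (rule prod.mono_neutral_cong_right) (use K in auto)
  also have "\<dots> = 2 ^ K * complex_of_real (chi K h v)"
    unfolding chi_def prod.distrib of_real_prod by (auto intro!: prod.cong)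
  also have "(\<forall>i<N. bit v i = (bit u i \<noteq> bit (hswap K g h) i)) \<longleftrightarrow> v = xor u (hswap K g h)"
    using nat_eq_bitwiseI[OF v xor_nat_less[OF u hswap_less[OF g h K]]] by (auto simp: bit_xor_iff)
  finally show ?thesis .
qed

text \<open>Conjugation by Hadamard gates exchanges \<open>X\<close> and \<open>Z\<close> on the
  first \<open>K\<close> qubits and leaves the \<open>X\<close> mask elsewhere; the sign
  \<open>chi K h g\<close> comes from restoring the order of the two factors.\<close>

lemma pexp_hadamard:
  assumes g: "g < 2 ^ K" and h: "h < 2 ^ N" and K: "K = 2 * k" "K \<le> N" and \<rho>: "\<rho> \<in> carrier_mat (2 ^ N) (2 ^ N)"
  defines "U \<equiv> depth1_unitary N (hadamard_gates k)"
  shows "pexp N g h (U * \<rho> * mat_adjoint U)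
    = complex_of_real (chi K h g) * pexp N (take_bit K h) (hswap K g h) \<rho>"
proof -
  let ?c = "complex_of_real"
  have e: "U $$ (x, u) = (1 / 2) ^ k * hkernel N K x u" if "x < 2 ^ N" "u < 2 ^ N" for x u
    unfolding U_def K(1) by (rule hadamard_unitary_entry) (use that K in auto)
  have half: "(1 / 2) ^ k * (1 / 2) ^ k = (1 / 2 :: complex) ^ K"
    unfolding K(1) by (simp add: power_add[symmetric] mult_2)
  have "pexp N g h (U * \<rho> * mat_adjoint U)
    = (\<Sum>x<2 ^ N. \<Sum>u<2 ^ N. \<Sum>v<2 ^ N. (1 / 2) ^ K * (\<rho> $$ (u, v) * (?c (chi N g x) * (hkernel N K x u * hkernel N K (xor x h) v))))"
    unfolding pexp_def
  proof (rule sum.cong[OF refl])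
    fix x :: nat assume "x \<in> {..<2 ^ N}"
    then have x: "x < 2 ^ N" by simp
    show "?c (chi N g x) * (U * \<rho> * mat_adjoint U) $$ (x, xor x h) =
      (\<Sum>u<2 ^ N. \<Sum>v<2 ^ N. (1 / 2) ^ K * (\<rho> $$ (u, v) * (?c (chi N g x) * (hkernel N K x u * hkernel N K (xor x h) v))))"
      unfolding mat_mult_adjoint_entry[OF depth1_unitary_carrier[of N "hadamard_gates k", folded U_def] \<rho> x xor_nat_less[OF x h]]
        sum_distrib_left
      by (intro sum.cong refl) (simp add: e x xor_nat_less h half[symmetric] mult_ac)
  qed
  also have "\<dots> = (\<Sum>u<2 ^ N. \<Sum>v<2 ^ N. \<Sum>x<2 ^ N. (1 / 2) ^ K * (\<rho> $$ (u, v) * (?c (chi N g x) * (hkernel N K x u * hkernel N K (xor x h) v))))"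
    by (subst sum.swap) (rule sum.cong[OF refl sum.swap])
  also have "\<dots> = (\<Sum>u<2 ^ N. \<Sum>v<2 ^ N. if v = xor u (hswap K g h) then \<rho> $$ (u, v) * ?c (chi K h v) else 0)"
  proof (intro sum.cong refl)
    fix u v :: nat assume "u \<in> {..<2 ^ N}" "v \<in> {..<2 ^ N}"
    then show "(\<Sum>x<2 ^ N. (1 / 2) ^ K * (\<rho> $$ (u, v) * (?c (chi N g x) * (hkernel N K x u * hkernel N K (xor x h) v))))
      = (if v = xor u (hswap K g h) then \<rho> $$ (u, v) * ?c (chi K h v) else 0)"
      by (simp only: sum_distrib_left[symmetric] hkernel_sum[OF g h _ _ K(2)] lessThan_iff) (simp add: power_divide)
  qed
  also have "\<dots> = (\<Sum>u<2 ^ N. \<rho> $$ (u, xor u (hswap K g h)) * ?c (chi K h (xor u (hswap K g h))))"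
    by (intro sum.cong refl) (use xor_nat_less[OF _ hswap_less[OF g h K(2)]] in auto)
  also have "\<dots> = ?c (chi K h g) * pexp N (take_bit K h) (hswap K g h) \<rho>"
  proof -
    have 1: "chi K h (hswap K g h) = chi K h g"
      unfolding chi_def by (intro prod.cong refl) (simp add: bit_hswap[OF g])
    have "chi N (take_bit K h) u = chi K h u" for u
      using chi_extend[of "take_bit K h" K N u] K(2) by (simp add: chi_take_bit)
    then show ?thesis
      unfolding pexp_def sum_distrib_left chi_xor 1 by (intro sum.cong refl) (simp add: mult_ac)
  qed
  finally show ?thesis .
qed

section \<open>The initial state and Fourier inversion on blocks\<close>

lemma xor_nat_eq_0_iff: "xor a b = (0::nat) \<longleftrightarrow> a = b"
proof
  assume "xor a b = 0"
  then have "bit (xor a b) i = bit (0::nat) i" for i by simp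
  then show "a = b" by (intro bit_eqI) (simp add: bit_xor_iff)
qed simp

lemma pexp_zero_state:
  assumes "h < 2 ^ N"
  shows "pexp N g h (zero_state N) = (if h = 0 then 1 else 0)"
proof -
  have "pexp N g h (zero_state N) = (\<Sum>x<(2::nat) ^ N. if x = 0 then (if h = 0 then 1 else 0) else 0)"
    unfolding pexp_def zero_state_def by (intro sum.cong refl) (auto simp: xor_nat_less assms)
  then show ?thesis by simp
qed

lemma sum_chi_take_bit:
  assumes "a < 2 ^ K"
  shows "(\<Sum>g<2 ^ K. chi K g a * chi K g x) = (if take_bit K x = a then 2 ^ K else 0)"
proof -
  have "(\<Sum>g<2 ^ K. chi K g a * chi K g x) = (\<Sum>g<2 ^ K. chi K (xor a (take_bit K x)) g)"
    unfolding chi_xor by (simp add: chi_take_bit chi_commute)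
  also have "\<dots> = (if xor a (take_bit K x) = 0 then 2 ^ K else 0)"
    by (rule sum_chi) (simp add: xor_nat_less assms)
  also have "xor a (take_bit K x) = 0 \<longleftrightarrow> take_bit K x = a"
    unfolding xor_nat_eq_0_iff by auto
  finally show ?thesis .
qed

text \<open>The projector onto the value \<open>a\<close> of the first \<open>K\<close> qubits is
  the signed average of the \<open>Z^g\<close>. This serves the oracle layer, where the shift
  \<open>h\<close> depends on \<open>a\<close>, and with \<open>h = 0\<close> the final
  measurement.\<close>

lemma block_sum_eq_pexp:
  assumes a: "a < 2 ^ K" and K: "K \<le> N"
  shows "(\<Sum>x<2 ^ N. if take_bit K x = a then \<rho> $$ (x, xor x h) else 0)
    = (1 / 2 ^ K) * (\<Sum>g<2 ^ K. complex_of_real (chi K g a) * pexp N g h \<rho>)"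
proof -
  have "(\<Sum>g<2 ^ K. complex_of_real (chi K g a) * pexp N g h \<rho>)
     = (\<Sum>g<2 ^ K. \<Sum>x<2 ^ N. complex_of_real (chi K g a * chi K g x) * \<rho> $$ (x, xor x h))"
    unfolding pexp_def sum_distrib_left
    by (intro sum.cong refl) (simp add: chi_extend[OF _ K])
  also have "\<dots> = (\<Sum>x<2 ^ N. complex_of_real (\<Sum>g<2 ^ K. chi K g a * chi K g x) * \<rho> $$ (x, xor x h))"
    by (subst sum.swap) (simp add: sum_distrib_right)
  also have "\<dots> = 2 ^ K * (\<Sum>x<2 ^ N. if take_bit K x = a then \<rho> $$ (x, xor x h) else 0)"
    unfolding sum_chi_take_bit[OF a] sum_distrib_left by (intro sum.cong refl) simp
  finally show ?thesis by simp
qed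

section \<open>Bit strings as indices and the oracle layer\<close>

lemma index_of_bits_less: "index_of_bits s < 2 ^ length s"
  unfolding index_of_bits_def by (induction s) (auto simp: of_bool_def)

lemma bit_index_of_bits: "bit (index_of_bits s) i \<longleftrightarrow> i < length s \<and> s ! i"
  unfolding index_of_bits_def by (simp add: bit_horner_sum_bit_iff)

lemma length_bits_of_index [simp]: "length (bits_of_index n z) = n"
  by (simp add: bits_of_index_def)

lemma nth_bits_of_index [simp]: "i < n \<Longrightarrow> bits_of_index n z ! i = bit z i"
  by (simp add: bits_of_index_def)

lemma index_of_bits_of_index: "index_of_bits (bits_of_index n z) = take_bit n z"
  by (rule bit_eqI) (auto simp: bit_index_of_bits bit_take_bit_iff)

lemma bits_of_index_of_bits: "length s = n \<Longrightarrow> bits_of_index n (index_of_bits s) = s"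
  by (rule nth_equalityI) (auto simp: bit_index_of_bits)

definition oracle_value :: "(bits \<Rightarrow> bits) \<Rightarrow> nat \<Rightarrow> nat \<Rightarrow> nat" where
  "oracle_value Or n y = index_of_bits (Or (bits_of_index n y))"

definition oracle_perm :: "(bits \<Rightarrow> bits) \<Rightarrow> nat \<Rightarrow> nat \<Rightarrow> nat" where
  "oracle_perm Or n y = xor y (push_bit n (oracle_value Or n y))"

lemma oracle_value_cong:
  assumes "take_bit n x = take_bit n y"
  shows "oracle_value Or n x = oracle_value Or n y"
proof -
  have "bit x i = bit y i" if "i < n" for i
    using arg_cong[OF assms, of "\<lambda>z. bit z i"] that by (simp add: bit_take_bit_iff)
  then have "bits_of_index n x = bits_of_index n y"
    by (intro nth_equalityI) simp_all
  then show ?thesis by (simp add: oracle_value_def)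
qed

lemma take_bit_oracle_perm: "take_bit n (oracle_perm Or n y) = take_bit n y"
  unfolding oracle_perm_def
  by (rule bit_eqI) (auto simp: bit_take_bit_iff bit_xor_iff bit_push_bit_iff)

lemma oracle_perm_invol: "oracle_perm Or n (oracle_perm Or n y) = y"
  using oracle_value_cong[OF take_bit_oracle_perm[of n Or y], of Or]
  by (simp add: oracle_perm_def xor_nat_cancel)

lemma push_bit_nat_less: "c < 2 ^ m \<Longrightarrow> n + m \<le> N \<Longrightarrow> push_bit n c < (2::nat) ^ N"
proof -
  assume a: "c < 2 ^ m" "n + m \<le> N"
  have "push_bit n c = c * 2 ^ n" by (simp add: push_bit_eq_mult)
  also have "\<dots> < 2 ^ m * 2 ^ n" using a(1) by simp
  also have "\<dots> \<le> 2 ^ N" using a(2) by (simp add: power_add[symmetric] add.commute)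
  finally show ?thesis .
qed

lemma oracle_perm_less:
  assumes "\<And>s. length s = n \<Longrightarrow> length (Or s) = m" "n + m \<le> N" "y < 2 ^ N"
  shows "oracle_perm Or n y < 2 ^ N"
proof -
  have "oracle_value Or n y < 2 ^ m"
    unfolding oracle_value_def by (metis assms(1) index_of_bits_less length_bits_of_index)
  then show ?thesis
    unfolding oracle_perm_def using assms(2,3) by (intro xor_nat_less push_bit_nat_less)
qed

text \<open>The oracle unitary permutes basis vectors, so \<open>X^h\<close> turns into a shift that
  depends on the query value \<open>a\<close>: by \<open>h\<close>, and by the difference of the
  labels of \<open>a\<close> and \<open>xor a h\<close>. By \<open>pe\<close> the state has no
  expectation for a shift of the answer register, so exactly the \<open>a\<close> with equal labels
  contribute, each with weight \<open>1 / 2^K\<close>.\<close>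

lemma pexp_oracle:
  assumes len: "\<And>s. length s = K \<Longrightarrow> length (Or s) = m" and N: "K + m \<le> N"
    and \<rho>: "\<rho> \<in> carrier_mat (2 ^ N) (2 ^ N)"
    and pe: "\<And>g h'. g < 2 ^ K \<Longrightarrow> h' < 2 ^ N \<Longrightarrow>
      pexp N g h' \<rho> = complex_of_real (if g = 0 \<and> drop_bit K h' = 0 then c h' else 0)"
    and h: "h < 2 ^ K"
  defines "U \<equiv> oracle_unitary Or N K"
  shows "pexp N 0 h (U * \<rho> * mat_adjoint U)
    = complex_of_real (c h * card {a. a < 2 ^ K \<and> oracle_value Or K a = oracle_value Or K (xor a h)} / 2 ^ K)"
proof -
  let ?o = "oracle_perm Or K"
  let ?f = "oracle_value Or K"
  \<comment> \<open>The shift by \<open>h\<close> conjugated by the oracle, on the block with query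
    value \<open>a\<close>.\<close>
  define d where "d a = xor h (push_bit K (xor (?f a) (?f (xor a h))))" for a
  have KN: "K \<le> N" using N by simp
  have hN: "h < 2 ^ N" using h KN by (meson le_less_trans less_le_trans one_le_numeral power_increasing)
  have less: "y < 2 ^ N \<Longrightarrow> ?o y < 2 ^ N" for y
    by (rule oracle_perm_less[OF len N])
  have fless: "?f a < 2 ^ m" for a
    unfolding oracle_value_def by (metis len index_of_bits_less length_bits_of_index)
  have dless: "d a < 2 ^ N" for a
    unfolding d_def by (intro xor_nat_less hN push_bit_nat_less[OF _ N] fless)
  have Ue: "U $$ (x, u) = (if u = ?o x then 1 else 0)" if "x < 2 ^ N" "u < 2 ^ N" for x u
  proof -
    have "U $$ (x, u) = (if x = ?o u then 1 else 0)"
      using that unfolding U_def oracle_unitary_def by (simp add: oracle_perm_def oracle_value_def)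
    also have "x = ?o u \<longleftrightarrow> u = ?o x" by (metis oracle_perm_invol)
    finally show ?thesis .
  qed
  have conj: "(U * \<rho> * mat_adjoint U) $$ (x, y) = \<rho> $$ (?o x, ?o y)" if "x < 2 ^ N" "y < 2 ^ N" for x y
  proof -
    have "(U * \<rho> * mat_adjoint U) $$ (x, y) = (\<Sum>u<2 ^ N. \<Sum>v<2 ^ N. U $$ (x, u) * \<rho> $$ (u, v) * cnj (U $$ (y, v)))"
      unfolding U_def by (rule mat_mult_adjoint_entry) (use \<rho> that in auto)
    also have "\<dots> = (\<Sum>u<2 ^ N. \<Sum>v<2 ^ N. if v = ?o y then (if u = ?o x then \<rho> $$ (u, v) else 0) else 0)"
      by (intro sum.cong refl) (simp add: Ue that)
    also have "\<dots> = \<rho> $$ (?o x, ?o y)" using that by (simp add: less)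
    finally show ?thesis .
  qed
  have comp: "?o (xor (?o x) h) = xor x (d (take_bit K x))" for x
  proof -
    have 1: "?f (xor (?o x) h) = ?f (xor x h)"
      by (rule oracle_value_cong) (simp only: take_bit_xor take_bit_oracle_perm)
    have 2: "?f (take_bit K x) = ?f x" "?f (xor (take_bit K x) h) = ?f (xor x h)"
      by (rule oracle_value_cong, simp add: take_bit_xor)+
    have "?o (xor (?o x) h) = xor (xor (xor x (push_bit K (?f x))) h) (push_bit K (?f (xor x h)))"
      unfolding oracle_perm_def[of Or K "xor (?o x) h"] 1 by (simp add: oracle_perm_def)
    also have "\<dots> = xor x (d (take_bit K x))"
      unfolding d_def 2 push_bit_xor by (simp add: xor.assoc xor.commute xor.left_commute)
    finally show ?thesis .
  qed
  have dh: "drop_bit K (d a) = 0 \<longleftrightarrow> ?f a = ?f (xor a h)" for a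
  proof -
    have "drop_bit K (d a) = xor (?f a) (?f (xor a h))"
      using bit_nat_bound[OF _ h]
      by (intro bit_eqI) (force simp: d_def bit_drop_bit_eq bit_xor_iff bit_push_bit_iff)
    then show ?thesis by (simp add: xor_nat_eq_0_iff)
  qed
  have "pexp N 0 h (U * \<rho> * mat_adjoint U) = (\<Sum>x<2 ^ N. \<rho> $$ (?o x, ?o (xor x h)))"
    unfolding pexp_def by (intro sum.cong refl) (simp add: conj xor_nat_less hN)
  also have "\<dots> = (\<Sum>x<2 ^ N. \<rho> $$ (x, ?o (xor (?o x) h)))"
    by (rule sum.reindex_bij_witness[of _ ?o ?o]) (auto simp: oracle_perm_invol less)
  \<comment> \<open>The shift depends on \<open>x\<close> only through its query value, so the sum
    splits into blocks to which \<open>block_sum_eq_pexp\<close> applies.\<close>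
  also have "\<dots> = (\<Sum>x<2 ^ N. \<Sum>a<2 ^ K. if take_bit K x = a then \<rho> $$ (x, xor x (d a)) else 0)"
    unfolding comp by (intro sum.cong refl) (simp add: sum.delta')
  also have "\<dots> = (\<Sum>a<2 ^ K. (1 / 2 ^ K) * (\<Sum>g<2 ^ K. complex_of_real (chi K g a) * pexp N g (d a) \<rho>))"
    by (subst sum.swap) (simp add: block_sum_eq_pexp[OF _ KN])
  also have "\<dots> = (\<Sum>a<2 ^ K. (1 / 2 ^ K) * complex_of_real (if ?f a = ?f (xor a h) then c h else 0))"
  proof (intro sum.cong refl arg_cong2[where f = "(*)"])
    fix a :: nat
    have "(\<Sum>g<2 ^ K. complex_of_real (chi K g a) * pexp N g (d a) \<rho>)
      = (\<Sum>g<(2::nat) ^ K. if g = 0 then complex_of_real (if drop_bit K (d a) = 0 then c (d a) else 0) else 0)"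
      by (intro sum.cong refl) (auto simp: pe dless)
    also have "\<dots> = complex_of_real (if drop_bit K (d a) = 0 then c (d a) else 0)"
      by simp
    also have "\<dots> = complex_of_real (if ?f a = ?f (xor a h) then c h else 0)"
      unfolding dh by (auto simp: d_def)
    finally show "(\<Sum>g<2 ^ K. complex_of_real (chi K g a) * pexp N g (d a) \<rho>)
      = complex_of_real (if ?f a = ?f (xor a h) then c h else 0)" .
  qed
  also have "\<dots> = complex_of_real (c h * card {a. a < 2 ^ K \<and> ?f a = ?f (xor a h)} / 2 ^ K)"
  proof -
    have "(\<Sum>a<(2::nat) ^ K. if ?f a = ?f (xor a h) then c h else 0) = (\<Sum>a\<in>{a. a < 2 ^ K \<and> ?f a = ?f (xor a h)}. c h)"
      by (rule sum.mono_neutral_cong_right) auto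
    then show ?thesis
      by (simp only: sum_distrib_left[symmetric] of_real_sum[symmetric] sum_constant) (simp add: mult.commute)
  qed
  finally show ?thesis .
qed

section \<open>Positivity of noisy states\<close>

definition qform :: "nat \<Rightarrow> complex mat \<Rightarrow> (nat \<Rightarrow> complex) \<Rightarrow> complex" where
  "qform N \<rho> v = (\<Sum>x<2 ^ N. \<Sum>y<2 ^ N. cnj (v x) * \<rho> $$ (x, y) * v y)"

text \<open>Positivity yields nonnegative diagonal entries, without which \<open>embed_pmf\<close>
  would not be the intended distribution. It is stated for the quadratic form because conjugation
  and averaging visibly preserve it.\<close>

definition psd :: "nat \<Rightarrow> complex mat \<Rightarrow> bool" where
  "psd N \<rho> \<longleftrightarrow> (\<forall>v. 0 \<le> Re (qform N \<rho> v))"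

lemma psd_diag:
  assumes "psd N \<rho>" "x < 2 ^ N"
  shows "0 \<le> Re (\<rho> $$ (x, x))"
proof -
  have "qform N \<rho> (\<lambda>y. if y = x then 1 else 0) = (\<Sum>u<2 ^ N. if u = x then \<rho> $$ (x, x) else 0)"
    unfolding qform_def
  proof (intro sum.cong refl)
    fix u
    have "(\<Sum>y<2 ^ N. cnj (if u = x then 1 else 0) * \<rho> $$ (u, y) * (if y = x then 1 else 0))
      = (\<Sum>y<2 ^ N. if y = x then (if u = x then \<rho> $$ (x, x) else 0) else 0)"
      by (intro sum.cong refl) auto
    then show "(\<Sum>y<2 ^ N. cnj (if u = x then 1 else 0) * \<rho> $$ (u, y) * (if y = x then 1 else 0))
      = (if u = x then \<rho> $$ (x, x) else 0)" using assms(2) by simp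
  qed
  then have "qform N \<rho> (\<lambda>y. if y = x then 1 else 0) = \<rho> $$ (x, x)" using assms(2) by simp
  then show ?thesis using assms(1) unfolding psd_def by metis
qed

lemma psd_zero_state: "psd N (zero_state N)"
proof -
  have "qform N (zero_state N) v = cnj (v 0) * v 0" for v
  proof -
    have "qform N (zero_state N) v = (\<Sum>x<(2::nat) ^ N. \<Sum>y<(2::nat) ^ N. if y = 0 then (if x = 0 then cnj (v 0) * v 0 else 0) else 0)"
      unfolding qform_def zero_state_def by (intro sum.cong refl) auto
    then show ?thesis by simp
  qed
  then show ?thesis by (simp add: psd_def)
qed

text \<open>The form of the conjugated matrix at \<open>v\<close> is the form of
  \<open>\<rho>\<close> at the adjoint of \<open>U\<close> applied to \<open>v\<close>; the
  exchanges of sums only collect these two vectors.\<close>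

lemma psd_conj:
  assumes "psd N \<rho>" "U \<in> carrier_mat (2 ^ N) (2 ^ N)" "\<rho> \<in> carrier_mat (2 ^ N) (2 ^ N)"
  shows "psd N (U * \<rho> * mat_adjoint U)"
proof -
  have "qform N (U * \<rho> * mat_adjoint U) v = qform N \<rho> (\<lambda>u. \<Sum>y<2 ^ N. cnj (U $$ (y, u)) * v y)" for v
  proof -
    let ?T = "\<lambda>x y u w. cnj (v x) * (U $$ (x, u) * \<rho> $$ (u, w) * cnj (U $$ (y, w))) * v y"
    have "qform N (U * \<rho> * mat_adjoint U) v = (\<Sum>x<2 ^ N. \<Sum>y<2 ^ N. \<Sum>u<2 ^ N. \<Sum>w<2 ^ N. ?T x y u w)"
      unfolding qform_def
      by (intro sum.cong refl) (simp add: mat_mult_adjoint_entry[OF assms(2,3)] sum_distrib_left sum_distrib_right)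
    also have "\<dots> = (\<Sum>x<2 ^ N. \<Sum>u<2 ^ N. \<Sum>y<2 ^ N. \<Sum>w<2 ^ N. ?T x y u w)"
      by (rule sum.cong[OF refl]) (rule sum.swap)
    also have "\<dots> = (\<Sum>u<2 ^ N. \<Sum>x<2 ^ N. \<Sum>y<2 ^ N. \<Sum>w<2 ^ N. ?T x y u w)"
      by (rule sum.swap)
    also have "\<dots> = (\<Sum>u<2 ^ N. \<Sum>x<2 ^ N. \<Sum>w<2 ^ N. \<Sum>y<2 ^ N. ?T x y u w)"
      by (rule sum.cong[OF refl], rule sum.cong[OF refl], rule sum.swap)
    also have "\<dots> = (\<Sum>u<2 ^ N. \<Sum>w<2 ^ N. \<Sum>x<2 ^ N. \<Sum>y<2 ^ N. ?T x y u w)"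
      by (rule sum.cong[OF refl], rule sum.swap)
    also have "\<dots> = qform N \<rho> (\<lambda>u. \<Sum>y<2 ^ N. cnj (U $$ (y, u)) * v y)"
      unfolding qform_def
      by (intro sum.cong refl) (simp add: sum_distrib_left sum_distrib_right mult_ac)
    finally show ?thesis .
  qed
  then show ?thesis using assms(1) by (simp add: psd_def)
qed

text \<open>The replacement of a qubit by the maximally mixed state is the average of the conjugations with
  \<open>I, Z, X, XZ\<close>.\<close>

lemma psd_depolarize_qubit:
  assumes \<rho>: "psd N \<rho>" and i: "i < N" and lam: "0 \<le> lam" "lam \<le> 1"
  shows "psd N (depolarize_qubit lam N i \<rho>)"
proof -
  let ?c = "complex_of_real"
  define e :: nat where "e = 2 ^ i"
  define s :: "nat \<Rightarrow> complex" where "s x = (if bit x i then - 1 else 1)" for x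
  have e: "e < 2 ^ N" unfolding e_def using i by simp
  have be: "bit (xor x e) j = (if j = i then \<not> bit x i else bit x j)" for x j
    unfolding e_def by (auto simp: bit_xor_iff bit_exp_iff)
  \<comment> \<open>\<open>1 + s x * s y\<close> is 2 if the bits at \<open>i\<close> agree and 0
    otherwise; expanding the product gives the four conjugations.\<close>
  have entry: "depolarize_qubit lam N i \<rho> $$ (x, y) = ?c (1 - lam) * \<rho> $$ (x, y) +
      ?c lam / 4 * ((1 + s x * s y) * (\<rho> $$ (x, y) + \<rho> $$ (xor x e, xor y e)))"
    if "x < 2 ^ N" "y < 2 ^ N" for x y
  proof -
    have "set_bit i z = (if bit z i then z else xor z e)" "unset_bit i z = (if bit z i then xor z e else z)" for z
      by (rule bit_eqI; auto simp: be bit_set_bit_iff bit_unset_bit_iff)+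
    then show ?thesis
      unfolding depolarize_qubit_def s_def using that
      by (cases "bit x i"; cases "bit y i") (simp_all add: field_simps)
  qed
  have shift: "(\<Sum>x<2 ^ N. \<Sum>y<2 ^ N. cnj (v x) * \<rho> $$ (xor x e, xor y e) * v y) = qform N \<rho> (\<lambda>x. v (xor x e))" for v
  proof -
    have "(\<Sum>x<2 ^ N. \<Sum>y<2 ^ N. cnj (v x) * \<rho> $$ (xor x e, xor y e) * v y)
      = (\<Sum>x<2 ^ N. \<Sum>y<2 ^ N. cnj (v x) * \<rho> $$ (xor x e, y) * v (xor y e))"
    proof (rule sum.cong[OF refl])
      fix x
      show "(\<Sum>y<2 ^ N. cnj (v x) * \<rho> $$ (xor x e, xor y e) * v y) = (\<Sum>y<2 ^ N. cnj (v x) * \<rho> $$ (xor x e, y) * v (xor y e))"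
        using sum_xor_reindex[OF e, of "\<lambda>y. cnj (v x) * \<rho> $$ (xor x e, y) * v (xor y e)"]
        by (simp add: xor_nat_cancel)
    qed
    also have "\<dots> = qform N \<rho> (\<lambda>x. v (xor x e))"
      unfolding qform_def
      using sum_xor_reindex[OF e, of "\<lambda>x. \<Sum>y<2 ^ N. cnj (v (xor x e)) * \<rho> $$ (x, y) * v (xor y e)"]
      by (simp add: xor_nat_cancel)
    finally show ?thesis .
  qed
  have cs: "cnj (s x) = s x" for x by (simp add: s_def)
  have "qform N (depolarize_qubit lam N i \<rho>) v = ?c (1 - lam) * qform N \<rho> v + ?c lam / 4 *
      (qform N \<rho> v + qform N \<rho> (\<lambda>x. s x * v x) + qform N \<rho> (\<lambda>x. v (xor x e))
        + qform N \<rho> (\<lambda>x. s (xor x e) * v (xor x e)))" for v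
  proof -
    have "qform N (depolarize_qubit lam N i \<rho>) v = (\<Sum>x<2 ^ N. \<Sum>y<2 ^ N. 
      ?c (1 - lam) * (cnj (v x) * \<rho> $$ (x, y) * v y) + ?c lam / 4 * (cnj (v x) * \<rho> $$ (x, y) * v y
       + cnj (s x * v x) * \<rho> $$ (x, y) * (s y * v y) + cnj (v x) * \<rho> $$ (xor x e, xor y e) * v y
       + cnj (s x * v x) * \<rho> $$ (xor x e, xor y e) * (s y * v y)))"
      unfolding qform_def by (intro sum.cong refl) (simp add: entry cs algebra_simps)
    also have "\<dots> = ?c (1 - lam) * qform N \<rho> v + ?c lam / 4 *
      (qform N \<rho> v + qform N \<rho> (\<lambda>x. s x * v x) + qform N \<rho> (\<lambda>x. v (xor x e))
        + qform N \<rho> (\<lambda>x. s (xor x e) * v (xor x e)))"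
      unfolding shift[symmetric, of v] shift[symmetric, of "\<lambda>x. s x * v x"]
      by (simp only: sum.distrib sum_distrib_left[symmetric] qform_def)
    finally show ?thesis .
  qed
  moreover have "?c lam / 4 = ?c (lam / 4)" by simp
  ultimately show ?thesis
    using \<rho> lam unfolding psd_def by (simp del: of_real_divide of_real_diff) 
qed

lemma psd_depolarize:
  assumes "psd N \<rho>" "0 \<le> lam" "lam \<le> 1"
  shows "psd N (depolarize lam N \<rho>)"
proof -
  have "psd N (fold (depolarize_qubit lam N) [0..<k] \<rho>)" if "k \<le> N" for k
    using that by (induction k) (auto simp: assms psd_depolarize_qubit)
  then show ?thesis by (simp add: depolarize_def)
qed

lemma depolarize_carrier:
  assumes "\<rho> \<in> carrier_mat (2 ^ N) (2 ^ N)"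
  shows "depolarize lam N \<rho> \<in> carrier_mat (2 ^ N) (2 ^ N)"
proof -
  have "fold (depolarize_qubit lam N) [0..<k] \<rho> \<in> carrier_mat (2 ^ N) (2 ^ N)" for k
    using assms by (cases k) (auto simp: depolarize_qubit_def)
  then show ?thesis by (simp add: depolarize_def)
qed

lemma conj_carrier:
  fixes U :: "complex mat"
  shows "U \<in> carrier_mat d d \<Longrightarrow> \<rho> \<in> carrier_mat d d \<Longrightarrow> U * \<rho> * mat_adjoint U \<in> carrier_mat d d"
  by (auto simp: mat_adjoint_def)

section \<open>Sampling a noisy codeword\<close>

text \<open>Simon's circuit: Fourier sampling of a function that is constant on the cosets of a
  subgroup.\<close>

definition sample_layers :: "(bits \<Rightarrow> bits) \<Rightarrow> nat \<Rightarrow> nat \<Rightarrow> complex mat list" where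
  "sample_layers Or N k =
     [depth1_unitary N (hadamard_gates k), oracle_unitary Or N (2 * k), depth1_unitary N (hadamard_gates k)]"

lemma zero_state_carrier: "zero_state N \<in> carrier_mat (2 ^ N) (2 ^ N)"
  by (simp add: zero_state_def)

lemma psd_noisy_state:
  assumes "\<forall>U\<in>set Us. U \<in> carrier_mat (2 ^ N) (2 ^ N)" "0 \<le> lam" "lam \<le> 1"
  shows "psd N (noisy_state lam N Us)"
proof -
  have "psd N (fold (\<lambda>U \<rho>. depolarize lam N (U * \<rho> * mat_adjoint U)) Us \<rho>)"
    if "\<rho> \<in> carrier_mat (2 ^ N) (2 ^ N)" "psd N \<rho>" for \<rho>
    using assms that
    by (induction Us arbitrary: \<rho>) (auto intro!: depolarize_carrier conj_carrier psd_depolarize psd_conj)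
  then show ?thesis
    unfolding noisy_state_def
    by (simp add: depolarize_carrier zero_state_carrier psd_depolarize psd_zero_state assms)
qed

lemma take_bit_self_if_drop_bit_0: "drop_bit K (h::nat) = 0 \<Longrightarrow> take_bit K h = h"
  using bits_ident[of K h] by simp

lemma hswap_eq_0_iff: "g < 2 ^ K \<Longrightarrow> hswap K g h = 0 \<longleftrightarrow> g = 0 \<and> drop_bit K h = 0"
proof -
  assume g: "g < 2 ^ K"
  have "g = 0 \<and> drop_bit K h = 0" if h: "hswap K g h = 0"
  proof
    have "\<not> (if i < K then bit g i else bit h i)" for i
      using bit_hswap[OF g, of h i] h by simp
    then have "\<not> (i < K \<and> bit g i)" "\<not> bit h (K + i)" for i by (metis, metis not_add_less1)
    then show "g = 0" "drop_bit K h = 0"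
      using bit_nat_bound[OF _ g] by (auto intro!: bit_eqI simp: bit_drop_bit_eq)
  qed
  then show ?thesis by (auto simp: hswap_def)
qed

lemma wt_commute: "wt lam N g h = wt lam N h g"
  unfolding wt_def by (auto intro!: prod.cong)

text \<open>Followed backwards through the circuit, \<open>Z^g\<close> becomes \<open>X^g\<close>
  before the last Hadamard layer, contributes through the unshifted \<open>X^g\<close> at the
  oracle, and is \<open>Z^g\<close> again on the initial state. In all four rounds of noise its
  support is that of \<open>g\<close>, hence the fourth power of \<open>wt\<close>.\<close>

lemma pexp_sample_layers:
  assumes K: "K = 2 * k" and N: "K + m \<le> N" and len: "\<And>s. length s = K \<Longrightarrow> length (Or s) = m"
    and g: "g < 2 ^ K"
  shows "pexp N g 0 (noisy_state lam N (sample_layers Or N k)) = complex_of_real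
    (wt lam N 0 g ^ 4 * card {a. a < 2 ^ K \<and> oracle_value Or K a = oracle_value Or K (xor a g)} / 2 ^ K)"
proof -
  let ?c = "complex_of_real"
  let ?H = "depth1_unitary N (hadamard_gates k)"
  let ?O = "oracle_unitary Or N K"
  define r0 where "r0 = depolarize lam N (zero_state N)"
  define r1 where "r1 = depolarize lam N (?H * r0 * mat_adjoint ?H)"
  define r2 where "r2 = depolarize lam N (?O * r1 * mat_adjoint ?O)"
  define r3 where "r3 = depolarize lam N (?H * r2 * mat_adjoint ?H)"
  have KN: "K \<le> N" using N by simp
  have up: "a < 2 ^ K \<Longrightarrow> a < 2 ^ N" for a :: nat
    using KN by (meson less_le_trans one_le_numeral power_increasing)
  have c0: "r0 \<in> carrier_mat (2 ^ N) (2 ^ N)"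
    unfolding r0_def by (simp add: depolarize_carrier zero_state_carrier)
  have c1: "r1 \<in> carrier_mat (2 ^ N) (2 ^ N)"
    unfolding r1_def by (simp add: depolarize_carrier conj_carrier c0)
  have c2: "r2 \<in> carrier_mat (2 ^ N) (2 ^ N)"
    unfolding r2_def by (simp add: depolarize_carrier conj_carrier c1)
  have p0: "pexp N a h r0 = ?c (if h = 0 then wt lam N a h else 0)" if "h < 2 ^ N" for a h
    unfolding r0_def by (simp add: pexp_depolarize that pexp_zero_state)
  \<comment> \<open>Without noise the query qubits are in \<open>|+>\<close> and the answer qubits
    in \<open>|0>\<close>, so \<open>Z\<close> on the former and \<open>X\<close> on the latter have
    expectation zero; noise only rescales.\<close>
  have p1: "pexp N a h r1 = ?c (if a = 0 \<and> drop_bit K h = 0 then (wt lam N 0 h)\<^sup>2 else 0)"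
    if a: "a < 2 ^ K" and h: "h < 2 ^ N" for a h
  proof -
    have "pexp N a h r1 = ?c (wt lam N a h) * (?c (chi K h a) * pexp N (take_bit K h) (hswap K a h) r0)"
      unfolding r1_def by (simp add: pexp_depolarize h pexp_hadamard[OF a h K KN c0])
    also have "pexp N (take_bit K h) (hswap K a h) r0
      = ?c (if a = 0 \<and> drop_bit K h = 0 then wt lam N (take_bit K h) (hswap K a h) else 0)"
      by (simp add: p0 hswap_less[OF a h KN] hswap_eq_0_iff[OF a])
    also have "?c (wt lam N a h) * (?c (chi K h a) * \<dots>) = ?c (if a = 0 \<and> drop_bit K h = 0 then (wt lam N 0 h)\<^sup>2 else 0)"
      by (auto simp: take_bit_self_if_drop_bit_0 hswap_def power2_eq_square wt_commute[of lam N h 0])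
    finally show ?thesis .
  qed
  have p2: "pexp N 0 h r2 = ?c (wt lam N 0 h * ((wt lam N 0 h)\<^sup>2
      * card {a. a < 2 ^ K \<and> oracle_value Or K a = oracle_value Or K (xor a h)} / 2 ^ K))"
    if h: "h < 2 ^ K" for h
    unfolding r2_def
    by (simp add: pexp_depolarize up[OF h] pexp_oracle[OF len N c1 p1 h])
  have "pexp N g 0 r3 = ?c (wt lam N g 0) * pexp N 0 g r2"
    unfolding r3_def by (simp add: pexp_depolarize pexp_hadamard[OF g _ K KN c2] hswap_def)
  also have "\<dots> = ?c (wt lam N 0 g ^ 4
      * card {a. a < 2 ^ K \<and> oracle_value Or K a = oracle_value Or K (xor a g)} / 2 ^ K)"
    unfolding p2[OF g] of_real_mult[symmetric] wt_commute[of lam N g 0]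
    by (intro arg_cong[of _ _ ?c]) (simp add: power4_eq_xxxx power2_eq_square)
  also have "r3 = noisy_state lam N (sample_layers Or N k)"
    unfolding r3_def r2_def r1_def r0_def noisy_state_def sample_layers_def K by simp
  finally show ?thesis .
qed

section \<open>The distribution of measurement outcomes\<close>

lemma inj_on_index_of_bits: "inj_on index_of_bits {s. length s = N}"
  by (rule inj_on_inverseI[of _ "bits_of_index N"]) (simp add: bits_of_index_of_bits)

lemma index_of_bits_image: "index_of_bits ` {s. length s = N} = {..<2 ^ N}"
proof -
  have "x \<in> index_of_bits ` {s. length s = N}" if "x < 2 ^ N" for x
    using that by (intro image_eqI[of _ _ "bits_of_index N x"]) (auto simp: index_of_bits_of_index take_bit_nat_eq_self)
  then show ?thesis using index_of_bits_less by auto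
qed

lemma finite_bits_length: "finite {s :: bits. length s = N}"
  using finite_lists_length_eq[of "UNIV :: bool set" N] by simp

text \<open>\<open>embed_pmf\<close> has the prescribed probabilities once they are nonnegative and
  sum to 1: the former is positivity of the state, the latter its trace, which is the expectation
  with both masks 0.\<close>

lemma
  fixes Us :: "complex mat list"
  assumes psd: "psd N (noisy_state lam N Us)" and tr: "pexp N 0 0 (noisy_state lam N Us) = 1"
  shows set_noisy_outcome: "set_pmf (noisy_outcome lam N Us) \<subseteq> {s. length s = N}"
    and prob_noisy_outcome: "measure_pmf.prob (noisy_outcome lam N Us) {s. P (index_of_bits s)}
      = (\<Sum>x<2 ^ N. if P x then Re (noisy_state lam N Us $$ (x, x)) else 0)"
proof -
  let ?\<rho> = "noisy_state lam N Us"
  have nonneg: "0 \<le> noisy_prob lam N Us s" for s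
    unfolding noisy_prob_def using psd_diag[OF psd] index_of_bits_less by auto
  have sumP: "(\<Sum>s\<in>{s. length s = N}. if P (index_of_bits s) then noisy_prob lam N Us s else 0)
     = (\<Sum>x<2 ^ N. if P x then Re (?\<rho> $$ (x, x)) else 0)" for P
    unfolding index_of_bits_image[symmetric] sum.reindex[OF inj_on_index_of_bits] o_def
    by (rule sum.cong) (auto simp: noisy_prob_def)
  have "(\<Sum>x<2 ^ N. Re (?\<rho> $$ (x, x))) = 1"
    using arg_cong[OF tr, of Re] by (simp add: pexp_def)
  then have one: "(\<Sum>s\<in>{s. length s = N}. noisy_prob lam N Us s) = 1"
    using sumP[of "\<lambda>_. True"] by simp
  have "(\<integral>\<^sup>+ s. ennreal (noisy_prob lam N Us s) \<partial>count_space UNIV)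
     = (\<Sum>s\<in>{s. length s = N}. ennreal (noisy_prob lam N Us s))"
    by (rule nn_integral_count_space'[OF finite_bits_length]) (auto simp: noisy_prob_def)
  also have "\<dots> = 1"
    using one by (simp add: sum_ennreal nonneg)
  finally have pmf: "pmf (noisy_outcome lam N Us) s = noisy_prob lam N Us s" for s
    unfolding noisy_outcome_def by (intro pmf_embed_pmf nonneg)
  show set: "set_pmf (noisy_outcome lam N Us) \<subseteq> {s. length s = N}"
    by (auto simp: set_pmf_iff pmf noisy_prob_def split: if_splits)
  have "measure_pmf.prob (noisy_outcome lam N Us) {s. P (index_of_bits s)}
    = measure_pmf.prob (noisy_outcome lam N Us) {s. length s = N \<and> P (index_of_bits s)}"
    by (rule measure_pmf.finite_measure_eq_AE) (use set in \<open>auto simp: AE_measure_pmf_iff\<close>)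
  also have "\<dots> = (\<Sum>s\<in>{s. length s = N \<and> P (index_of_bits s)}. noisy_prob lam N Us s)"
    by (subst measure_measure_pmf_finite) (auto simp: pmf intro: finite_subset[OF _ finite_bits_length[of N]])
  also have "\<dots> = (\<Sum>s\<in>{s. length s = N}. if P (index_of_bits s) then noisy_prob lam N Us s else 0)"
    by (rule sum.mono_neutral_cong_left) (auto simp: finite_bits_length)
  finally show "measure_pmf.prob (noisy_outcome lam N Us) {s. P (index_of_bits s)}
      = (\<Sum>x<2 ^ N. if P x then Re (noisy_state lam N Us $$ (x, x)) else 0)"
    unfolding sumP .
qed

section \<open>Codewords and the binary symmetric channel\<close>

primrec codeword :: "(nat \<Rightarrow> nat) \<Rightarrow> nat \<Rightarrow> nat \<Rightarrow> nat" where
  "codeword A 0 u = 0"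
| "codeword A (Suc n) u = xor (codeword A n u) (if bit u n then A n else 0)"

lemma chi_codeword: "chi K (codeword A n u) h = (\<Prod>j<n. if bit u j then chi K (A j) h else 1)"
  by (induction n) (auto simp: chi_xor)

text \<open>Orthogonality for the code: averaging characters over all codewords gives the indicator
  of the dual code, which is the kernel of \<open>A\<close>.\<close>

lemma sum_chi_codeword:
  "(\<Sum>u<2 ^ n. chi K (codeword A n u) h) = (if \<forall>j<n. chi K (A j) h = 1 then 2 ^ n else 0)"
proof -
  have "(\<Sum>u<2 ^ n. chi K (codeword A n u) h) = (\<Prod>j<n. (if False then chi K (A j) h else 1) + (if True then chi K (A j) h else 1))"
    unfolding chi_codeword by (rule sum_prod_bits[of "\<lambda>j b. if b then chi K (A j) h else 1" n])
  also have "\<dots> = (\<Prod>j<n. if chi K (A j) h = 1 then 2 else 0)"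
    using chi_cases by (intro prod.cong refl) (auto, metis add.right_inverse)
  also have "\<dots> = (if \<forall>j<n. chi K (A j) h = 1 then 2 ^ n else 0)"
    by (subst prod_ind) auto
  finally show ?thesis .
qed

definition hdist :: "nat \<Rightarrow> nat \<Rightarrow> nat \<Rightarrow> nat" where
  "hdist K y z = card {i. i < K \<and> bit y i \<noteq> bit z i}"

lemma hdist_sum: "real (hdist K y z) = (\<Sum>i<K. if bit y i \<noteq> bit z i then 1 else 0)"
proof -
  have "(\<Sum>i<K. if bit y i \<noteq> bit z i then 1 else 0) = (\<Sum>i\<in>{i. i < K \<and> bit y i \<noteq> bit z i}. 1 :: real)"
    by (rule sum.mono_neutral_cong_right) auto
  then show ?thesis by (simp add: hdist_def)
qed

text \<open>Transition probabilities of the binary symmetric channel with error rate \<open>(1 - nu) / 2\<close>.\<close>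

definition bsc :: "real \<Rightarrow> nat \<Rightarrow> nat \<Rightarrow> nat \<Rightarrow> real" where
  "bsc nu K y z = (\<Prod>i<K. if bit y i \<noteq> bit z i then (1 - nu) / 2 else (1 + nu) / 2)"

lemma bsc_nonneg: "0 \<le> nu \<Longrightarrow> nu \<le> 1 \<Longrightarrow> 0 \<le> bsc nu K y z"
  unfolding bsc_def by (intro prod_nonneg) auto

lemma sum_bsc: "(\<Sum>y<2 ^ K. bsc nu K y z) = 1"
proof -
  have "(\<Sum>y<2 ^ K. bsc nu K y z) = (\<Prod>i<K. (if False \<noteq> bit z i then (1 - nu) / 2 else (1 + nu) / 2) + (if True \<noteq> bit z i then (1 - nu) / 2 else (1 + nu) / 2))"
    unfolding bsc_def by (rule sum_prod_bits[of "\<lambda>i b. if b \<noteq> bit z i then (1 - nu) / 2 else (1 + nu) / 2" K])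
  also have "\<dots> = 1" by (intro prod.neutral) (auto simp: field_simps)
  finally show ?thesis .
qed

lemma sum_hdist_bsc: "(\<Sum>y<2 ^ K. real (hdist K y z) * bsc nu K y z) = real K * ((1 - nu) / 2)"
proof -
  let ?q = "\<lambda>i b. if b \<noteq> bit z i then (1 - nu) / 2 else (1 + nu) / 2"
  have "(\<Sum>y<2 ^ K. (if bit y j \<noteq> bit z j then 1 else 0) * bsc nu K y z) = (1 - nu) / 2" if j: "j < K" for j
  proof -
    \<comment> \<open>The indicator of an error at bit \<open>j\<close> is absorbed into factor
      \<open>j\<close>, which keeps the summand a product over bits.\<close>
    define F where "F i b = (if i = j then (if b \<noteq> bit z j then 1 else 0) else 1) * ?q i b" for i b
    have "(\<Sum>y<2 ^ K. (if bit y j \<noteq> bit z j then 1 else 0) * bsc nu K y z) = (\<Sum>y<(2::nat) ^ K. \<Prod>i<K. F i (bit y i))"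
      unfolding F_def prod.distrib bsc_def using j by (intro sum.cong refl) (simp add: prod.delta)
    also have "\<dots> = (\<Prod>i<K. F i False + F i True)" by (rule sum_prod_bits)
    also have "\<dots> = (\<Prod>i<K. if i = j then (1 - nu) / 2 else 1)"
      by (intro prod.cong refl) (auto simp: F_def field_simps)
    also have "\<dots> = (1 - nu) / 2" using j by (simp add: prod.delta)
    finally show ?thesis .
  qed
  then have "(\<Sum>j<K. \<Sum>y<2 ^ K. (if bit y j \<noteq> bit z j then 1 else 0) * bsc nu K y z) = (\<Sum>j<K. (1 - nu) / 2)"
    by (intro sum.cong refl) blast
  also have "\<dots> = real K * ((1 - nu) / 2)"
    by simp
  finally have "(\<Sum>j<K. \<Sum>y<2 ^ K. (if bit y j \<noteq> bit z j then 1 else 0) * bsc nu K y z) = real K * ((1 - nu) / 2)" .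
  then show ?thesis
    unfolding hdist_sum sum_distrib_right by (subst sum.swap)
qed

text \<open>Markov's inequality for the number of errors; distances are integers, so exceeding
  \<open>r\<close> means at least \<open>r + 1\<close>.\<close>

lemma sum_bsc_ball:
  assumes nu: "0 \<le> nu" "nu \<le> 1"
  shows "(\<Sum>y<2 ^ K. if hdist K y z \<le> r then bsc nu K y z else 0) \<ge> 1 - real K * ((1 - nu) / 2) / (real r + 1)"
proof -
  have "bsc nu K y z - real (hdist K y z) * bsc nu K y z / (real r + 1) \<le> (if hdist K y z \<le> r then bsc nu K y z else 0)" for y
  proof (cases "hdist K y z \<le> r")
    case False
    then have "real r + 1 \<le> real (hdist K y z)" by simp
    then have "1 \<le> real (hdist K y z) / (real r + 1)" by (simp add: field_simps)
    then have "bsc nu K y z * 1 \<le> bsc nu K y z * (real (hdist K y z) / (real r + 1))"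
      by (intro mult_left_mono bsc_nonneg nu)
    then show ?thesis using False by (simp add: mult.commute)
  qed (use bsc_nonneg[OF nu] in simp)
  then have "(\<Sum>y<2 ^ K. bsc nu K y z - real (hdist K y z) * bsc nu K y z / (real r + 1))
     \<le> (\<Sum>y<2 ^ K. if hdist K y z \<le> r then bsc nu K y z else 0)"
    by (intro sum_mono) auto
  then show ?thesis
    by (simp only: sum_subtractf sum_bsc sum_divide_distrib[symmetric] sum_hdist_bsc)
qed

text \<open>\<open>u = 0\<close> is excluded because its codeword is 0 for every \<open>A\<close>:
  strings close to it could be presented without knowing anything about \<open>A\<close>.\<close>

definition near_code :: "(nat \<Rightarrow> nat) \<Rightarrow> nat \<Rightarrow> nat \<Rightarrow> nat \<Rightarrow> nat set" where
  "near_code A n K r = {y. \<exists>u<2 ^ n. u \<noteq> 0 \<and> hdist K y (codeword A n u) \<le> r}"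

text \<open>Equal syndromes: \<open>A a = A b\<close> over the field with two elements, with the
  bits of \<open>A a\<close> written as signs.\<close>

definition coset_eq :: "(nat \<Rightarrow> nat) \<Rightarrow> nat \<Rightarrow> nat \<Rightarrow> nat \<Rightarrow> nat \<Rightarrow> bool" where
  "coset_eq A n K a b \<longleftrightarrow> (\<forall>j<n. chi K (A j) a = chi K (A j) b)"

section \<open>The outcome of the sampling circuit\<close>

context
  fixes A :: "nat \<Rightarrow> nat" and n K k m N :: nat and Or :: "bits \<Rightarrow> bits" and lam :: real
  assumes K: "K = 2 * k" and N: "K + m \<le> N" and len: "\<And>s. length s = K \<Longrightarrow> length (Or s) = m"
    and cosets: "\<And>a b. a < 2 ^ K \<Longrightarrow> b < 2 ^ K \<Longrightarrow> oracle_value Or K a = oracle_value Or K b \<longleftrightarrow> coset_eq A n K a b"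
    and lam: "0 \<le> lam" "lam \<le> 1"
begin

text \<open>Whether \<open>a\<close> and \<open>xor a g\<close> lie in one coset depends on
  \<open>g\<close> alone, so the fraction of such \<open>a\<close> is 0 or 1;
  \<open>sum_chi_codeword\<close> rewrites it as an average over codewords.\<close>

lemma sample_pexp:
  assumes g: "g < 2 ^ K"
  shows "pexp N g 0 (noisy_state lam N (sample_layers Or N k)) = complex_of_real
    (wt lam N 0 g ^ 4 * (1 / 2 ^ n) * (\<Sum>u<2 ^ n. chi K (codeword A n u) g))"
proof -
  have "coset_eq A n K a (xor a g) \<longleftrightarrow> (\<forall>j<n. chi K (A j) g = 1)" for a
  proof -
    have "chi K (A j) a = chi K (A j) a * chi K (A j) g \<longleftrightarrow> chi K (A j) g = 1" for j
      using chi_cases[of K "A j" a] by auto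
    then show ?thesis by (simp add: coset_eq_def chi_xor)
  qed
  then have "card {a. a < 2 ^ K \<and> oracle_value Or K a = oracle_value Or K (xor a g)}
     = card {a. a < (2::nat) ^ K \<and> (\<forall>j<n. chi K (A j) g = 1)}"
    using cosets xor_nat_less[OF _ g] by (intro arg_cong[of _ _ card]) auto
  then have "real (card {a. a < 2 ^ K \<and> oracle_value Or K a = oracle_value Or K (xor a g)}) / 2 ^ K
     = (1 / 2 ^ n) * (\<Sum>u<2 ^ n. chi K (codeword A n u) g)"
    unfolding sum_chi_codeword by auto
  then have "wt lam N 0 g ^ 4 * real (card {a. a < 2 ^ K \<and> oracle_value Or K a = oracle_value Or K (xor a g)}) / 2 ^ K
     = wt lam N 0 g ^ 4 * (1 / 2 ^ n) * (\<Sum>u<2 ^ n. chi K (codeword A n u) g)"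
    by (simp add: field_simps)
  moreover have "pexp N g 0 (noisy_state lam N (sample_layers Or N k)) = complex_of_real
    (wt lam N 0 g ^ 4 * card {a. a < 2 ^ K \<and> oracle_value Or K a = oracle_value Or K (xor a g)} / 2 ^ K)"
    by (rule pexp_sample_layers[OF K N len g])
  ultimately show ?thesis by simp
qed

lemma sample_psd: "psd N (noisy_state lam N (sample_layers Or N k))"
  by (rule psd_noisy_state) (auto simp: sample_layers_def lam)

lemma sample_trace: "pexp N 0 0 (noisy_state lam N (sample_layers Or N k)) = 1"
proof -
  have "wt lam N 0 0 = 1" by (simp add: wt_def)
  then show ?thesis using sample_pexp[of 0] by simp
qed

text \<open>Damping the character of \<open>g\<close> by a constant factor per bit of
  \<open>g\<close> is, after Fourier inversion, independent bit flips. Hence the first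
  \<open>K\<close> qubits show a uniformly random codeword sent through a binary symmetric
  channel.\<close>

lemma sample_marginal:
  assumes y: "y < 2 ^ K"
  shows "(\<Sum>x<2 ^ N. if take_bit K x = y then Re (noisy_state lam N (sample_layers Or N k) $$ (x, x)) else 0)
    = (1 / 2 ^ n) * (\<Sum>u<2 ^ n. bsc ((1 - lam) ^ 4) K y (codeword A n u))"
proof -
  let ?\<rho> = "noisy_state lam N (sample_layers Or N k)" and ?c = "complex_of_real"
  let ?nu = "(1 - lam) ^ 4"
  have KN: "K \<le> N" using N by simp
  have wt: "wt lam N 0 g ^ 4 = (\<Prod>i<K. if bit g i then ?nu else 1)" if "g < 2 ^ K" for g
  proof -
    have "wt lam N 0 g = (\<Prod>i<K. if bit g i then 1 - lam else 1)"
      unfolding wt_def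
      by (rule prod.mono_neutral_cong_right) (use KN bit_nat_bound[OF _ that] in force)+
    then show ?thesis by (auto simp: prod_power_distrib intro!: prod.cong)
  qed
  \<comment> \<open>Summing bit \<open>i\<close> of \<open>g\<close> gives \<open>1 + ?nu\<close> or
    \<open>1 - ?nu\<close>, twice the probability that the channel keeps or flips that bit.\<close>
  have b: "(\<Sum>g<2 ^ K. chi K g y * wt lam N 0 g ^ 4 * chi K z g) = 2 ^ K * bsc ?nu K y z" for z
  proof -
    define F :: "nat \<Rightarrow> bool \<Rightarrow> real" where "F i b = (if b \<and> bit y i then - 1 else 1) * (if b then ?nu else 1) * (if bit z i \<and> b then - 1 else 1)" for i b
    have "(\<Sum>g<2 ^ K. chi K g y * wt lam N 0 g ^ 4 * chi K z g) = (\<Sum>g<(2::nat) ^ K. \<Prod>i<K. F i (bit g i))"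
      unfolding F_def prod.distrib by (intro sum.cong refl) (simp add: wt chi_def)
    also have "\<dots> = (\<Prod>i<K. F i False + F i True)" by (rule sum_prod_bits)
    also have "\<dots> = (\<Prod>i<K. 2 * (if bit y i \<noteq> bit z i then (1 - ?nu) / 2 else (1 + ?nu) / 2))"
    proof (intro prod.cong refl)
      fix i
      have "2 * ((1 - ?nu) / 2) = 1 - ?nu" "2 * ((1 + ?nu) / 2) = 1 + ?nu" by simp_all
      then show "F i False + F i True = 2 * (if bit y i \<noteq> bit z i then (1 - ?nu) / 2 else (1 + ?nu) / 2)"
        unfolding F_def by (cases "bit y i"; cases "bit z i") simp_all
    qed
    also have "\<dots> = 2 ^ K * bsc ?nu K y z"
      unfolding bsc_def by (simp only: prod.distrib prod_constant card_lessThan)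
    finally show ?thesis .
  qed
  have "(\<Sum>x<2 ^ N. if take_bit K x = y then ?\<rho> $$ (x, xor x 0) else 0)
    = (1 / 2 ^ K) * (\<Sum>g<2 ^ K. ?c (chi K g y) * pexp N g 0 ?\<rho>)"
    by (rule block_sum_eq_pexp[OF y KN])
  also have "\<dots> = (1 / 2 ^ K) * (\<Sum>g<2 ^ K. ?c (chi K g y * (wt lam N 0 g ^ 4 * (1 / 2 ^ n) * (\<Sum>u<2 ^ n. chi K (codeword A n u) g))))"
    by (intro arg_cong2[where f = "(*)"] sum.cong refl) (simp add: sample_pexp)
  also have "\<dots> = ?c ((1 / 2 ^ K) * (\<Sum>g<2 ^ K. chi K g y * (wt lam N 0 g ^ 4 * (1 / 2 ^ n) * (\<Sum>u<2 ^ n. chi K (codeword A n u) g))))"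
    by simp
  also have "(\<Sum>g<2 ^ K. chi K g y * (wt lam N 0 g ^ 4 * (1 / 2 ^ n) * (\<Sum>u<2 ^ n. chi K (codeword A n u) g)))
     = (\<Sum>u<2 ^ n. (1 / 2 ^ n) * (\<Sum>g<2 ^ K. chi K g y * wt lam N 0 g ^ 4 * chi K (codeword A n u) g))"
    unfolding sum_distrib_left by (subst sum.swap) (simp add: mult_ac)
  finally have "(\<Sum>x<2 ^ N. if take_bit K x = y then ?\<rho> $$ (x, xor x 0) else 0)
     = ?c ((1 / 2 ^ n) * (\<Sum>u<2 ^ n. bsc ?nu K y (codeword A n u)))"
    unfolding b by (simp add: sum_distrib_left)
  then have "Re (\<Sum>x<2 ^ N. if take_bit K x = y then ?\<rho> $$ (x, xor x 0) else 0)
     = (1 / 2 ^ n) * (\<Sum>u<2 ^ n. bsc ?nu K y (codeword A n u))"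
    by (simp only: Re_complex_of_real)
  then show ?thesis by (simp add: if_distrib[of Re] cong: if_cong)
qed

lemma sample_near_code:
  assumes "\<delta> = real K * ((1 - (1 - lam) ^ 4) / 2) / (real r + 1)"
  shows "measure_pmf.prob (noisy_outcome lam N (sample_layers Or N k))
      {s. take_bit K (index_of_bits s) \<in> near_code A n K r} \<ge> (1 - 1 / 2 ^ n) * (1 - \<delta>)"
proof -
  let ?\<rho> = "noisy_state lam N (sample_layers Or N k)"
  let ?nu = "(1 - lam) ^ 4" and ?W = "near_code A n K r"
  have nu: "0 \<le> ?nu" "?nu \<le> 1" using lam by (simp_all add: power_le_one)
  have "measure_pmf.prob (noisy_outcome lam N (sample_layers Or N k)) {s. take_bit K (index_of_bits s) \<in> ?W}
     = (\<Sum>x<2 ^ N. if take_bit K x \<in> ?W then Re (?\<rho> $$ (x, x)) else 0)"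
    by (rule prob_noisy_outcome[OF sample_psd sample_trace])
  also have "\<dots> = (\<Sum>x<2 ^ N. \<Sum>y<2 ^ K. if y \<in> ?W then (if take_bit K x = y then Re (?\<rho> $$ (x, x)) else 0) else 0)"
  proof (intro sum.cong refl)
    fix x
    have "(\<Sum>y<2 ^ K. if y \<in> ?W then (if take_bit K x = y then Re (?\<rho> $$ (x, x)) else 0) else 0)
      = (\<Sum>y<2 ^ K. if y = take_bit K x then (if take_bit K x \<in> ?W then Re (?\<rho> $$ (x, x)) else 0) else 0)"
      by (intro sum.cong refl) auto
    then show "(if take_bit K x \<in> ?W then Re (?\<rho> $$ (x, x)) else 0)
      = (\<Sum>y<2 ^ K. if y \<in> ?W then (if take_bit K x = y then Re (?\<rho> $$ (x, x)) else 0) else 0)"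
      by simp
  qed
  also have "\<dots> = (\<Sum>y<2 ^ K. if y \<in> ?W then (1 / 2 ^ n) * (\<Sum>u<2 ^ n. bsc ?nu K y (codeword A n u)) else 0)"
    by (subst sum.swap) (intro sum.cong refl, simp add: sample_marginal)
  finally have e1: "measure_pmf.prob (noisy_outcome lam N (sample_layers Or N k)) {s. take_bit K (index_of_bits s) \<in> ?W}
     = (\<Sum>y<2 ^ K. if y \<in> ?W then (1 / 2 ^ n) * (\<Sum>u<2 ^ n. bsc ?nu K y (codeword A n u)) else 0)" .
  \<comment> \<open>If \<open>y\<close> lies in the ball around the codeword of some
    \<open>u\<close> other than 0, then \<open>y\<close> is in \<open>?W\<close>. So restricting
    each such \<open>u\<close> to its own ball only loses probability.\<close>
  have e2: "(\<Sum>y<2 ^ K. if y \<in> ?W then (1 / 2 ^ n) * (\<Sum>u<2 ^ n. bsc ?nu K y (codeword A n u)) else 0) \<ge> (\<Sum>y<2 ^ K. (1 / 2 ^ n) * (\<Sum>u\<in>{..<2 ^ n} - {0}. if hdist K y (codeword A n u) \<le> r then bsc ?nu K y (codeword A n u) else 0))"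
  proof (rule sum_mono)
    fix y
    have "(\<Sum>u\<in>{..<2 ^ n} - {0}. if hdist K y (codeword A n u) \<le> r then bsc ?nu K y (codeword A n u) else 0)
      \<le> (if y \<in> ?W then \<Sum>u<2 ^ n. bsc ?nu K y (codeword A n u) else 0)"
    proof (cases "y \<in> ?W")
      case True
      have "(\<Sum>u\<in>{..<2 ^ n} - {0}. if hdist K y (codeword A n u) \<le> r then bsc ?nu K y (codeword A n u) else 0)
         \<le> (\<Sum>u\<in>{..<2 ^ n} - {0}. bsc ?nu K y (codeword A n u))"
        by (intro sum_mono) (simp add: bsc_nonneg[OF nu])
      also have "\<dots> \<le> (\<Sum>u<2 ^ n. bsc ?nu K y (codeword A n u))"
        by (intro sum_mono2) (auto simp: bsc_nonneg[OF nu])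
      finally show ?thesis using True by simp
    next
      case False
      then have "\<not> hdist K y (codeword A n u) \<le> r" if "u \<in> {..<2 ^ n} - {0}" for u
        using that unfolding near_code_def by blast
      then have "(\<Sum>u\<in>{..<2 ^ n} - {0}. if hdist K y (codeword A n u) \<le> r then bsc ?nu K y (codeword A n u) else 0) = 0"
        by (intro sum.neutral) simp
      then show ?thesis unfolding if_not_P[OF False] by (rule eq_refl)
    qed
    then have "(1 / 2 ^ n) * (\<Sum>u\<in>{..<2 ^ n} - {0}. if hdist K y (codeword A n u) \<le> r then bsc ?nu K y (codeword A n u) else 0)
      \<le> (1 / 2 ^ n) * (if y \<in> ?W then \<Sum>u<2 ^ n. bsc ?nu K y (codeword A n u) else 0)"
      by (rule mult_left_mono) simp
    also have "\<dots> = (if y \<in> ?W then (1 / 2 ^ n) * (\<Sum>u<2 ^ n. bsc ?nu K y (codeword A n u)) else 0)"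
      by (cases "y \<in> ?W") (simp_all only: if_True if_False mult_zero_right)
    finally show "(1 / 2 ^ n) * (\<Sum>u\<in>{..<2 ^ n} - {0}. if hdist K y (codeword A n u) \<le> r then bsc ?nu K y (codeword A n u) else 0)
      \<le> (if y \<in> ?W then (1 / 2 ^ n) * (\<Sum>u<2 ^ n. bsc ?nu K y (codeword A n u)) else 0)"
      .
  qed
  have e3: "(\<Sum>y<2 ^ K. (1 / 2 ^ n) * (\<Sum>u\<in>{..<2 ^ n} - {0}. if hdist K y (codeword A n u) \<le> r then bsc ?nu K y (codeword A n u) else 0))
     = (1 / 2 ^ n) * (\<Sum>u\<in>{..<2 ^ n} - {0}. \<Sum>y<2 ^ K. if hdist K y (codeword A n u) \<le> r then bsc ?nu K y (codeword A n u) else 0)"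
    unfolding sum_distrib_left[symmetric] by (subst sum.swap) (rule refl)
  have e4: "\<dots> \<ge> (1 / 2 ^ n) * (\<Sum>u\<in>{..<(2::nat) ^ n} - {0}. 1 - \<delta>)"
    unfolding assms by (intro mult_left_mono sum_mono sum_bsc_ball nu) auto
  have e5: "(1 / 2 ^ n) * (\<Sum>u\<in>{..<(2::nat) ^ n} - {0}. 1 - \<delta>) = (1 - 1 / 2 ^ n) * (1 - \<delta>)"
    by (simp add: card_Diff_singleton of_nat_diff field_simps)
  show ?thesis
    using order_trans[OF e4 e2[unfolded e3]] unfolding e1 e5 .
qed

end

section \<open>Counting random codes\<close>

abbreviation row_maps :: "nat \<Rightarrow> nat \<Rightarrow> (nat \<Rightarrow> nat) set" where
  "row_maps n K \<equiv> PiE {..<n} (\<lambda>_. {..<2 ^ K})"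

lemma card_row_maps: "card (row_maps n K) = (2 ^ K) ^ n"
  by (simp add: card_PiE)

lemma finite_row_maps: "finite (row_maps n K)"
  by (simp add: finite_PiE)

lemma row_maps_nonempty: "row_maps n K \<noteq> {}"
  by (simp add: PiE_eq_empty_iff) (metis empty_iff lessThan_iff zero_less_numeral zero_less_power)

lemma card_chi_eq_1:
  assumes "h < 2 ^ K" "h \<noteq> 0"
  shows "2 * card {a. a < 2 ^ K \<and> chi K a h = 1} = 2 ^ K"
proof -
  have "(\<Sum>a<2 ^ K. chi K a h) = 0"
    using sum_chi[OF assms(1)] assms(2) by (simp add: chi_commute)
  moreover have "(\<Sum>a<2 ^ K. chi K a h) = (\<Sum>a<(2::nat) ^ K. 2 * (if chi K a h = 1 then 1 else 0) - 1)"
  proof (rule sum.cong[OF refl])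
    fix a show "chi K a h = 2 * (if chi K a h = 1 then 1 else 0) - 1"
      using chi_cases[of K a h] by auto
  qed
  moreover have "(\<Sum>a<(2::nat) ^ K. (if chi K a h = 1 then 1 else 0 :: real)) = (\<Sum>a\<in>{a. a < 2 ^ K \<and> chi K a h = 1}. 1)"
    by (rule sum.mono_neutral_cong_right) auto
  ultimately have "2 * real (card {a. a < 2 ^ K \<and> chi K a h = 1}) - 2 ^ K = 0"
    by (simp add: sum_subtractf sum_distrib_left[symmetric])
  then have "real (2 * card {a. a < 2 ^ K \<and> chi K a h = 1}) = real (2 ^ K)" by simp
  then show ?thesis by (simp only: of_nat_eq_iff)
qed

lemma coset_eq_xor: "coset_eq A n K a b \<longleftrightarrow> (\<forall>j<n. chi K (A j) (xor a b) = 1)"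
proof -
  have "chi K (A j) a = chi K (A j) b \<longleftrightarrow> chi K (A j) a * chi K (A j) b = 1" for j
    using chi_cases[of K "A j" a] chi_cases[of K "A j" b] by auto
  then show ?thesis by (simp add: coset_eq_def chi_xor)
qed

text \<open>\<open>xor a b\<close> is not 0, so each row is orthogonal to it with probability 1/2,
  and the rows are independent.\<close>

lemma card_coset_eq:
  assumes "a < 2 ^ K" "b < 2 ^ K" "a \<noteq> b"
  shows "card {A \<in> row_maps n K. coset_eq A n K a b} * 2 ^ n = card (row_maps n K)"
proof -
  let ?h = "xor a b"
  let ?C = "{c. c < 2 ^ K \<and> chi K c ?h = 1}"
  have C: "2 * card ?C = 2 ^ K"
  proof (rule card_chi_eq_1[OF xor_nat_less[OF assms(1,2)]])
    show "xor a b \<noteq> 0" using assms(3) unfolding xor_nat_eq_0_iff .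
  qed
  have "{A \<in> row_maps n K. coset_eq A n K a b} = PiE {..<n} (\<lambda>_. ?C)"
    unfolding set_eq_iff coset_eq_xor PiE_iff mem_Collect_eq lessThan_iff Ball_def by blast
  then have "card {A \<in> row_maps n K. coset_eq A n K a b} * 2 ^ n = card ?C ^ n * 2 ^ n"
    by (simp add: card_PiE)
  also have "\<dots> = (2 * card ?C) ^ n"
    by (simp add: power_mult_distrib)
  finally show ?thesis unfolding C card_row_maps .
qed

lemma codeword_update:
  "codeword (A(j := a)) n u = (if j < n \<and> bit u j then xor (xor (codeword A n u) (A j)) a else codeword A n u)"
proof (induction n)
  case (Suc n)
  show ?case
  proof (cases "j = n")
    case True
    then show ?thesis using Suc by (simp add: xor_nat_cancel)
  next
    case False
    then show ?thesis using Suc by (simp add: less_Suc_eq xor.assoc xor.commute xor.left_commute)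
  qed
qed simp

lemma codeword_less: "A \<in> row_maps n K \<Longrightarrow> k \<le> n \<Longrightarrow> codeword A k u < 2 ^ K"
proof (induction k)
  case (Suc k)
  then have "A k < 2 ^ K" by (metis PiE_mem Suc_le_lessD lessThan_iff)
  then have "(if bit u k then A k else 0) < 2 ^ K" by simp
  then show ?case using Suc by (simp add: xor_nat_less)
qed simp

text \<open>For \<open>u\<close> other than 0 the codeword is uniformly distributed: if
  \<open>u\<close> selects row \<open>j\<close>, the codeword and the other rows determine row
  \<open>j\<close>.\<close>

lemma card_codeword:
  assumes "u < 2 ^ n" "u \<noteq> 0" "finite S"
  shows "card {A \<in> row_maps n K. codeword A n u \<in> S} * 2 ^ K \<le> card S * card (row_maps n K)"
proof -
  obtain j where j: "j < n" "bit u j"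
    using nat_eq_bitwiseI[OF assms(1), of 0] assms(2) by auto
  let ?B = "PiE {..<n} (\<lambda>i. if i = j then {0} else {..<2 ^ K}) :: (nat \<Rightarrow> nat) set"
  let ?T = "{A \<in> row_maps n K. codeword A n u \<in> S}"
  let ?f = "\<lambda>A. (A(j := 0), codeword A n u)"
  have "inj_on ?f ?T"
  proof (rule inj_onI)
    fix A B assume "?f A = ?f B"
    then have e: "A(j := 0) = B(j := 0)" and c: "codeword A n u = codeword B n u" by auto
    have "xor (codeword A n u) (A j) = xor (codeword B n u) (B j)"
      using codeword_update[of A j 0 n u] codeword_update[of B j 0 n u] e j by simp
    then have "A j = B j" unfolding c by (metis xor_nat_cancel(3))
    then show "A = B" using e by (metis fun_upd_triv fun_upd_upd)
  qed
  moreover have "?f ` ?T \<subseteq> ?B \<times> S"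
    using j by (auto simp: PiE_iff extensional_def split: if_splits)
  moreover have "finite (?B \<times> S)"
    using assms(3) by (intro finite_cartesian_product finite_PiE) auto
  ultimately have "card ?T \<le> card (?B \<times> S)"
    by (rule card_inj_on_le)
  also have "\<dots> = card S * card ?B" unfolding card_cartesian_product by (rule mult.commute)
  finally have "card ?T * 2 ^ K \<le> card S * (card ?B * 2 ^ K)"
    unfolding mult.assoc[symmetric] by (rule mult_right_mono) simp
  also have "card ?B * 2 ^ K = card (row_maps n K)"
  proof -
    have "card ?B = (\<Prod>i\<in>{..<n} - {j}. 2 ^ K)"
      unfolding card_PiE[OF finite_lessThan] using j by (simp add: prod.remove[of "{..<n}" j])
    then have "card ?B * 2 ^ K = (\<Prod>i<n. 2 ^ K)"
      using j by (simp only: prod.remove[of "{..<n}" j] finite_lessThan lessThan_iff mult.commute)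
    then show ?thesis by (simp add: card_row_maps)
  qed
  finally show ?thesis .
qed

text \<open>Weigh each string by \<open>(1 / 2)\<close> to the power of its distance from
  \<open>w\<close>. The total weight factorizes to \<open>(3 / 2) ^ K\<close>, and every point of
  the ball has weight at least \<open>(1 / 2) ^ r\<close>.\<close>

lemma card_ball: "real (card {z. z < 2 ^ K \<and> hdist K w z \<le> r}) \<le> 2 ^ r * (3 / 2) ^ K"
proof -
  let ?S = "{z. z < (2::nat) ^ K \<and> hdist K w z \<le> r}"
  have h: "(1 / 2) ^ hdist K w z = (\<Prod>i<K. if bit w i \<noteq> bit z i then 1 / 2 else (1::real))" for z
  proof -
    have "(\<Prod>i<K. if bit w i \<noteq> bit z i then 1 / 2 else (1::real)) = (\<Prod>i\<in>{i. i < K \<and> bit w i \<noteq> bit z i}. 1 / 2)"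
      by (rule prod.mono_neutral_cong_right) auto
    then show ?thesis by (simp only: hdist_def prod_constant)
  qed
  have "real (card ?S) * (1 / 2) ^ r = (\<Sum>z\<in>?S. (1 / 2) ^ r)" by simp
  also have "\<dots> \<le> (\<Sum>z\<in>?S. (1 / 2) ^ hdist K w z)"
    by (intro sum_mono power_decreasing) auto
  also have "\<dots> \<le> (\<Sum>z<2 ^ K. (1 / 2) ^ hdist K w z)"
    by (intro sum_mono2) auto
  also have "\<dots> = (\<Prod>i<K. (if bit w i \<noteq> False then 1 / 2 else 1) + (if bit w i \<noteq> True then 1 / 2 else 1))"
    unfolding h by (rule sum_prod_bits[of "\<lambda>i b. if bit w i \<noteq> b then 1 / 2 else 1" K])
  also have "\<dots> = (\<Prod>i<K. 3 / 2)" by (intro prod.cong) auto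
  also have "\<dots> = (3 / 2) ^ K" by simp
  finally have "real (card ?S) * (1 / 2) ^ r * 2 ^ r \<le> (3 / 2) ^ K * 2 ^ r"
    by (rule mult_right_mono) simp
  then show ?thesis by (simp add: power_one_over mult.commute)
qed

text \<open>A union bound over the nonzero \<open>u\<close>: the codeword of each is uniform, so it
  hits the ball around \<open>w\<close> with probability proportional to the size of the
  ball.\<close>

lemma card_near_code:
  "card {A \<in> row_maps n (8 * n). w \<in> near_code A n (8 * n) n} * 2 ^ n \<le> card (row_maps n (8 * n))"
proof -
  let ?K = "8 * n"
  let ?S = "{z. z < (2::nat) ^ ?K \<and> hdist ?K w z \<le> n}"
  let ?R = "card (row_maps n ?K)"
  have "{A \<in> row_maps n ?K. w \<in> near_code A n ?K n}
     \<subseteq> (\<Union>u\<in>{u. u < 2 ^ n \<and> u \<noteq> 0}. {A \<in> row_maps n ?K. codeword A n u \<in> ?S})"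
    using codeword_less[of _ n ?K n] by (auto simp: near_code_def)
  then have "card {A \<in> row_maps n ?K. w \<in> near_code A n ?K n}
     \<le> card (\<Union>u\<in>{u. u < 2 ^ n \<and> u \<noteq> 0}. {A \<in> row_maps n ?K. codeword A n u \<in> ?S})"
    by (intro card_mono finite_UN_I) (auto simp: finite_row_maps)
  also have "\<dots> \<le> (\<Sum>u\<in>{u. u < 2 ^ n \<and> u \<noteq> 0}. card {A \<in> row_maps n ?K. codeword A n u \<in> ?S})"
    by (rule card_UN_le) simp
  finally have "real (card {A \<in> row_maps n ?K. w \<in> near_code A n ?K n})
     \<le> (\<Sum>u\<in>{u. u < 2 ^ n \<and> u \<noteq> 0}. real (card {A \<in> row_maps n ?K. codeword A n u \<in> ?S}))"
    unfolding of_nat_sum[symmetric] by (rule of_nat_mono)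
  also have "\<dots> \<le> (\<Sum>u\<in>{u. u < (2::nat) ^ n \<and> u \<noteq> 0}. 2 ^ n * (3 / 2) ^ ?K * real ?R / 2 ^ ?K)"
  proof (rule sum_mono)
    fix u :: nat assume "u \<in> {u. u < 2 ^ n \<and> u \<noteq> 0}"
    then have "card {A \<in> row_maps n ?K. codeword A n u \<in> ?S} * 2 ^ ?K \<le> card ?S * ?R"
      by (intro card_codeword) auto
    then have "real (card {A \<in> row_maps n ?K. codeword A n u \<in> ?S} * 2 ^ ?K) \<le> real (card ?S * ?R)"
      by (rule of_nat_mono)
    then have "real (card {A \<in> row_maps n ?K. codeword A n u \<in> ?S}) * 2 ^ ?K \<le> real (card ?S) * real ?R"
      unfolding of_nat_mult of_nat_power of_nat_numeral .
    also have "\<dots> \<le> 2 ^ n * (3 / 2) ^ ?K * real ?R"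
      by (intro mult_right_mono card_ball) simp
    finally show "real (card {A \<in> row_maps n ?K. codeword A n u \<in> ?S}) \<le> 2 ^ n * (3 / 2) ^ ?K * real ?R / 2 ^ ?K"
      by (subst pos_le_divide_eq) simp_all
  qed
  also have "\<dots> = real (card {u. u < (2::nat) ^ n \<and> u \<noteq> 0}) * (2 ^ n * (3 / 2) ^ ?K * real ?R / 2 ^ ?K)"
    by (rule sum_constant)
  also have "\<dots> \<le> 2 ^ n * (2 ^ n * (3 / 2) ^ ?K * real ?R / 2 ^ ?K)"
  proof (rule mult_right_mono)
    have "card {u. u < (2::nat) ^ n \<and> u \<noteq> 0} \<le> card {..<(2::nat) ^ n}"
      by (intro card_mono) auto
    then have "real (card {u. u < (2::nat) ^ n \<and> u \<noteq> 0}) \<le> real (card {..<(2::nat) ^ n})"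
      by (rule of_nat_mono)
    then show "real (card {u. u < (2::nat) ^ n \<and> u \<noteq> 0}) \<le> 2 ^ n"
      unfolding card_lessThan of_nat_power of_nat_numeral .
  qed simp
  finally have "real (card {A \<in> row_maps n ?K. w \<in> near_code A n ?K n}) * 2 ^ n
     \<le> 2 ^ n * (2 ^ n * (3 / 2) ^ ?K * real ?R / 2 ^ ?K) * 2 ^ n"
    by (rule mult_right_mono) simp
  \<comment> \<open>The three factors 2 come from the number of \<open>u\<close>, from the radius
    \<open>n\<close> in \<open>card_ball\<close> and from the bound to be shown;
    \<open>6561 / 65536\<close> is \<open>(3 / 4) ^ 8\<close>, and the base is below 1.\<close>
  also have "\<dots> = (2 * 2 * 2 * (6561 / 65536)) ^ n * real ?R"
  proof -
    have "(3 / 2 :: real) ^ ?K = (6561 / 256) ^ n" "(2 :: real) ^ ?K = 256 ^ n"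
      unfolding power_mult by (simp_all add: power_divide)
    moreover have r: "(6561 / 256 :: real) ^ n / 256 ^ n = (6561 / 65536) ^ n"
      unfolding power_divide[symmetric] by simp
    moreover have "2 ^ n * (2 ^ n * a * r / b) * 2 ^ n = 2 ^ n * 2 ^ n * 2 ^ n * (a / b) * (r :: real)" for a b r
      by simp
    ultimately show ?thesis unfolding power_mult_distrib by presburger
  qed
  also have "\<dots> \<le> 1 * real ?R"
    by (rule mult_right_mono[OF power_le_one]) simp_all
  finally have "real (card {A \<in> row_maps n ?K. w \<in> near_code A n ?K n} * 2 ^ n) \<le> real ?R"
    unfolding of_nat_mult of_nat_power of_nat_numeral mult_1 .
  then show ?thesis by (simp only: of_nat_le_iff)
qed

section \<open>Runs of oracle machines\<close>

text \<open>\<open>wf_instr\<close> constrains a transition function only on reads of the right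
  length over the alphabet; this invariant keeps all reads there.\<close>

definition valid_config :: "ptm \<Rightarrow> config \<Rightarrow> bool" where
  "valid_config M c \<longleftrightarrow> state c < length (program M) \<and> length (tapes c) = num_tapes M \<and>
     (\<forall>T \<in> set (tapes c). \<forall>i. fst T i < num_symbols M)"

lemma tape_of_bits_symbol: "fst (tape_of_bits w) i < 4"
  by (simp add: tape_of_bits_def)

lemma valid_init_config:
  assumes "wf_ptm M"
  shows "valid_config M (init_config M x)"
proof -
  have "4 \<le> num_symbols M" "3 \<le> num_tapes M" "program M \<noteq> []"
    using assms by (auto simp: wf_ptm_def)
  then show ?thesis
    using less_le_trans[OF tape_of_bits_symbol]
    by (auto simp: valid_config_def init_config_def)
qed

lemma valid_answer_query:
  assumes "wf_ptm M" "valid_config M c" "q < length (program M)"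
  shows "valid_config M (answer_query q t c s)"
proof -
  have "fst (tape_of_bits s) i < num_symbols M" for i
    using tape_of_bits_symbol[of s i] assms(1) by (auto simp: wf_ptm_def)
  then have "\<forall>T \<in> insert (tape_of_bits s) (set (tapes c)). \<forall>i. fst T i < num_symbols M"
    using assms(2) by (simp add: valid_config_def)
  then have "\<forall>T \<in> set ((tapes c)[2 := tape_of_bits s]). \<forall>i. fst T i < num_symbols M"
    using set_update_subset_insert[of "tapes c" 2 "tape_of_bits s"] by blast
  then show ?thesis
    using assms(2,3) by (simp add: valid_config_def answer_query_def)
qed

lemma read_tapes_valid:
  assumes "valid_config M c"
  shows "length (map read_tape (tapes c)) = num_tapes M"
    "set (map read_tape (tapes c)) \<subseteq> {..<num_symbols M}"
  using assms by (auto simp: valid_config_def read_tape_def split: prod.splits)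

lemma valid_map2_write_tape:
  assumes "length acts = length ts" "fst ` set acts \<subseteq> {..<g}" "\<forall>T\<in>set ts. \<forall>i. fst T i < g"
  shows "\<forall>T\<in>set (map2 write_tape acts ts). \<forall>i. fst T i < (g::nat)"
  using assms
proof (induction acts ts rule: list_induct2)
  case (Cons a as T ts)
  obtain s mv where a: "a = (s, mv)" by (cases a)
  obtain t h where T: "T = (t, h)" by (cases T)
  show ?case using Cons by (auto simp: a T write_tape_def)
qed simp

lemma program_nth_wf:
  assumes "wf_ptm M" "valid_config M c"
  shows "program M ! state c \<in> set (program M)"
    "wf_instr (num_tapes M) (num_symbols M) (length (program M)) (program M ! state c)"
  using assms by (auto simp: wf_ptm_def valid_config_def)

lemma valid_step:
  assumes M: "wf_ptm M" and c: "valid_config M c" and c': "c' \<in> set_pmf (step M Or R c)"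
  shows "valid_config M c'"
proof (cases "program M ! state c")
  case (Step \<delta>)
  from c' obtain coin where c'_eq: "c' = (let (q, acts) = \<delta> coin (map read_tape (tapes c)) in
       \<lparr>state = q, tapes = map2 write_tape acts (tapes c), time_used = time_used c + 1\<rparr>)"
    by (auto simp: step_def Step)
  obtain q acts where qa: "\<delta> coin (map read_tape (tapes c)) = (q, acts)" by fastforce
  have "\<forall>coin as. length as = num_tapes M \<and> set as \<subseteq> {..<num_symbols M} \<longrightarrow>
        fst (\<delta> coin as) < length (program M) \<and> length (snd (\<delta> coin as)) = num_tapes M \<and>
        fst ` set (snd (\<delta> coin as)) \<subseteq> {..<num_symbols M}"
    using program_nth_wf(2)[OF M c] unfolding Step by simp
  from this[rule_format, of "map read_tape (tapes c)" coin] read_tapes_valid[OF c]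
  have "q < length (program M)" "length acts = num_tapes M" "fst ` set acts \<subseteq> {..<num_symbols M}"
    using qa by auto
  then show ?thesis
    using c valid_map2_write_tape[of acts "tapes c" "num_symbols M"] unfolding c'_eq qa
    by (auto simp: valid_config_def)
next
  case (Query q)
  then show ?thesis
    using c' program_nth_wf(2)[OF M c] valid_answer_query[OF M c] by (auto simp: step_def)
next
  case (Query_NQC q)
  then show ?thesis
    using c' program_nth_wf(2)[OF M c] valid_answer_query[OF M c]
    by (auto simp: step_def split: prod.splits)
next
  case (Halt b)
  then show ?thesis using c c' by (auto simp: step_def)
qed

lemma run_0: "run M Or R x 0 = return_pmf (init_config M x)"
  by (simp add: run_def)

lemma run_Suc: "run M Or R x (Suc t) = bind_pmf (run M Or R x t) (step M Or R)"
  by (simp add: run_def)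

lemma valid_run:
  assumes "wf_ptm M"
  shows "c \<in> set_pmf (run M Or R x t) \<Longrightarrow> valid_config M c"
proof (induction t arbitrary: c)
  case 0
  then show ?case using valid_init_config[OF assms] by (simp add: run_0)
next
  case (Suc t)
  then obtain c' where "c' \<in> set_pmf (run M Or R x t)" "c \<in> set_pmf (step M Or R c')"
    by (auto simp: run_Suc)
  then show ?case using valid_step[OF assms Suc.IH] by blast
qed

lemma run_no_nqc:
  assumes M: "wf_ptm M" "no_nqc M"
  shows "run M Or R x t = run M Or R' x t"
proof (induction t)
  case (Suc t)
  have "step M Or R c = step M Or R' c" if "c \<in> set_pmf (run M Or R x t)" for c
  proof -
    have "program M ! state c \<noteq> Query_NQC q" for q
      using M(2) program_nth_wf(1)[OF M(1) valid_run[OF M(1) that]] by (metis no_nqc_def)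
    then show ?thesis by (auto simp: step_def split: instr.split)
  qed
  then show ?case
    unfolding run_Suc Suc.IH[symmetric] by (intro bind_pmf_cong) auto
qed (simp add: run_0)

lemma BPP_subset_NISQ: "BPP Or \<subseteq> NISQ Or"
proof
  fix L assume "L \<in> BPP Or"
  then obtain M where M: "wf_ptm M" "no_nqc M" "decides_poly_time M Or (\<lambda>_. (return_pmf [], 0)) L"
    by (auto simp: BPP_def)
  \<comment> \<open>No noisy query is made, so any admissible noise rate serves.\<close>
  have "decides_poly_time M Or (nqc 1 Or) L"
    using M(3) unfolding decides_poly_time_def run_no_nqc[OF M(1,2), of Or "nqc 1 Or" _ _ "\<lambda>_. (return_pmf [], 0)"] .
  then show "L \<in> NISQ Or"
    using M(1) unfolding NISQ_def by (intro CollectI exI[of _ 1]) auto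
qed

section \<open>Deterministic runs\<close>

text \<open>Every step consumes a coin, even a query or a halted step, so that a run of
  \<open>t\<close> steps is a function of exactly \<open>t\<close> coins.\<close>

definition dstep :: "ptm \<Rightarrow> (bits \<Rightarrow> bits) \<Rightarrow> bool \<Rightarrow> config \<Rightarrow> config" where
  "dstep M Or coin c = (case program M ! state c of
      Step \<delta> \<Rightarrow> (let (q, acts) = \<delta> coin (map read_tape (tapes c)) in
         \<lparr>state = q, tapes = map2 write_tape acts (tapes c), time_used = time_used c + 1\<rparr>)
    | Query q \<Rightarrow> answer_query q 2 c (Or (bits_of_tape (tapes c ! 1)))
    | Query_NQC q \<Rightarrow> answer_query q 1 c []
    | Halt b \<Rightarrow> c)"

abbreviation no_oracle :: "bits \<Rightarrow> bits pmf \<times> nat" where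
  "no_oracle \<equiv> \<lambda>_. (return_pmf [], 0)"

lemma step_eq_dstep: "step M Or no_oracle c = map_pmf (\<lambda>coin. dstep M Or coin c) (bernoulli_pmf (1 / 2))"
  by (auto simp: step_def dstep_def map_pmf_const split: instr.split)

text \<open>The latest coin is at the head, so \<open>foldr\<close> executes the steps in their
  temporal order.\<close>

primrec coins :: "nat \<Rightarrow> bool list pmf" where
  "coins 0 = return_pmf []"
| "coins (Suc t) = bind_pmf (coins t) (\<lambda>cs. map_pmf (\<lambda>b. b # cs) (bernoulli_pmf (1 / 2)))"

lemma length_coins: "cs \<in> set_pmf (coins t) \<Longrightarrow> length cs = t"
  by (induction t arbitrary: cs) auto

lemma run_eq_coins:
  "run M Or no_oracle x t = map_pmf (\<lambda>cs. foldr (dstep M Or) cs (init_config M x)) (coins t)"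
proof (induction t)
  case (Suc t)
  show ?case
    unfolding run_Suc Suc.IH coins.simps map_bind_pmf bind_map_pmf step_eq_dstep
    by (simp add: map_pmf_comp)
qed (simp add: run_0)

primrec queried :: "ptm \<Rightarrow> (bits \<Rightarrow> bits) \<Rightarrow> bool list \<Rightarrow> config \<Rightarrow> bits set" where
  "queried M Or [] c = {}"
| "queried M Or (b # cs) c = queried M Or cs c \<union>
     (let c' = foldr (dstep M Or) cs c in
      case program M ! state c' of Query q \<Rightarrow> {bits_of_tape (tapes c' ! 1)} | _ \<Rightarrow> {})"

text \<open>Agreement on the strings that the run with \<open>Or\<close> queries is enough despite
  adaptivity: the answers so far fix the configuration and thereby the next query.\<close>

lemma queried_cong:
  assumes "\<And>w. w \<in> queried M Or cs c \<Longrightarrow> Or' w = Or w"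
  shows "foldr (dstep M Or') cs c = foldr (dstep M Or) cs c \<and> queried M Or' cs c = queried M Or cs c"
  using assms
proof (induction cs)
  case (Cons b cs)
  then have IH: "foldr (dstep M Or') cs c = foldr (dstep M Or) cs c" "queried M Or' cs c = queried M Or cs c"
    by auto
  have "dstep M Or' b (foldr (dstep M Or) cs c) = dstep M Or b (foldr (dstep M Or) cs c)"
    using Cons.prems by (auto simp: dstep_def Let_def split: instr.split)
  then show ?case by (simp add: IH)
qed simp

lemma finite_card_queried: "finite (queried M Or cs c) \<and> card (queried M Or cs c) \<le> length cs"
proof (induction cs)
  case (Cons b cs)
  let ?S = "let c' = foldr (dstep M Or) cs c in
      case program M ! state c' of Query q \<Rightarrow> {bits_of_tape (tapes c' ! 1)} | _ \<Rightarrow> {}"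
  have S: "finite ?S \<and> card ?S \<le> 1"
    by (auto simp: Let_def split: instr.split)
  have "card (queried M Or cs c \<union> ?S) \<le> card (queried M Or cs c) + card ?S"
    by (rule card_Un_le)
  then show ?case using Cons S by auto
qed simp

lemma valid_dstep:
  assumes "wf_ptm M" "valid_config M c"
  shows "valid_config M (dstep M Or b c)"
proof (rule valid_step[OF assms])
  have "b \<in> set_pmf (bernoulli_pmf (1 / 2))" by (simp add: set_pmf_bernoulli)
  then show "dstep M Or b c \<in> set_pmf (step M Or no_oracle c)"
    unfolding step_eq_dstep by auto
qed

lemma valid_foldr_dstep:
  assumes "wf_ptm M" "valid_config M c"
  shows "valid_config M (foldr (dstep M Or) cs c)"
  by (induction cs) (auto simp: assms valid_dstep)

lemma query_tape_bound:
  assumes M: "wf_ptm M"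
  shows "snd (tapes (foldr (dstep M Or) cs (init_config M x)) ! 1) \<le> length cs \<and>
    (\<forall>i > length cs. fst (tapes (foldr (dstep M Or) cs (init_config M x)) ! 1) i = 0)"
proof (induction cs)
  case Nil
  have "num_tapes M - 1 > 0" using M by (auto simp: wf_ptm_def)
  then show ?case by (simp add: init_config_def tape_of_bits_def)
next
  case (Cons b cs)
  let ?c = "foldr (dstep M Or) cs (init_config M x)"
  have v: "valid_config M ?c" by (intro valid_foldr_dstep valid_init_config M)
  then have l: "length (tapes ?c) = num_tapes M" and k: "1 < num_tapes M"
    using M by (auto simp: valid_config_def wf_ptm_def)
  show ?case
  proof (cases "program M ! state ?c")
    case (Step \<delta>)
    obtain q acts where qa: "\<delta> b (map read_tape (tapes ?c)) = (q, acts)" by fastforce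
    have "\<forall>coin as. length as = num_tapes M \<and> set as \<subseteq> {..<num_symbols M} \<longrightarrow> length (snd (\<delta> coin as)) = num_tapes M"
      using program_nth_wf(2)[OF M v] unfolding Step by simp
    from this[rule_format, of "map read_tape (tapes ?c)" b] read_tapes_valid[OF v]
    have "length acts = num_tapes M" using qa by simp
    then have t1: "tapes (dstep M Or b ?c) ! 1 = write_tape (acts ! 1) (tapes ?c ! 1)"
      using l k by (simp add: dstep_def[of M Or b ?c] Step qa)
    obtain a mv where a: "acts ! 1 = (a, mv)" by fastforce
    obtain t h where t: "tapes ?c ! 1 = (t, h)" by fastforce
    show ?thesis
      using Cons unfolding foldr_Cons o_apply t1 a t
      by (cases mv) (auto simp: write_tape_def)
  next
    case (Query q)
    then have "tapes (dstep M Or b ?c) ! 1 = tapes ?c ! 1"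
      by (simp add: dstep_def[of M Or b ?c] answer_query_def)
    then show ?thesis using Cons by simp
  next
    case (Query_NQC q)
    then have "tapes (dstep M Or b ?c) ! 1 = tapes ?c ! 1"
      by (simp add: dstep_def[of M Or b ?c] answer_query_def)
    then show ?thesis using Cons by simp
  next
    case (Halt a)
    then have "tapes (dstep M Or b ?c) ! 1 = tapes ?c ! 1"
      by (simp add: dstep_def[of M Or b ?c])
    then show ?thesis using Cons by simp
  qed
qed

text \<open>A query string is written one cell per step, and the query itself is a further step,
  hence the strict inequality. A short run therefore cannot see the oracle at great lengths.\<close>

lemma length_queried:
  assumes M: "wf_ptm M"
  shows "w \<in> queried M Or cs (init_config M x) \<Longrightarrow> length w < length cs"
proof (induction cs)
  case (Cons b cs)
  let ?c = "foldr (dstep M Or) cs (init_config M x)"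
  obtain t h where t: "tapes ?c ! 1 = (t, h)" by fastforce
  have "t (Suc (length cs)) \<notin> {2, 3}"
    using query_tape_bound[OF M, of Or cs x] t by auto
  then have "length (bits_of_tape (tapes ?c ! 1)) \<le> length cs"
    unfolding t bits_of_tape_def by (simp add: Least_le)
  then show ?case
    using Cons by (auto simp: Let_def split: instr.splits)
qed simp

section \<open>Countably many machines\<close>

instance move :: countable by countable_datatype

text \<open>A transition function also has values at reads that never occur, so there are
  uncountably many machine records. Only its restriction to this finite set matters for a
  run.\<close>

definition legal_reads :: "ptm \<Rightarrow> (bool \<times> nat list) set" where
  "legal_reads M = UNIV \<times> {as. set as \<subseteq> {..<num_symbols M} \<and> length as = num_tapes M}"

fun norm_instr :: "(bool \<times> nat list) set \<Rightarrow> instr \<Rightarrow> instr" where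
  "norm_instr D (Step \<delta>) = Step (curry (restrict (case_prod \<delta>) D))"
| "norm_instr D I = I"

definition norm_ptm :: "ptm \<Rightarrow> ptm" where
  "norm_ptm M = \<lparr>num_tapes = num_tapes M, num_symbols = num_symbols M,
     program = map (norm_instr (legal_reads M)) (program M)\<rparr>"

lemma norm_instr_Halt_iff: "norm_instr D I = Halt b \<longleftrightarrow> I = Halt b"
  by (cases I) auto

lemma wf_norm_ptm: "wf_ptm M \<Longrightarrow> wf_ptm (norm_ptm M)"
proof -
  assume M: "wf_ptm M"
  have "wf_instr (num_tapes M) (num_symbols M) n (norm_instr (legal_reads M) I)"
    if "wf_instr (num_tapes M) (num_symbols M) n I" for n I
    using that by (cases I) (auto simp: legal_reads_def)
  then show ?thesis using M by (simp add: wf_ptm_def norm_ptm_def)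
qed

lemma step_norm_ptm:
  assumes "valid_config M c"
  shows "step (norm_ptm M) Or R c = step M Or R c"
proof -
  have "(coin, map read_tape (tapes c)) \<in> legal_reads M" for coin
    using read_tapes_valid[OF assms] unfolding legal_reads_def by simp
  moreover have "program (norm_ptm M) ! state c = norm_instr (legal_reads M) (program M ! state c)"
    using assms by (simp add: norm_ptm_def valid_config_def)
  ultimately show ?thesis
    by (cases "program M ! state c") (simp_all add: step_def)
qed

lemma run_norm_ptm:
  assumes M: "wf_ptm M"
  shows "run (norm_ptm M) Or R x t = run M Or R x t"
proof (induction t)
  case 0
  then show ?case by (simp add: run_0 init_config_def norm_ptm_def)
next
  case (Suc t)
  then show ?case
    unfolding run_Suc Suc.IH by (intro bind_pmf_cong refl step_norm_ptm valid_run[OF M])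
qed

lemma outputs_norm_ptm:
  assumes "valid_config M c"
  shows "c \<in> outputs (norm_ptm M) b \<longleftrightarrow> c \<in> outputs M b"
  using assms by (simp add: outputs_def norm_ptm_def valid_config_def norm_instr_Halt_iff)

lemma prob_outputs_norm_ptm:
  assumes M: "wf_ptm M"
  shows "measure_pmf.prob (run (norm_ptm M) Or R x t) (outputs (norm_ptm M) b)
    = measure_pmf.prob (run M Or R x t) (outputs M b)"
  unfolding run_norm_ptm[OF M]
  by (rule measure_pmf.finite_measure_eq_AE)
    (auto simp: AE_measure_pmf_iff outputs_norm_ptm valid_run[OF M])

text \<open>A normalized \<open>Step\<close> is given by finitely many values from a countable
  type.\<close>

lemma countable_norm_ptms: "countable (range norm_ptm)"
proof -
  define I where "I k g = Step ` curry ` (PiE ((UNIV :: bool set) \<times> {as. set as \<subseteq> {..<g} \<and> length as = k}) (\<lambda>_. UNIV))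
     \<union> range Query \<union> range Query_NQC \<union> range Halt" for k g :: nat
  have "countable (PiE ((UNIV :: bool set) \<times> {as. set as \<subseteq> {..<g} \<and> length as = k}) (\<lambda>_. UNIV :: (nat \<times> (nat \<times> move) list) set))"
    for k g :: nat
    by (rule countable_PiE) (auto intro!: finite_cartesian_product finite_lists_length_eq)
  then have I: "countable (I k g)" for k g
    unfolding I_def by simp
  have "norm_instr (legal_reads M) J \<in> I (num_tapes M) (num_symbols M)" for M J
    by (cases J) (auto simp: I_def legal_reads_def)
  then have "norm_ptm M \<in> (\<lambda>(k, g, P). \<lparr>num_tapes = k, num_symbols = g, program = P\<rparr>) `
      (SIGMA k:UNIV. SIGMA g:UNIV. lists (I k g))" for M
    unfolding norm_ptm_def
    by (intro image_eqI[of _ _ "(num_tapes M, num_symbols M, map (norm_instr (legal_reads M)) (program M))"]) auto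
  moreover have "countable (SIGMA k:(UNIV::nat set). SIGMA g:(UNIV::nat set). lists (I k g))"
    by (intro countable_SIGMA countable_lists I) auto
  ultimately show ?thesis
    by (meson countable_image countable_subset image_subsetI)
qed

section \<open>Lower bound for a single input length\<close>

lemma coset_eq_refl: "coset_eq A n K a a"
  by (simp add: coset_eq_def)

lemma coset_eq_sym: "coset_eq A n K a b \<Longrightarrow> coset_eq A n K b a"
  by (simp add: coset_eq_def)

lemma coset_eq_trans: "coset_eq A n K a b \<Longrightarrow> coset_eq A n K b c \<Longrightarrow> coset_eq A n K a c"
  by (simp add: coset_eq_def)

text \<open>The least element is chosen so that the representative of a point below
  \<open>2 ^ K\<close> stays below \<open>2 ^ K\<close>.\<close>

definition coset_rep :: "(nat \<Rightarrow> nat) \<Rightarrow> nat \<Rightarrow> nat \<Rightarrow> nat \<Rightarrow> nat" where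
  "coset_rep A n K a = (LEAST z. coset_eq A n K z a)"

lemma coset_eq_rep: "coset_eq A n K (coset_rep A n K a) a"
  unfolding coset_rep_def by (rule LeastI) (rule coset_eq_refl)

lemma coset_rep_le: "coset_rep A n K a \<le> a"
  unfolding coset_rep_def by (rule Least_le) (rule coset_eq_refl)

lemma coset_rep_eq_iff: "coset_rep A n K a = coset_rep A n K b \<longleftrightarrow> coset_eq A n K a b"
proof
  assume "coset_rep A n K a = coset_rep A n K b"
  then show "coset_eq A n K a b"
    by (metis coset_eq_rep coset_eq_sym coset_eq_trans)
next
  assume "coset_eq A n K a b"
  then have "coset_eq A n K z a \<longleftrightarrow> coset_eq A n K z b" for z
    by (meson coset_eq_sym coset_eq_trans)
  then show "coset_rep A n K a = coset_rep A n K b" by (simp add: coset_rep_def)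
qed

text \<open>An involution that exchanges every point of \<open>X\<close> with the representative of
  its coset. The description by \<open>THE\<close> is meaningful when \<open>X\<close> has at most
  one point in each coset.\<close>

definition coset_swap :: "(nat \<Rightarrow> nat) \<Rightarrow> nat \<Rightarrow> nat \<Rightarrow> nat set \<Rightarrow> nat \<Rightarrow> nat" where
  "coset_swap A n K X z = (if \<exists>x\<in>X. coset_eq A n K x z
     then Transposition.transpose (THE x. x \<in> X \<and> coset_eq A n K x z) (coset_rep A n K z) z else z)"

context
  fixes A n K X
  assumes X: "X \<subseteq> {..<2 ^ K}" and inequiv: "\<And>x y. x \<in> X \<Longrightarrow> y \<in> X \<Longrightarrow> coset_eq A n K x y \<Longrightarrow> x = y"
begin

lemma coset_swap_eq:
  assumes "x \<in> X" "coset_eq A n K x z"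
  shows "coset_swap A n K X z = Transposition.transpose x (coset_rep A n K x) z"
proof -
  have "(THE x. x \<in> X \<and> coset_eq A n K x z) = x"
  proof (rule the_equality)
    fix y assume y: "y \<in> X \<and> coset_eq A n K y z"
    then have "coset_eq A n K y x" using coset_eq_trans[OF _ coset_eq_sym[OF assms(2)]] by simp
    then show "y = x" using y assms(1) by (intro inequiv) simp_all
  qed (use assms in simp)
  moreover have "coset_rep A n K z = coset_rep A n K x"
    using assms(2) by (simp add: coset_rep_eq_iff coset_eq_sym)
  ultimately show ?thesis using assms by (auto simp: coset_swap_def)
qed

lemma coset_swap_rep: "x \<in> X \<Longrightarrow> coset_swap A n K X (coset_rep A n K x) = x"
  by (subst coset_swap_eq[of x]) (auto intro: coset_eq_sym coset_eq_rep)

lemma coset_swap_invol: "coset_swap A n K X (coset_swap A n K X z) = z"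
proof (cases "\<exists>x\<in>X. coset_eq A n K x z")
  case True
  then obtain x where x: "x \<in> X" "coset_eq A n K x z" by blast
  have "coset_eq A n K x (Transposition.transpose x (coset_rep A n K x) z)"
    using x(2) coset_eq_sym[OF coset_eq_rep[of A n K x]] coset_eq_refl
    by (auto simp: Transposition.transpose_def)
  then show ?thesis
    by (simp add: coset_swap_eq[OF x] coset_swap_eq[OF x(1)])
next
  case False
  then show ?thesis by (simp add: coset_swap_def)
qed

lemma coset_swap_permutes: "coset_swap A n K X permutes {..<2 ^ K}"
  unfolding permutes_def
proof (intro conjI allI impI)
  fix z assume z: "z \<notin> {..<(2::nat) ^ K}"
  show "coset_swap A n K X z = z"
  proof (cases "\<exists>x\<in>X. coset_eq A n K x z")
    case True
    then obtain x where x: "x \<in> X" "coset_eq A n K x z" by blast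
    have "x < 2 ^ K" using x X by auto
    then have "x \<noteq> z" "coset_rep A n K x \<noteq> z"
      using z coset_rep_le[of A n K x] by auto
    then show ?thesis by (simp add: coset_swap_eq[OF x] Transposition.transpose_def)
  qed (simp add: coset_swap_def)
next
  fix y show "\<exists>!x. coset_swap A n K X x = y"
    by (rule ex1I[of _ "coset_swap A n K X y"]) (auto simp: coset_swap_invol)
qed

end

text \<open>The two leading zeros keep a label from being the code of a circuit with a layer.\<close>

definition label_oracle :: "(bits \<Rightarrow> bits) \<Rightarrow> nat \<Rightarrow> nat \<Rightarrow> (nat \<Rightarrow> nat) \<Rightarrow> nat set \<Rightarrow> bits \<Rightarrow> bits" where
  "label_oracle base K N F S w =
     (if length w = K then False # False # bits_of_index K (F (index_of_bits w))
      else if length w = N then [take_bit K (index_of_bits w) \<in> S] else base w)"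

definition revealing :: "nat \<Rightarrow> nat \<Rightarrow> nat \<Rightarrow> (nat \<Rightarrow> nat) \<Rightarrow> bits set \<Rightarrow> bool" where
  "revealing n K N A Q \<longleftrightarrow>
     (\<exists>w\<in>Q. \<exists>w'\<in>Q. length w = K \<and> length w' = K \<and> w \<noteq> w' \<and> coset_eq A n K (index_of_bits w) (index_of_bits w')) \<or>
     (\<exists>w\<in>Q. length w = N \<and> take_bit K (index_of_bits w) \<in> near_code A n K n)"

text \<open>Composing the labelling of the points with a permutation that moves every queried point to its
  representative makes the labels of the cosets look like the labels of the points.\<close>

lemma card_not_revealing_le:
  fixes Qs :: "(bits \<Rightarrow> bits) \<Rightarrow> bits set"
  assumes Qs: "\<And>Or Or'. (\<And>w. w \<in> Qs Or \<Longrightarrow> Or' w = Or w) \<Longrightarrow> Qs Or' = Qs Or"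
  shows "card {G. G permutes {..<2 ^ K} \<and> \<not> revealing n K N A (Qs (label_oracle base K N G {}))}
    \<le> card {G. G permutes {..<2 ^ K} \<and> \<not> revealing n K N A (Qs (label_oracle base K N (G \<circ> coset_rep A n K) {}))}"
    (is "card ?I \<le> card ?J")
proof -
  define X where "X G = index_of_bits ` {w \<in> Qs (label_oracle base K N G {}). length w = K}" for G
  define f where "f G = G \<circ> coset_swap A n K (X G)" for G
  have X: "X G \<subseteq> {..<2 ^ K}" for G
    using index_of_bits_less by (auto simp: X_def)
  have inequiv: "x = y" if "G \<in> ?I" "x \<in> X G" "y \<in> X G" "coset_eq A n K x y" for G x y
    using that unfolding X_def revealing_def by blast
  \<comment> \<open>On queried points the coset label under \<open>f G\<close> equals the point
    label under \<open>G\<close>, so both oracles answer the run alike.\<close>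
  have Q: "Qs (label_oracle base K N (f G \<circ> coset_rep A n K) {}) = Qs (label_oracle base K N G {})"
    if G: "G \<in> ?I" for G
  proof (rule Qs)
    fix w assume w: "w \<in> Qs (label_oracle base K N G {})"
    have "f G (coset_rep A n K (index_of_bits w)) = G (index_of_bits w)" if "length w = K"
    proof -
      have "index_of_bits w \<in> X G" using w that by (auto simp: X_def)
      then show ?thesis
        unfolding f_def o_apply using coset_swap_rep[OF X inequiv[OF G]] by simp
    qed
    then show "label_oracle base K N (f G \<circ> coset_rep A n K) {} w = label_oracle base K N G {} w"
      by (simp add: label_oracle_def)
  qed
  show ?thesis
  proof (rule card_inj_on_le)
    \<comment> \<open>Equal images give equal query sets, hence the same swap, and an involution can
      be cancelled.\<close>
    show "inj_on f ?I"
    proof (rule inj_onI)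
      fix G H assume GH: "G \<in> ?I" "H \<in> ?I" "f G = f H"
      have "Qs (label_oracle base K N G {}) = Qs (label_oracle base K N H {})"
        using Q[OF GH(1)] Q[OF GH(2)] unfolding GH(3) by simp
      then have XX: "X G = X H" by (simp add: X_def)
      have "G z = H z" for z
      proof -
        have "f G (coset_swap A n K (X G) z) = G z" "f H (coset_swap A n K (X H) z) = H z"
          unfolding f_def o_apply
          using coset_swap_invol[OF X inequiv[OF GH(1)]] coset_swap_invol[OF X inequiv[OF GH(2)]] by simp_all
        then show ?thesis using GH(3) XX by simp
      qed
      then show "G = H" ..
    qed
    show "f ` ?I \<subseteq> ?J"
    proof (rule image_subsetI)
      fix G assume G: "G \<in> ?I"
      have "f G permutes {..<2 ^ K}"
        unfolding f_def using G coset_swap_permutes[OF X inequiv[OF G]] by (auto intro: permutes_compose)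
      then show "f G \<in> ?J" using G Q[OF G] by simp
    qed
    show "finite ?J"
      by (rule finite_subset[OF _ finite_permutations[of "{..<2 ^ K}"]]) auto
  qed
qed

text \<open>\<open>Q\<close> is fixed before \<open>A\<close>, so a union bound applies: at most
  \<open>T * T\<close> pairs can collide and at most \<open>T\<close> strings can be near the code,
  each with probability at most \<open>2^(-n)\<close>.\<close>

lemma card_revealing:
  assumes Q: "finite Q" "card Q \<le> T"
  shows "card {A \<in> row_maps n (8 * n). revealing n (8 * n) N A Q} * 2 ^ n \<le> (T * T + T) * card (row_maps n (8 * n))"
proof -
  let ?K = "8 * n"
  let ?R = "row_maps n ?K"
  let ?P = "{p \<in> Q \<times> Q. length (fst p) = ?K \<and> length (snd p) = ?K \<and> fst p \<noteq> snd p}"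
  let ?U = "\<Union>p\<in>?P. {A \<in> ?R. coset_eq A n ?K (index_of_bits (fst p)) (index_of_bits (snd p))}"
  let ?V = "\<Union>w\<in>Q. {A \<in> ?R. take_bit ?K (index_of_bits w) \<in> near_code A n ?K n}"
  have P: "finite ?P" "card ?P \<le> T * T"
  proof -
    show "finite ?P" using Q(1) by auto
    have "card ?P \<le> card (Q \<times> Q)" using Q(1) by (intro card_mono) auto
    also have "\<dots> \<le> T * T" using Q(2) by (simp add: card_cartesian_product mult_le_mono)
    finally show "card ?P \<le> T * T" .
  qed
  have "card ?U * 2 ^ n \<le> (\<Sum>p\<in>?P. card {A \<in> ?R. coset_eq A n ?K (index_of_bits (fst p)) (index_of_bits (snd p))}) * 2 ^ n"
    by (intro mult_right_mono card_UN_le P) simp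
  also have "\<dots> = (\<Sum>p\<in>?P. card ?R)"
    unfolding sum_distrib_right
  proof (rule sum.cong[OF refl])
    fix p assume p: "p \<in> ?P"
    then have l: "length (fst p) = ?K" "length (snd p) = ?K" "fst p \<noteq> snd p" by auto
    then have "index_of_bits (fst p) \<noteq> index_of_bits (snd p)"
      by (metis bits_of_index_of_bits)
    then show "card {A \<in> ?R. coset_eq A n ?K (index_of_bits (fst p)) (index_of_bits (snd p))} * 2 ^ n = card ?R"
      by (rule card_coset_eq[OF index_of_bits_less[of "fst p", unfolded l] index_of_bits_less[of "snd p", unfolded l]])
  qed
  also have "\<dots> = card ?P * card ?R" unfolding sum_constant of_nat_id ..
  also have "\<dots> \<le> T * T * card ?R" by (rule mult_right_mono[OF P(2)]) simp
  finally have U: "card ?U * 2 ^ n \<le> T * T * card ?R" .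
  have "card ?V * 2 ^ n \<le> (\<Sum>w\<in>Q. card {A \<in> ?R. take_bit ?K (index_of_bits w) \<in> near_code A n ?K n}) * 2 ^ n"
    by (intro mult_right_mono card_UN_le Q) simp
  also have "\<dots> \<le> (\<Sum>w\<in>Q. card ?R)"
    unfolding sum_distrib_right by (intro sum_mono card_near_code)
  also have "\<dots> = card Q * card ?R" unfolding sum_constant of_nat_id ..
  also have "\<dots> \<le> T * card ?R" by (rule mult_right_mono[OF Q(2)]) simp
  finally have V: "card ?V * 2 ^ n \<le> T * card ?R" .
  have "{A \<in> ?R. revealing n ?K N A Q} \<subseteq> ?U \<union> ?V"
  proof
    fix A assume A: "A \<in> {A \<in> ?R. revealing n ?K N A Q}"
    then consider w w' where "w \<in> Q" "w' \<in> Q" "length w = ?K" "length w' = ?K" "w \<noteq> w'"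
        "coset_eq A n ?K (index_of_bits w) (index_of_bits w')"
      | w where "w \<in> Q" "take_bit ?K (index_of_bits w) \<in> near_code A n ?K n"
      unfolding revealing_def by blast
    then show "A \<in> ?U \<union> ?V"
    proof cases
      case 1
      then have "A \<in> ?U" using A by (intro UN_I[of "(w, w')"]) simp_all
      then show ?thesis ..
    next
      case 2
      then have "A \<in> ?V" using A by (intro UN_I[of w]) simp_all
      then show ?thesis ..
    qed
  qed
  moreover have "finite (?U \<union> ?V)" by (rule finite_subset[of _ ?R]) (blast, rule finite_row_maps)
  ultimately have "card {A \<in> ?R. revealing n ?K N A Q} \<le> card (?U \<union> ?V)"
    by (rule card_mono[rotated])
  also have "\<dots> \<le> card ?U + card ?V" by (rule card_Un_le)
  finally have "card {A \<in> ?R. revealing n ?K N A Q} * 2 ^ n \<le> (card ?U + card ?V) * 2 ^ n"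
    by (rule mult_right_mono) simp
  also have "\<dots> \<le> T * T * card ?R + T * card ?R"
    unfolding add_mult_distrib by (rule add_mono[OF U V])
  finally show ?thesis unfolding add_mult_distrib .
qed

text \<open>Averaging over \<open>D\<close> and exchanging the average with the expectation: a bound
  on the fraction of bad \<open>d\<close> for each fixed \<open>\<omega>\<close> bounds the
  probability for some fixed \<open>d\<close>.\<close>

lemma exists_small_prob:
  fixes e :: real
  assumes D: "finite D" "D \<noteq> {}" and e: "\<And>\<omega>. real (card {d \<in> D. bad d \<omega>}) \<le> e * card D"
  shows "\<exists>d\<in>D. measure_pmf.prob P {\<omega>. bad d \<omega>} \<le> e"
proof (rule ccontr)
  assume "\<not> ?thesis"
  then have "e < measure_pmf.prob P {\<omega>. bad d \<omega>}" if "d \<in> D" for d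
    using that by force
  then have "(\<Sum>d\<in>D. e) < (\<Sum>d\<in>D. measure_pmf.prob P {\<omega>. bad d \<omega>})"
    using D by (intro sum_strict_mono) auto
  also have "\<dots> = (\<Sum>d\<in>D. measure_pmf.expectation P (indicator {\<omega>. bad d \<omega>}))"
    by simp
  also have "\<dots> = measure_pmf.expectation P (\<lambda>\<omega>. \<Sum>d\<in>D. indicator {\<omega>. bad d \<omega>} \<omega>)"
    by (rule Bochner_Integration.integral_sum[symmetric])
      (rule measure_pmf.integrable_const_bound[where B = 1], auto simp: indicator_def)
  also have "\<dots> \<le> e * card D"
  proof (rule measure_pmf.integral_le_const)
    show "AE \<omega> in measure_pmf P. (\<Sum>d\<in>D. indicator {\<omega>. bad d \<omega>} \<omega>) \<le> e * card D"
    proof (rule AE_I2)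
      fix \<omega>
      have "(\<Sum>d\<in>D. indicator {\<omega>. bad d \<omega>} \<omega>) = (\<Sum>d\<in>{d \<in> D. bad d \<omega>}. 1 :: real)"
        using D by (intro sum.mono_neutral_cong_right) (auto simp: indicator_def)
      then show "(\<Sum>d\<in>D. indicator {\<omega>. bad d \<omega>} \<omega>) \<le> e * card D" using e[of \<omega>] by simp
    qed
    show "integrable (measure_pmf P) (\<lambda>\<omega>. \<Sum>d\<in>D. indicator {\<omega>. bad d \<omega>} \<omega> :: real)"
      by (rule Bochner_Integration.integrable_sum)
        (rule measure_pmf.integrable_const_bound[where B = 1], auto simp: indicator_def)
  qed
  finally show False by (simp add: mult.commute)
qed

lemma card_pairs_eq:
  assumes "finite R" "finite P"
  shows "card {d \<in> R \<times> P. b (fst d) (snd d)} = (\<Sum>x\<in>R. card {y \<in> P. b x y})"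
proof -
  have "{d \<in> R \<times> P. b (fst d) (snd d)} = (SIGMA x:R. {y \<in> P. b x y})" by auto
  then show ?thesis using assms by simp
qed

text \<open>For each \<open>A\<close>, coset labels reveal something for at most as many
  permutations as point labels do. With point labels the queries do not depend on \<open>A\<close>,
  so the two summations can be exchanged and \<open>card_revealing\<close> used for each
  permutation.\<close>

lemma card_revealing_pairs:
  fixes Qs :: "(bits \<Rightarrow> bits) \<Rightarrow> bits set"
  assumes Qs: "\<And>Or Or'. (\<And>w. w \<in> Qs Or \<Longrightarrow> Or' w = Or w) \<Longrightarrow> Qs Or' = Qs Or"
    and fin: "\<And>Or. finite (Qs Or) \<and> card (Qs Or) \<le> T" and K: "K = 8 * n"
  shows "card {d \<in> row_maps n K \<times> {G. G permutes {..<2 ^ K}}.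
      revealing n K N (fst d) (Qs (label_oracle base K N (snd d \<circ> coset_rep (fst d) n K) {}))} * 2 ^ n
    \<le> (T * T + T) * card (row_maps n K \<times> {G. G permutes {..<(2::nat) ^ K}})"
proof -
  let ?R = "row_maps n K" and ?P = "{G. G permutes {..<(2::nat) ^ K}}"
  have fP: "finite ?P" by (rule finite_permutations) simp
  let ?b = "\<lambda>A G. revealing n K N A (Qs (label_oracle base K N (G \<circ> coset_rep A n K) {}))"
  let ?i = "\<lambda>A G. revealing n K N A (Qs (label_oracle base K N G {}))"
  have le: "card {G \<in> ?P. ?b A G} \<le> card {G \<in> ?P. ?i A G}" for A
  proof -
    have part: "card {G \<in> ?P. \<not> p G} + card {G \<in> ?P. p G} = card ?P" for p
      by (subst card_Un_disjoint[symmetric]) (auto intro!: arg_cong[of _ _ card] simp: fP)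
    \<comment> \<open>The comparison is available for unrevealing permutations; taking complements
      in the same finite set reverses it.\<close>
    have h: "card {G \<in> ?P. \<not> ?i A G} \<le> card {G \<in> ?P. \<not> ?b A G}"
      unfolding mem_Collect_eq by (rule card_not_revealing_le[where Qs = Qs], rule Qs)
    have "a + b = p \<Longrightarrow> c + d = p \<Longrightarrow> c \<le> a \<Longrightarrow> b \<le> d" for a b c d p :: nat by linarith
    from this[OF part[of "?b A"] part[of "?i A"] h] show ?thesis .
  qed
  have "card {d \<in> ?R \<times> ?P. ?b (fst d) (snd d)} = (\<Sum>A\<in>?R. card {G \<in> ?P. ?b A G})"
    by (rule card_pairs_eq[OF finite_row_maps fP])
  also have "\<dots> \<le> (\<Sum>A\<in>?R. card {G \<in> ?P. ?i A G})" by (intro sum_mono le)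
  also have "\<dots> = (\<Sum>G\<in>?P. card {A \<in> ?R. ?i A G})"
    by (rule sum_multicount_gen[OF finite_row_maps fP]) blast
  finally have "card {d \<in> ?R \<times> ?P. ?b (fst d) (snd d)} * 2 ^ n \<le> (\<Sum>G\<in>?P. card {A \<in> ?R. ?i A G}) * 2 ^ n"
    by (rule mult_right_mono) simp
  also have "\<dots> \<le> (\<Sum>G\<in>?P. (T * T + T) * card ?R)"
    unfolding sum_distrib_right K by (intro sum_mono card_revealing fin[THEN conjunct1] fin[THEN conjunct2])
  also have "\<dots> = (T * T + T) * card (?R \<times> ?P)"
    unfolding card_cartesian_product sum_constant of_nat_id by (simp only: mult_ac)
  finally show ?thesis .
qed

text \<open>One choice of \<open>A\<close> and \<open>G\<close> serves both values of the bit.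
  Unless the run is revealing, which has probability at most \<open>e\<close>, it is the same for
  both. Being right in both cases would require acceptance and rejection probabilities of at least
  \<open>2 / 3 - e\<close> and \<open>2 / 3\<close> in one run, impossible as \<open>T\<close>
  forces \<open>e < 1 / 3\<close>.\<close>

lemma stage_lower_bound:
  assumes M: "wf_ptm M" and T: "3 * (T * T + T) < 2 ^ n" and K: "K = 8 * n"
  shows "\<exists>A G b. G permutes {..<2 ^ K} \<and>
    \<not> ((b \<longrightarrow> measure_pmf.prob (run M (label_oracle base K N (G \<circ> coset_rep A n K) (if b then near_code A n K n else {})) no_oracle x T) (outputs M True) \<ge> 2 / 3) \<and>
      (\<not> b \<longrightarrow> measure_pmf.prob (run M (label_oracle base K N (G \<circ> coset_rep A n K) (if b then near_code A n K n else {})) no_oracle x T) (outputs M False) \<ge> 2 / 3))"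
proof -
  let ?c = "init_config M x"
  let ?D = "row_maps n K \<times> {G. G permutes {..<(2::nat) ^ K}}"
  let ?O = "\<lambda>A G S. label_oracle base K N (G \<circ> coset_rep A n K) S"
  define e where "e = real (T * T + T) / 2 ^ n"
  define bad where "bad d cs \<longleftrightarrow> length cs = T \<and> revealing n K N (fst d) (queried M (?O (fst d) (snd d) {}) cs ?c)" for d cs
  have "real (3 * (T * T + T)) < real (2 ^ n)" using T by (simp only: of_nat_less_iff)
  then have e: "e < 1 / 3" unfolding e_def by (simp add: field_simps)
  have fP: "finite {G. G permutes {..<(2::nat) ^ K}}" by (rule finite_permutations) simp
  have "\<exists>d\<in>?D. measure_pmf.prob (coins T) {cs. bad d cs} \<le> e"
  proof (rule exists_small_prob)
    show "finite ?D" by (intro finite_cartesian_product finite_row_maps fP)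
    have "id \<in> {G. G permutes {..<(2::nat) ^ K}}" by (simp add: permutes_id)
    then have "{G. G permutes {..<(2::nat) ^ K}} \<noteq> {}" by (metis empty_iff)
    then show "?D \<noteq> {}" unfolding Times_empty using row_maps_nonempty[of n K] by simp
    fix cs :: "bool list"
    show "real (card {d \<in> ?D. bad d cs}) \<le> e * card ?D"
    proof (cases "length cs = T")
      case True
      have "card {d \<in> ?D. revealing n K N (fst d) (queried M (?O (fst d) (snd d) {}) cs ?c)} * 2 ^ n
         \<le> (T * T + T) * card ?D"
      proof (rule card_revealing_pairs[OF _ _ K])
        show "queried M Or' cs ?c = queried M Or cs ?c"
          if "\<And>w. w \<in> queried M Or cs ?c \<Longrightarrow> Or' w = Or w" for Or Or'
          using conjunct2[OF queried_cong[OF that]] .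
        show "finite (queried M Or cs ?c) \<and> card (queried M Or cs ?c) \<le> T" for Or
          using finite_card_queried[of M Or cs ?c] unfolding True .
      qed
      then have "real (card {d \<in> ?D. bad d cs} * 2 ^ n) \<le> real ((T * T + T) * card ?D)"
        unfolding bad_def of_nat_le_iff using True by (simp only: simp_thms)
      then have "real (card {d \<in> ?D. bad d cs}) * 2 ^ n \<le> real (T * T + T) * real (card ?D)"
        unfolding of_nat_mult[of _ "2 ^ n"] of_nat_mult[of "T * T + T"] of_nat_power of_nat_numeral .
      then have "real (card {d \<in> ?D. bad d cs}) \<le> real (T * T + T) * real (card ?D) / 2 ^ n"
        by (subst pos_le_divide_eq) simp_all
      then show ?thesis
        unfolding e_def times_divide_eq_left .
    next
      case False
      then show ?thesis by (simp add: bad_def e_def)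
    qed
  qed
  then obtain A G where G: "G permutes {..<2 ^ K}" and small: "measure_pmf.prob (coins T) {cs. bad (A, G) cs} \<le> e"
    by force
  let ?W = "near_code A n K n"
  let ?f = "\<lambda>S cs. foldr (dstep M (?O A G S)) cs ?c"
  have P: "measure_pmf.prob (run M (?O A G S) no_oracle x T) (outputs M b)
     = measure_pmf.prob (coins T) {cs. ?f S cs \<in> outputs M b}" for S b
    unfolding run_eq_coins measure_map_pmf vimage_def ..
  \<comment> \<open>The two oracles differ at most on strings of length \<open>N\<close> near the
    code, and an unrevealing run asks none of these.\<close>
  have same: "?f ?W cs = ?f {} cs" if "\<not> bad (A, G) cs" "length cs = T" for cs
  proof -
    have "\<not> revealing n K N A (queried M (?O A G {}) cs ?c)" using that by (simp add: bad_def)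
    then have "?O A G ?W w = ?O A G {} w" if "w \<in> queried M (?O A G {}) cs ?c" for w
      using that by (auto simp: label_oracle_def revealing_def)
    then show ?thesis using queried_cong[of M "?O A G {}" cs ?c "?O A G ?W"] by blast
  qed
  have "measure_pmf.prob (coins T) {cs. ?f ?W cs \<in> outputs M True}
     \<le> measure_pmf.prob (coins T) ({cs. ?f {} cs \<in> outputs M True} \<union> {cs. bad (A, G) cs})"
    by (rule measure_pmf.finite_measure_mono_AE)
      (use same length_coins in \<open>auto simp: AE_measure_pmf_iff\<close>)
  also have "\<dots> \<le> measure_pmf.prob (coins T) {cs. ?f {} cs \<in> outputs M True} + measure_pmf.prob (coins T) {cs. bad (A, G) cs}"
    by (rule measure_Un_le) simp_all
  finally have 1: "measure_pmf.prob (coins T) {cs. ?f ?W cs \<in> outputs M True}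
     \<le> measure_pmf.prob (coins T) {cs. ?f {} cs \<in> outputs M True} + e" using small by linarith
  have "measure_pmf.prob (coins T) {cs. ?f {} cs \<in> outputs M True} + measure_pmf.prob (coins T) {cs. ?f {} cs \<in> outputs M False}
     = measure_pmf.prob (coins T) ({cs. ?f {} cs \<in> outputs M True} \<union> {cs. ?f {} cs \<in> outputs M False})"
    by (rule measure_pmf.finite_measure_Union[symmetric]) (auto simp: outputs_def)
  also have "\<dots> \<le> 1" by (rule measure_pmf.prob_le_1)
  finally have 2: "measure_pmf.prob (coins T) {cs. ?f {} cs \<in> outputs M True} + measure_pmf.prob (coins T) {cs. ?f {} cs \<in> outputs M False} \<le> 1" .
  have "\<not> (measure_pmf.prob (run M (?O A G ?W) no_oracle x T) (outputs M True) \<ge> 2 / 3 \<and>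
      measure_pmf.prob (run M (?O A G {}) no_oracle x T) (outputs M False) \<ge> 2 / 3)"
    unfolding P using 1 2 e by linarith
  from this[unfolded de_Morgan_conj] show ?thesis
  proof (elim disjE)
    assume 3: "\<not> measure_pmf.prob (run M (?O A G ?W) no_oracle x T) (outputs M True) \<ge> 2 / 3"
    show ?thesis
      by (rule exI[of _ A], rule exI[of _ G], rule exI[of _ True])
        (simp only: G 3 if_True simp_thms)
  next
    assume 3: "\<not> measure_pmf.prob (run M (?O A G {}) no_oracle x T) (outputs M False) \<ge> 2 / 3"
    show ?thesis
      by (rule exI[of _ A], rule exI[of _ G], rule exI[of _ False])
        (simp only: G 3 if_False simp_thms)
  qed
qed

section \<open>The sampling machine\<close>

definition keep_tapes :: "(nat \<Rightarrow> move) \<Rightarrow> nat list \<Rightarrow> (nat \<times> move) list" where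
  "keep_tapes mv as = [(as ! 0, mv 0), (as ! 1, mv 1), (as ! 2, mv 2)]"

definition start_copy :: "nat \<Rightarrow> nat \<Rightarrow> instr" where
  "start_copy src q = Step (\<lambda>_ as. (q, keep_tapes (\<lambda>i. if i = src \<or> i = 1 then Right else Stay) as))"

text \<open>The final blank on tape 1 cuts off the remains of a longer earlier query.\<close>

definition copy_loop :: "nat \<Rightarrow> nat \<Rightarrow> nat \<Rightarrow> instr" where
  "copy_loop src q q' = Step (\<lambda>_ as.
     if as ! src = 2 \<or> as ! src = 3
     then (q, keep_tapes (\<lambda>i. if i = src \<or> i = 1 then Right else Stay) (as[1 := as ! src]))
     else (q', keep_tapes (\<lambda>_. Stay) (as[1 := 0])))"

definition rewind :: "nat \<Rightarrow> nat \<Rightarrow> instr" where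
  "rewind q q' = Step (\<lambda>_ as.
     if as ! 1 = 1 then (q', keep_tapes (\<lambda>_. Stay) as)
     else (q, keep_tapes (\<lambda>i. if i = 1 then Left else Stay) as))"

definition look_answer :: "nat \<Rightarrow> instr" where
  "look_answer q = Step (\<lambda>_ as. (q, keep_tapes (\<lambda>i. if i = 2 then Right else Stay) as))"

definition branch_answer :: "nat \<Rightarrow> nat \<Rightarrow> instr" where
  "branch_answer q q' = Step (\<lambda>_ as. (if as ! 2 = 3 then q else q', keep_tapes (\<lambda>_. Stay) as))"

text \<open>The input is submitted to the classical oracle, the answer to the noisy circuit oracle, and the
  outcome of that to the classical oracle again; the first bit of the last answer is the output.\<close>

definition sampling_machine :: ptm where
  "sampling_machine = \<lparr>num_tapes = 3, num_symbols = 4, program =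
     [start_copy 0 1, copy_loop 0 1 2, rewind 2 3, Query 4,
      start_copy 2 5, copy_loop 2 5 6, rewind 6 7, Query_NQC 8,
      start_copy 2 9, copy_loop 2 9 10, rewind 10 11, Query 12,
      look_answer 13, branch_answer 14 15, Halt True, Halt False]\<rparr>"

lemma wf_keep_tapes:
  assumes "length as = 3" "set as \<subseteq> {..<4}"
  shows "length (keep_tapes mv as) = 3" "fst ` set (keep_tapes mv as) \<subseteq> {..<4}"
proof -
  have "as ! 0 \<in> set as" "as ! 1 \<in> set as" "as ! 2 \<in> set as" using assms(1) by simp_all
  then show "length (keep_tapes mv as) = 3" "fst ` set (keep_tapes mv as) \<subseteq> {..<4}"
    using assms(2) unfolding keep_tapes_def by auto
qed

lemma wf_instr_copy:
  "q < n \<Longrightarrow> wf_instr 3 4 n (start_copy src q)"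
  "q < n \<Longrightarrow> q' < n \<Longrightarrow> src < 3 \<Longrightarrow> wf_instr 3 4 n (copy_loop src q q')"
  "q < n \<Longrightarrow> q' < n \<Longrightarrow> wf_instr 3 4 n (rewind q q')"
  "q < n \<Longrightarrow> wf_instr 3 4 n (look_answer q)"
  "q < n \<Longrightarrow> q' < n \<Longrightarrow> wf_instr 3 4 n (branch_answer q q')"
proof -
  assume q: "q < n"
  show "wf_instr 3 4 n (start_copy src q)" "wf_instr 3 4 n (look_answer q)"
    unfolding start_copy_def look_answer_def by (simp_all add: q wf_keep_tapes)
  assume q': "q' < n"
  show "wf_instr 3 4 n (rewind q q')" "wf_instr 3 4 n (branch_answer q q')"
    unfolding rewind_def branch_answer_def by (simp_all add: q q' wf_keep_tapes)
  assume src: "src < 3"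
  have "set (as[1 := as ! src]) \<subseteq> {..<4}" "set (as[1 := 0]) \<subseteq> {..<4}"
    if "length as = 3" "set as \<subseteq> {..<4}" for as :: "nat list"
    using that src by (intro set_update_subsetI; force)+
  then show "wf_instr 3 4 n (copy_loop src q q')"
    unfolding copy_loop_def by (simp add: q q' wf_keep_tapes)
qed

lemma wf_sampling_machine: "wf_ptm sampling_machine"
  unfolding wf_ptm_def sampling_machine_def by (simp add: wf_instr_copy)

section \<open>Exact runs from arbitrary configurations\<close>

definition steps :: "ptm \<Rightarrow> (bits \<Rightarrow> bits) \<Rightarrow> (bits \<Rightarrow> bits pmf \<times> nat) \<Rightarrow> nat \<Rightarrow> config \<Rightarrow> config pmf" where
  "steps M Or R k c = ((\<lambda>D. bind_pmf D (step M Or R)) ^^ k) (return_pmf c)"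

lemma run_eq_steps: "run M Or R x t = steps M Or R t (init_config M x)"
  by (simp add: run_def steps_def)

lemma steps_0 [simp]: "steps M Or R 0 c = return_pmf c"
  by (simp add: steps_def)

lemma steps_Suc: "steps M Or R (Suc k) c = bind_pmf (steps M Or R k c) (step M Or R)"
  by (simp add: steps_def)

lemma steps_add: "steps M Or R (a + b) c = bind_pmf (steps M Or R a c) (steps M Or R b)"
  by (induction b) (simp_all add: steps_Suc bind_assoc_pmf bind_return_pmf')

lemma steps_1: "steps M Or R 1 c = step M Or R c"
  by (simp add: steps_Suc bind_return_pmf)

lemma steps_trans:
  "steps M Or R a c = return_pmf c' \<Longrightarrow> steps M Or R b c' = D \<Longrightarrow> steps M Or R (a + b) c = D"
  by (simp add: steps_add bind_return_pmf)

lemma steps_halted: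
  assumes "program M ! state c = Halt b"
  shows "steps M Or R k c = return_pmf c"
  by (induction k) (simp_all add: steps_Suc bind_return_pmf step_def assms)

lemma step_det:
  assumes "program M ! state c = Step (\<lambda>_. f)"
  shows "step M Or R c = return_pmf (let (q, acts) = f (map read_tape (tapes c)) in
     \<lparr>state = q, tapes = map2 write_tape acts (tapes c), time_used = time_used c + 1\<rparr>)"
  by (simp add: step_def assms map_pmf_const)

abbreviation cfg :: "nat \<Rightarrow> tape list \<Rightarrow> nat \<Rightarrow> config" where
  "cfg q ts t \<equiv> \<lparr>state = q, tapes = ts, time_used = t\<rparr>"

text \<open>Source tape, query tape and bystander: one set of lemmas then covers copying from the
  input tape and from the answer tape.\<close>

definition with_source :: "nat \<Rightarrow> tape \<Rightarrow> tape \<Rightarrow> tape \<Rightarrow> tape list" where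
  "with_source src S T X = (if src = 0 then [S, T, X] else [X, T, S])"

context
  fixes M :: ptm and Or :: "bits \<Rightarrow> bits" and R :: "bits \<Rightarrow> bits pmf \<times> nat" and src q0 q1 q2 q3 :: nat
  assumes src: "src = 0 \<or> src = 2"
    and p0: "program M ! q0 = start_copy src q1" and p1: "program M ! q1 = copy_loop src q1 q2"
    and p2: "program M ! q2 = rewind q2 q3"
begin

lemma step_start_copy:
  "step M Or R (cfg q0 (with_source src (s, h) (t, k) X) u) = return_pmf (cfg q1 (with_source src (s, h + 1) (t, k + 1) X) (u + 1))"
  using src by (subst step_det[where f = "\<lambda>as. (q1, keep_tapes (\<lambda>i. if i = src \<or> i = 1 then Right else Stay) as)"])
    (cases X; auto simp: p0 start_copy_def with_source_def keep_tapes_def read_tape_def write_tape_def)+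

lemma step_copy_bit:
  assumes "s h = 2 \<or> s h = 3"
  shows "step M Or R (cfg q1 (with_source src (s, h) (t, k) X) u)
    = return_pmf (cfg q1 (with_source src (s, h + 1) (t(k := s h), k + 1) X) (u + 1))"
  using src assms by (subst step_det[where f = "\<lambda>as. if as ! src = 2 \<or> as ! src = 3
     then (q1, keep_tapes (\<lambda>i. if i = src \<or> i = 1 then Right else Stay) (as[1 := as ! src]))
     else (q2, keep_tapes (\<lambda>_. Stay) (as[1 := 0]))"])
    (cases X; auto simp: p1 copy_loop_def with_source_def keep_tapes_def read_tape_def write_tape_def)+

lemma step_copy_end:
  assumes "s h = 0"
  shows "step M Or R (cfg q1 (with_source src (s, h) (t, k) X) u)
    = return_pmf (cfg q2 (with_source src (s, h) (t(k := 0), k) X) (u + 1))"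
  using src assms by (subst step_det[where f = "\<lambda>as. if as ! src = 2 \<or> as ! src = 3
     then (q1, keep_tapes (\<lambda>i. if i = src \<or> i = 1 then Right else Stay) (as[1 := as ! src]))
     else (q2, keep_tapes (\<lambda>_. Stay) (as[1 := 0]))"])
    (cases X; auto simp: p1 copy_loop_def with_source_def keep_tapes_def read_tape_def write_tape_def)+

lemma step_rewind:
  "step M Or R (cfg q2 (with_source src S (t, k) X) u) = return_pmf (if t k = 1
     then cfg q3 (with_source src S (t, k) X) (u + 1) else cfg q2 (with_source src S (t, k - 1) X) (u + 1))"
  using src by (subst step_det[where f = "\<lambda>as. if as ! 1 = 1 then (q3, keep_tapes (\<lambda>_. Stay) as)
     else (q2, keep_tapes (\<lambda>i. if i = 1 then Left else Stay) as)"])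
    (cases S; cases X; auto simp: p2 rewind_def with_source_def keep_tapes_def read_tape_def write_tape_def)+

lemma steps_copy_bits:
  assumes "\<And>i. h \<le> i \<Longrightarrow> i < h + k \<Longrightarrow> s i = 2 \<or> s i = 3"
  shows "steps M Or R k (cfg q1 (with_source src (s, h) (t, h) X) u)
    = return_pmf (cfg q1 (with_source src (s, h + k) (\<lambda>i. if h \<le> i \<and> i < h + k then s i else t i, h + k) X) (u + k))"
  using assms
proof (induction k)
  case (Suc k)
  let ?t = "\<lambda>k i. if h \<le> i \<and> i < h + k then s i else t i"
  have "(?t k)(h + k := s (h + k)) = ?t (Suc k)" by (auto simp: less_Suc_eq)
  then show ?case
    using Suc by (simp add: steps_Suc bind_return_pmf step_copy_bit)
next
  case 0
  have "(\<lambda>i. if h \<le> i \<and> i < h + 0 then s i else t i) = t" by auto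
  then show ?case by simp
qed

lemma steps_rewind:
  assumes "t 0 = 1" "\<And>i. 0 < i \<Longrightarrow> i \<le> k \<Longrightarrow> t i \<noteq> 1"
  shows "steps M Or R (k + 1) (cfg q2 (with_source src S (t, k) X) u) = return_pmf (cfg q3 (with_source src S (t, 0) X) (u + k + 1))"
  using assms
proof (induction k arbitrary: u)
  case 0
  then show ?case by (simp add: steps_1[unfolded One_nat_def] step_rewind)
next
  case (Suc k)
  have "steps M Or R (1 + (k + 1)) (cfg q2 (with_source src S (t, Suc k) X) u)
      = return_pmf (cfg q3 (with_source src S (t, 0) X) (u + Suc k + 1))"
    by (rule steps_trans[where c' = "cfg q2 (with_source src S (t, k) X) (u + 1)"])
      (use Suc.prems Suc.IH[of "u + 1"] in \<open>simp_all add: steps_1[unfolded One_nat_def] step_rewind\<close>)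
  then show ?case by simp
qed

text \<open>One step leaves the end marker, \<open>length w\<close> steps copy, one writes the
  blank, and \<open>length w + 2\<close> steps rewind, the last of them only changing the state. Old
  content of tape 1 beyond the blank may remain.\<close>

lemma steps_copy:
  assumes "t 0 = 1"
  shows "\<exists>t'. t' 0 = 1 \<and> bits_of_tape (t', 0) = w \<and>
    steps M Or R (2 * length w + 4) (cfg q0 (with_source src (tape_of_bits w) (t, 0) X) u)
      = return_pmf (cfg q3 (with_source src (fst (tape_of_bits w), length w + 1) (t', 0) X) (u + (2 * length w + 4)))"
proof -
  let ?l = "length w"
  define s where "s = fst (tape_of_bits w)"
  have tw: "tape_of_bits w = (s, 0)" by (simp add: s_def tape_of_bits_def)
  have s: "s 0 = 1" "s (Suc i) = (if i < ?l then (if w ! i then 3 else 2) else 0)" for i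
    by (simp_all add: s_def tape_of_bits_def Suc_le_eq)
  have s23: "s i = 2 \<or> s i = 3" if "1 \<le> i" "i < 1 + ?l" for i
    using that s(2)[of "i - 1"] by auto
  define t1 where "t1 = (\<lambda>i. if 1 \<le> i \<and> i < 1 + ?l then s i else t i)"
  define t' where "t' = t1(1 + ?l := 0)"
  have "steps M Or R 1 (cfg q0 (with_source src (s, 0) (t, 0) X) u) = return_pmf (cfg q1 (with_source src (s, 1) (t, 1) X) (u + 1))"
    unfolding steps_1 step_start_copy by simp
  moreover have "steps M Or R ?l (cfg q1 (with_source src (s, 1) (t, 1) X) (u + 1))
     = return_pmf (cfg q1 (with_source src (s, 1 + ?l) (t1, 1 + ?l) X) (u + 1 + ?l))"
    unfolding t1_def by (rule steps_copy_bits) (rule s23)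
  moreover have "steps M Or R 1 (cfg q1 (with_source src (s, 1 + ?l) (t1, 1 + ?l) X) (u + 1 + ?l))
     = return_pmf (cfg q2 (with_source src (s, 1 + ?l) (t', 1 + ?l) X) (u + 1 + ?l + 1))"
    unfolding steps_1 t'_def by (rule step_copy_end) (use s(2)[of ?l] in simp)
  moreover have t': "t' 0 = 1" "t' (Suc i) = (if i < ?l then s (Suc i) else if i = ?l then 0 else t (Suc i))" for i
    using assms by (auto simp: t'_def t1_def)
  moreover have "t' i \<noteq> 1" if "0 < i" "i \<le> 1 + ?l" for i
    using that t'(2)[of "i - 1"] s(2)[of "i - 1"] by (auto split: if_splits)
  then have "steps M Or R (1 + ?l + 1) (cfg q2 (with_source src (s, 1 + ?l) (t', 1 + ?l) X) (u + 1 + ?l + 1))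
     = return_pmf (cfg q3 (with_source src (s, 1 + ?l) (t', 0) X) (u + 1 + ?l + 1 + (1 + ?l) + 1))"
    by (intro steps_rewind t')
  ultimately have "steps M Or R (1 + (?l + (1 + (1 + ?l + 1)))) (cfg q0 (with_source src (s, 0) (t, 0) X) u)
     = return_pmf (cfg q3 (with_source src (s, 1 + ?l) (t', 0) X) (u + 1 + ?l + 1 + (1 + ?l) + 1))"
    by (intro steps_trans[of M Or R 1] steps_trans[of M Or R ?l])
  moreover have "1 + (?l + (1 + (1 + ?l + 1))) = 2 * ?l + 4" "u + 1 + ?l + 1 + (1 + ?l) + 1 = u + (2 * ?l + 4)" "1 + ?l = ?l + 1"
    by simp_all
  ultimately have "steps M Or R (2 * ?l + 4) (cfg q0 (with_source src (s, 0) (t, 0) X) u)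
     = return_pmf (cfg q3 (with_source src (s, ?l + 1) (t', 0) X) (u + (2 * ?l + 4)))" by (simp only:)
  moreover have "bits_of_tape (t', 0) = w"
  proof -
    have "(LEAST n. t' (Suc n) \<notin> {2, 3}) = ?l"
    proof (rule Least_equality)
      show "t' (Suc ?l) \<notin> {2, 3}" using t'(2)[of ?l] by simp
      fix y assume "t' (Suc y) \<notin> {2, 3}"
      then show "?l \<le> y" using t'(2)[of y] s(2)[of y] by (auto split: if_splits simp: not_le)
    qed
    then show ?thesis
      unfolding bits_of_tape_def using t'(2) s(2) by (auto intro!: nth_equalityI)
  qed
  ultimately show ?thesis using t'(1) unfolding tw fst_conv by blast
qed

end

section \<open>The run of the sampling machine\<close>

definition accepting :: "bits \<Rightarrow> bool" where
  "accepting v \<longleftrightarrow> v \<noteq> [] \<and> hd v"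

lemma program_sampling_machine:
  "program sampling_machine ! 0 = start_copy 0 1" "program sampling_machine ! 1 = copy_loop 0 1 2"
  "program sampling_machine ! 2 = rewind 2 3" "program sampling_machine ! 3 = Query 4"
  "program sampling_machine ! 4 = start_copy 2 5" "program sampling_machine ! 5 = copy_loop 2 5 6"
  "program sampling_machine ! 6 = rewind 6 7" "program sampling_machine ! 7 = Query_NQC 8"
  "program sampling_machine ! 8 = start_copy 2 9" "program sampling_machine ! 9 = copy_loop 2 9 10"
  "program sampling_machine ! 10 = rewind 10 11" "program sampling_machine ! 11 = Query 12"
  "program sampling_machine ! 12 = look_answer 13" "program sampling_machine ! 13 = branch_answer 14 15"
  "program sampling_machine ! 14 = Halt True" "program sampling_machine ! 15 = Halt False"
  by (simp_all add: sampling_machine_def)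

lemma step_Query:
  assumes "program M ! q = Query q'" "bits_of_tape T1 = w"
  shows "step M Or R (cfg q [T0, T1, T2] u) = return_pmf (cfg q' [T0, T1, tape_of_bits (Or w)] (u + 2))"
  by (simp add: step_def assms answer_query_def numeral_2_eq_2)

lemma step_Query_NQC:
  assumes "program M ! q = Query_NQC q'" "bits_of_tape T1 = w"
  shows "step M Or R (cfg q [T0, T1, T2] u) = map_pmf (\<lambda>s. cfg q' [T0, T1, tape_of_bits s] (u + (1 + snd (R w)))) (fst (R w))"
  by (simp add: step_def assms split_beta) (intro map_pmf_cong refl, simp add: answer_query_def numeral_2_eq_2)

lemma steps_read_answer:
  "steps sampling_machine Or R 2 (cfg 12 [T0, T1, tape_of_bits v] u)
    = return_pmf (cfg (if accepting v then 14 else 15) [T0, T1, (fst (tape_of_bits v), 1)] (u + 2))"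
proof -
  obtain t0 h0 where T0: "T0 = (t0, h0)" by fastforce
  obtain t1 h1 where T1: "T1 = (t1, h1)" by fastforce
  define s where "s = fst (tape_of_bits v)"
  have tv: "tape_of_bits v = (s, 0)" by (simp add: s_def tape_of_bits_def)
  have s: "s (Suc 0) = 3 \<longleftrightarrow> accepting v"
    by (cases v) (auto simp: s_def tape_of_bits_def accepting_def)
  have "step sampling_machine Or R (cfg 12 [T0, T1, tape_of_bits v] u) = return_pmf (cfg 13 [T0, T1, (s, 1)] (u + 1))"
    by (subst step_det[where f = "\<lambda>as. (13, keep_tapes (\<lambda>i. if i = 2 then Right else Stay) as)"])
      (simp_all add: program_sampling_machine look_answer_def keep_tapes_def T0 T1 tv read_tape_def write_tape_def)
  moreover have "step sampling_machine Or R (cfg 13 [T0, T1, (s, 1)] (u + 1))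
     = return_pmf (cfg (if accepting v then 14 else 15) [T0, T1, (s, 1)] (u + 1 + 1))"
    by (subst step_det[where f = "\<lambda>as. (if as ! 2 = 3 then 14 else 15, keep_tapes (\<lambda>_. Stay) as)"])
      (simp_all add: program_sampling_machine branch_answer_def keep_tapes_def T0 T1 s read_tape_def write_tape_def)
  ultimately show ?thesis
    by (simp add: numeral_2_eq_2 steps_Suc bind_return_pmf s_def)
qed

text \<open>Copying takes \<open>2 * length s + 4\<close> steps, the query one and reading the
  answer two. The time is larger by one because a classical query costs 2.\<close>

lemma steps_final_query:
  assumes "t 0 = 1" "2 * length s + 7 \<le> k"
  shows "\<exists>c. steps sampling_machine Or R k (cfg 8 [T0, (t, 0), tape_of_bits s] u) = return_pmf c \<and>
    state c = (if accepting (Or s) then 14 else 15) \<and> time_used c = u + 2 * length s + 8"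
proof -
  from steps_copy[where t = t and w = s and X = T0 and u = u and Or = Or and R = R,
      OF disjI2[OF refl] program_sampling_machine(9-11) assms(1)]
  obtain t' where t': "t' 0 = 1" "bits_of_tape (t', 0) = s"
    and 1: "steps sampling_machine Or R (2 * length s + 4) (cfg 8 [T0, (t, 0), tape_of_bits s] u)
      = return_pmf (cfg 11 [T0, (t', 0), (fst (tape_of_bits s), length s + 1)] (u + (2 * length s + 4)))"
    by (auto simp: with_source_def)
  define c where "c = cfg (if accepting (Or s) then 14 else 15) [T0, (t', 0), (fst (tape_of_bits (Or s)), 1)] (u + (2 * length s + 4) + 2 + 2)"
  have "steps sampling_machine Or R (2 * length s + 4 + (1 + (2 + (k - (2 * length s + 7))))) (cfg 8 [T0, (t, 0), tape_of_bits s] u) = return_pmf c"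
  proof (rule steps_trans[OF 1], rule steps_trans)
    show "steps sampling_machine Or R 1 (cfg 11 [T0, (t', 0), (fst (tape_of_bits s), length s + 1)] (u + (2 * length s + 4)))
      = return_pmf (cfg 12 [T0, (t', 0), tape_of_bits (Or s)] (u + (2 * length s + 4) + 2))"
      unfolding steps_1 by (rule step_Query[OF program_sampling_machine(12) t'(2)])
    show "steps sampling_machine Or R (2 + (k - (2 * length s + 7))) (cfg 12 [T0, (t', 0), tape_of_bits (Or s)] (u + (2 * length s + 4) + 2)) = return_pmf c"
    proof (rule steps_trans[OF steps_read_answer])
      have "program sampling_machine ! state c = Halt (accepting (Or s))"
        by (simp add: c_def program_sampling_machine)
      then show "steps sampling_machine Or R (k - (2 * length s + 7)) (cfg (if accepting (Or s) then 14 else 15)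
         [T0, (t', 0), (fst (tape_of_bits (Or s)), 1)] (u + (2 * length s + 4) + 2 + 2)) = return_pmf c"
        unfolding c_def[symmetric] by (rule steps_halted)
    qed
  qed
  moreover have "2 * length s + 4 + (1 + (2 + (k - (2 * length s + 7)))) = k" using assms(2) by simp
  ultimately have "steps sampling_machine Or R k (cfg 8 [T0, (t, 0), tape_of_bits s] u) = return_pmf c" by metis
  then show ?thesis by (intro exI[of _ c]) (simp add: c_def)
qed

text \<open>No assumption is made on what \<open>w\<close> encodes, so this covers inputs for which
  the oracle supplies a circuit as well as all others. The summand 20 absorbs the constant
  overheads.\<close>

lemma run_sampling_machine:
  assumes w: "w = Or x" and short: "\<forall>s\<in>set_pmf (fst (R w)). length s \<le> S"
    and T: "2 * length x + 2 * length w + 2 * S + snd (R w) + 20 \<le> T"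
  shows "\<forall>c \<in> set_pmf (run sampling_machine Or R x T).
      c \<in> outputs sampling_machine True \<union> outputs sampling_machine False \<and> time_used c \<le> T"
    and "measure_pmf.prob (run sampling_machine Or R x T) (outputs sampling_machine b)
      = measure_pmf.prob (fst (R w)) {s. accepting (Or s) = b}"
proof -
  note S = short[rule_format]
  have "init_config sampling_machine x = cfg 0 [tape_of_bits x, tape_of_bits [], tape_of_bits []] 0"
    by (simp add: init_config_def sampling_machine_def numeral_2_eq_2)
  moreover have e: "tape_of_bits [] = (fst (tape_of_bits []), 0)" "fst (tape_of_bits []) 0 = 1"
    by (simp_all add: tape_of_bits_def)
  ultimately have init: "init_config sampling_machine x = cfg 0 [tape_of_bits x, (fst (tape_of_bits []), 0), tape_of_bits []] 0"
    by simp
  from steps_copy[where t = "fst (tape_of_bits [])" and w = x and X = "tape_of_bits []" and u = 0 and Or = Or and R = R,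
      OF disjI1[OF refl] program_sampling_machine(1-3) e(2)]
  obtain t1 where t1: "t1 0 = 1" "bits_of_tape (t1, 0) = x"
    and 1: "steps sampling_machine Or R (2 * length x + 4) (init_config sampling_machine x)
      = return_pmf (cfg 3 [(fst (tape_of_bits x), length x + 1), (t1, 0), tape_of_bits []] (2 * length x + 4))"
    unfolding init by (auto simp: with_source_def)
  let ?T0 = "(fst (tape_of_bits x), length x + 1)"
  have 2: "steps sampling_machine Or R 1 (cfg 3 [?T0, (t1, 0), tape_of_bits []] (2 * length x + 4))
     = return_pmf (cfg 4 [?T0, (t1, 0), tape_of_bits w] (2 * length x + 4 + 2))"
    unfolding steps_1 w by (rule step_Query[OF program_sampling_machine(4) t1(2)])
  from steps_copy[where t = t1 and w = w and X = ?T0 and u = "2 * length x + 4 + 2" and Or = Or and R = R,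
      OF disjI2[OF refl] program_sampling_machine(5-7) t1(1)]
  obtain t2 where t2: "t2 0 = 1" "bits_of_tape (t2, 0) = w"
    and 3: "steps sampling_machine Or R (2 * length w + 4) (cfg 4 [?T0, (t1, 0), tape_of_bits w] (2 * length x + 4 + 2))
      = return_pmf (cfg 7 [?T0, (t2, 0), (fst (tape_of_bits w), length w + 1)] (2 * length x + 4 + 2 + (2 * length w + 4)))"
    by (auto simp: with_source_def)
  let ?u = "2 * length x + 4 + 2 + (2 * length w + 4)"
  \<comment> \<open>\<open>?A\<close> counts steps, \<open>?u\<close> counts time; they differ by
    one because of the classical query.\<close>
  let ?A = "2 * length x + 4 + (1 + (2 * length w + 4))"
  define k where "k = T - (?A + 1)"
  have k: "T = ?A + (1 + k)" using T by (simp add: k_def)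
  let ?s = "\<lambda>s. cfg 8 [?T0, (t2, 0), tape_of_bits s] (?u + (1 + snd (R w)))"
  have "steps sampling_machine Or R ?A (init_config sampling_machine x) = return_pmf (cfg 7 [?T0, (t2, 0), (fst (tape_of_bits w), length w + 1)] ?u)"
    by (rule steps_trans[OF 1], rule steps_trans[OF 2], rule 3)
  then have "run sampling_machine Or R x T = bind_pmf (step sampling_machine Or R (cfg 7 [?T0, (t2, 0), (fst (tape_of_bits w), length w + 1)] ?u)) (steps sampling_machine Or R k)"
    unfolding run_eq_steps k steps_add[of _ _ _ ?A] steps_add[of _ _ _ 1] steps_1 by (simp add: bind_return_pmf)
  also have "\<dots> = bind_pmf (fst (R w)) (\<lambda>s. steps sampling_machine Or R k (?s s))"
    unfolding step_Query_NQC[OF program_sampling_machine(8) t2(2)] bind_map_pmf ..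
  finally have run: "run sampling_machine Or R x T = bind_pmf (fst (R w)) (\<lambda>s. steps sampling_machine Or R k (?s s))" .
  have "\<forall>s\<in>set_pmf (fst (R w)). \<exists>c. steps sampling_machine Or R k (?s s) = return_pmf c \<and>
    state c = (if accepting (Or s) then 14 else 15) \<and> time_used c = ?u + (1 + snd (R w)) + 2 * length s + 8"
  proof
    fix s assume "s \<in> set_pmf (fst (R w))"
    then have "length s \<le> S" by (rule S)
    then have "2 * length s + 7 \<le> k" using T unfolding k_def by simp
    then show "\<exists>c. steps sampling_machine Or R k (?s s) = return_pmf c \<and>
      state c = (if accepting (Or s) then 14 else 15) \<and> time_used c = ?u + (1 + snd (R w)) + 2 * length s + 8"
      by (rule steps_final_query[where Or = Or and R = R and t = t2, OF t2(1)])
  qed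
  then obtain f where f: "\<And>s. s \<in> set_pmf (fst (R w)) \<Longrightarrow> steps sampling_machine Or R k (?s s) = return_pmf (f s) \<and>
    state (f s) = (if accepting (Or s) then 14 else 15) \<and> time_used (f s) = ?u + (1 + snd (R w)) + 2 * length s + 8"
    by metis
  have "run sampling_machine Or R x T = bind_pmf (fst (R w)) (\<lambda>s. return_pmf (f s))"
    unfolding run by (rule bind_pmf_cong) (use f in auto)
  then have map: "run sampling_machine Or R x T = map_pmf f (fst (R w))"
    by (simp add: map_pmf_def)
  have out: "f s \<in> outputs sampling_machine b \<longleftrightarrow> accepting (Or s) = b" if "s \<in> set_pmf (fst (R w))" for s b
    using f[OF that] by (auto simp: outputs_def program_sampling_machine)
  show "\<forall>c \<in> set_pmf (run sampling_machine Or R x T).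
      c \<in> outputs sampling_machine True \<union> outputs sampling_machine False \<and> time_used c \<le> T"
  proof
    fix c assume "c \<in> set_pmf (run sampling_machine Or R x T)"
    then obtain s where s: "s \<in> set_pmf (fst (R w))" "c = f s" unfolding map by auto
    have "time_used c \<le> T" using f[OF s(1)] S[OF s(1)] T unfolding s(2) by simp
    then show "c \<in> outputs sampling_machine True \<union> outputs sampling_machine False \<and> time_used c \<le> T"
      using out[OF s(1)] unfolding s(2) by auto
  qed
  show "measure_pmf.prob (run sampling_machine Or R x T) (outputs sampling_machine b)
      = measure_pmf.prob (fst (R w)) {s. accepting (Or s) = b}"
    unfolding map measure_map_pmf
    by (rule measure_pmf.finite_measure_eq_AE) (use out in \<open>auto simp: AE_measure_pmf_iff\<close>)
qed

section \<open>The sampling circuit\<close>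

text \<open>The root of \<open>2 z + 1\<close> or \<open>2 z - 1\<close>, located on the real
  segment from -1 to 0 or from 0 to 1.\<close>

definition alg_half :: "bool \<Rightarrow> alg" where
  "alg_half neg = (if neg then Alg [1, 2] 1 (- 1) 0 0 0 else Alg [- 1, 2] 1 0 1 0 0)"

lemma alg_denotes_half: "alg_denotes (alg_half neg) z \<longleftrightarrow> z = (if neg then - 1 / 2 else 1 / 2)"
proof -
  have "1 + 2 * z = 0 \<longleftrightarrow> z = - 1 / 2"
    by (metis add.commute add_eq_0_iff mult.commute nonzero_eq_divide_eq zero_neq_numeral)
  moreover have "- 1 + 2 * z = 0 \<longleftrightarrow> z = 1 / 2"
    by (metis add.commute add_uminus_conv_diff eq_iff_diff_eq_0 mult.commute nonzero_eq_divide_eq zero_neq_numeral)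
  moreover have "alg_denotes (Alg [1, 2] 1 (- 1) 0 0 0) z \<longleftrightarrow> 1 + 2 * z = 0 \<and> - 1 \<le> Re z \<and> Re z \<le> 0 \<and> 0 \<le> Im z \<and> Im z \<le> 0"
    "alg_denotes (Alg [- 1, 2] 1 0 1 0 0) z \<longleftrightarrow> - 1 + 2 * z = 0 \<and> 0 \<le> Re z \<and> Re z \<le> 1 \<and> 0 \<le> Im z \<and> Im z \<le> 0"
    by (simp_all add: map_poly_pCons mult.commute)
  ultimately have "alg_denotes (Alg [1, 2] 1 (- 1) 0 0 0) z \<longleftrightarrow> z = - 1 / 2 \<and> - 1 \<le> Re z \<and> Re z \<le> 0 \<and> 0 \<le> Im z \<and> Im z \<le> 0"
    "alg_denotes (Alg [- 1, 2] 1 0 1 0 0) z \<longleftrightarrow> z = 1 / 2 \<and> 0 \<le> Re z \<and> Re z \<le> 1 \<and> 0 \<le> Im z \<and> Im z \<le> 0"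
    by (simp_all only:)
  moreover have "- 1 \<le> Re (- 1 / 2) \<and> Re (- 1 / 2) \<le> 0 \<and> 0 \<le> Im (- 1 / 2) \<and> Im (- 1 / 2) \<le> 0"
    "0 \<le> Re (1 / 2) \<and> Re (1 / 2) \<le> 1 \<and> 0 \<le> Im (1 / 2) \<and> Im (1 / 2) \<le> 0" by simp_all
  ultimately show ?thesis unfolding alg_half_def by (cases neg) (simp_all only: if_True if_False, blast+)
qed

lemma alg_val_half: "alg_val (alg_half neg) = (if neg then - 1 / 2 else 1 / 2)"
  unfolding alg_val_def alg_denotes_half by (rule the_equality) simp_all

definition hadamard2_neg :: "nat \<Rightarrow> nat \<Rightarrow> bool" where
  "hadamard2_neg r c = odd (of_bool (bit r 0 \<and> bit c 0) + of_bool (bit r 1 \<and> bit c 1) :: nat)"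

definition hadamard2_desc :: "alg list" where
  "hadamard2_desc = map (\<lambda>p. alg_half (hadamard2_neg (p div 4) (p mod 4))) [0..<16]"

definition hadamard_descs :: "nat \<Rightarrow> gate_desc list" where
  "hadamard_descs k = map (\<lambda>i. (2 * i, 2 * i + 1, hadamard2_desc)) [0..<k]"

lemma gate_of_hadamard2_desc: "gate_of_desc (i, j, hadamard2_desc) = (i, j, hadamard2)"
proof -
  have "alg_val (hadamard2_desc ! (4 * r + c)) = (if hadamard2_neg r c then - 1 / 2 else 1 / 2)"
    if "r < 4" "c < 4" for r c
    using that by (simp add: hadamard2_desc_def alg_val_half)
  then show ?thesis
    unfolding gate_of_desc_def hadamard2_def hadamard2_neg_def[symmetric] by (auto intro!: cong_mat)
qed

lemma gates_of_hadamard_descs: "map gate_of_desc (hadamard_descs k) = hadamard_gates k"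
  by (simp add: hadamard_descs_def hadamard_gates_def gate_of_hadamard2_desc)

lemma unitary_hadamard2: "unitary_mat 4 hadamard2"
proof -
  have c: "hadamard2 \<in> carrier_mat 4 4" by (simp add: hadamard2_def)
  have adj: "mat_adjoint hadamard2 = hadamard2"
  proof (rule eq_matI)
    fix i j assume "i < dim_row hadamard2" "j < dim_col hadamard2"
    then have "i < 4" "j < 4" using c by auto
    then show "mat_adjoint hadamard2 $$ (i, j) = hadamard2 $$ (i, j)"
      unfolding mat_adjoint_def hadamard2_def
      by (auto simp: mat_of_rows_def conjugate_vec_def conj_commute)
  qed (use c in \<open>auto simp: mat_adjoint_def\<close>)
  have "hadamard2 * hadamard2 = 1\<^sub>m 4"
  proof (rule eq_matI)
    fix i j assume "i < dim_row (1\<^sub>m 4 :: complex mat)" "j < dim_col (1\<^sub>m 4 :: complex mat)"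
    then have ij: "i \<in> {0, 1, 2, 3}" "j \<in> {0, 1, 2, 3}" by auto
    have e: "hadamard2 $$ (r, s) = (if hadamard2_neg r s then - 1 / 2 else 1 / 2)" if "r < 4" "s < 4" for r s
      using that by (simp add: hadamard2_def hadamard2_neg_def)
    have b: "bit (2::nat) 1" "\<not> bit (1::nat) 1" "bit (3::nat) 1" "bit (3::nat) 0" "bit (Suc 0) 0" "\<not> bit (Suc 0) 1" "\<not> bit (Suc 0) (Suc 0)" "bit (2::nat) (Suc 0)" "bit (3::nat) (Suc 0)" "\<not> bit (2::nat) 0"
      by (simp_all add: bit_iff_odd)
    have "(hadamard2 * hadamard2) $$ (i, j) = (\<Sum>k<4. hadamard2 $$ (i, k) * hadamard2 $$ (k, j))"
      using ij c by (auto simp: scalar_prod_def atLeast0LessThan)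
    also have "\<dots> = 1\<^sub>m 4 $$ (i, j)"
      using ij by (auto simp: e hadamard2_neg_def b lessThan_nat_numeral)
    finally show "(hadamard2 * hadamard2) $$ (i, j) = 1\<^sub>m 4 $$ (i, j)" .
  qed (use c in auto)
  then show ?thesis unfolding unitary_mat_def adj using c by simp
qed

text \<open>\<open>8 n\<close> query qubits and \<open>8 n + 2\<close> answer qubits, the 2 being
  the leading zeros of a label; \<open>4 n\<close> two-qubit gates cover the query register.\<close>

definition sample_circuit :: "nat \<Rightarrow> circuit_desc" where
  "sample_circuit n = (16 * n + 2, [Depth1 (hadamard_descs (4 * n)), Oracle (8 * n), Depth1 (hadamard_descs (4 * n))])"

lemma valid_sample_circuit:
  assumes "out_len Or (8 * n) = 8 * n + 2"
  shows "valid_circuit Or (sample_circuit n)"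
proof -
  have "depth1_gates (16 * n + 2) (hadamard_gates (4 * n))"
    unfolding depth1_gates_def touched_hadamard_gates
    using distinct_touched_hadamard_gates unitary_hadamard2 by (auto simp: hadamard_gates_def)
  moreover have "length hadamard2_desc = 16" "\<forall>r\<in>set hadamard2_desc. \<exists>!z. alg_denotes r z"
    by (auto simp: hadamard2_desc_def alg_denotes_half)
  ultimately have "valid_layer Or (16 * n + 2) (Depth1 (hadamard_descs (4 * n)))"
    unfolding valid_layer.simps gates_of_hadamard_descs by (auto simp: hadamard_descs_def)
  then show ?thesis
    using assms by (simp add: valid_circuit_def sample_circuit_def)
qed

lemma nqc_sample_circuit:
  assumes "out_len Or (8 * n) = 8 * n + 2"
  shows "nqc lam Or (enc_circuit (sample_circuit n)) =
    (noisy_outcome lam (16 * n + 2) (sample_layers Or (16 * n + 2) (4 * n)), (16 * n + 2) * 3)"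
proof -
  have "the_inv enc_circuit (enc_circuit (sample_circuit n)) = sample_circuit n"
    by (rule the_inv_f_f[OF inj_enc_circuit])
  then show ?thesis
    using valid_sample_circuit[OF assms]
    by (auto simp: nqc_def sample_circuit_def sample_layers_def gates_of_hadamard_descs)
qed

lemma enc_circuit_ge_2: "2 \<le> length (enc_circuit C)"
  by (cases C) (simp add: enc_circuit_def enc_unary_def enc_list_def)

lemma nqc_not_code:
  assumes "\<And>C. enc_circuit C \<noteq> w"
  shows "nqc lam Or w = (return_pmf [], 0)"
  using assms by (simp add: nqc_def)

lemma nqc_short: "length w < 2 \<Longrightarrow> nqc lam Or w = (return_pmf [], 0)"
  using enc_circuit_ge_2 by (intro nqc_not_code) (metis leD)

text \<open>Two zeros already encode the empty circuit on no qubits, and in a prefix code no proper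
  extension of a codeword is a codeword.\<close>

lemma nqc_False_False: "v \<noteq> [] \<Longrightarrow> nqc lam Or (False # False # v) = (return_pmf [], 0)"
proof (rule nqc_not_code)
  fix C assume v: "v \<noteq> []"
  have "enc_circuit (0, []) = [False, False]"
    by (simp add: enc_circuit_def enc_unary_def enc_list_def)
  then show "enc_circuit C \<noteq> False # False # v"
    using prefix_codeD[OF prefix_code_circuit, of C "[]" "(0, [])" v] v by auto
qed

lemma length_enc_list: "length (enc_list f xs) = (\<Sum>x\<leftarrow>xs. length (f x) + 1) + 1"
  by (induction xs) (auto simp: enc_list_def)

text \<open>Quadratic because the gates name their qubits in unary; the constant is
  generous.\<close>

lemma length_enc_sample_circuit:
  "\<exists>B. \<forall>n. length (enc_circuit (sample_circuit n)) \<le> B * (n + 1) ^ 2"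
proof -
  define e where "e = length (enc_list enc_alg hadamard2_desc)"
  have g: "length (enc_list enc_gate (hadamard_descs k)) \<le> k * (4 * k + e + 3) + 1" for k
  proof -
    have "length (enc_gate (2 * i, 2 * i + 1, hadamard2_desc)) + 1 = 2 * i + (2 * i + 1) + e + 3" for i
      by (simp add: enc_gate_def enc_unary_def e_def)
    then have "length (enc_list enc_gate (hadamard_descs k)) = (\<Sum>i\<leftarrow>[0..<k]. 2 * i + (2 * i + 1) + e + 3) + 1"
      unfolding length_enc_list hadamard_descs_def map_map o_def by (simp only:)
    also have "\<dots> = (\<Sum>i<k. 2 * i + (2 * i + 1) + e + 3) + 1"
      by (simp only: interv_sum_list_conv_sum_set_nat set_upt atLeast0LessThan)
    also have "(\<Sum>i<k. 2 * i + (2 * i + 1) + e + 3) \<le> (\<Sum>i<k. 4 * k + e + 3)"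
      by (intro sum_mono) auto
    finally show ?thesis by simp
  qed
  have "length (enc_circuit (sample_circuit n)) \<le> (2 * (16 + 4 * e + 12 + 64) + 50) * (n + 1) ^ 2" for n
  proof -
    have "length (enc_circuit (sample_circuit n)) = 24 * n + 11 + 2 * length (enc_list enc_gate (hadamard_descs (4 * n)))"
      by (simp add: enc_circuit_def sample_circuit_def enc_unary_def enc_list_def[of enc_layer])
    also have "\<dots> \<le> 24 * n + 11 + 2 * (4 * n * (4 * (4 * n) + e + 3) + 1)"
      using g[of "4 * n"] by simp
    also have "\<dots> \<le> (2 * (16 + 4 * e + 12 + 64) + 50) * (n + 1) ^ 2"
      by (simp add: power2_eq_square algebra_simps)
    finally show ?thesis .
  qed
  then show ?thesis by blast
qed

section \<open>Diagonalization\<close>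

text \<open>From 8 on the lengths \<open>n\<close>, \<open>8 n\<close> and \<open>16 n + 2\<close>
  of a stage lie below the next stage, and \<open>2^(-n)\<close> is at most \<open>1 / 256\<close>.
  The exponential growth puts later stages out of reach of every run that a stage has to
  defeat.\<close>

primrec stage_length :: "nat \<Rightarrow> nat" where
  "stage_length 0 = 8"
| "stage_length (Suc i) = 2 ^ stage_length i"

lemma exp_gt_linear: "8 \<le> n \<Longrightarrow> 16 * n + 2 < (2::nat) ^ n"
  by (induction n rule: dec_induct) auto

lemma stage_length_ge: "8 \<le> stage_length i"
proof (induction i)
  case (Suc i)
  then have "16 * stage_length i + 2 < stage_length (Suc i)" by (simp only: stage_length.simps exp_gt_linear)
  then show ?case using Suc by linarith
qed simp

lemma stage_length_gap: "16 * stage_length i + 2 < stage_length (Suc i)"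
  unfolding stage_length.simps by (rule exp_gt_linear[OF stage_length_ge])

lemma strict_mono_stage_length: "strict_mono stage_length"
  by (rule strict_mono_Suc_iff[THEN iffD2]) (use stage_length_gap add_leE less_or_eq_imp_le in \<open>force intro: le_less_trans[OF _ stage_length_gap]\<close>)

text \<open>Lengths below \<open>stage_length 0\<close> are also assigned to stage 0.\<close>

definition stage_of :: "nat \<Rightarrow> nat" where
  "stage_of l = (LEAST i. l < stage_length (Suc i))"

lemma stage_of_eq:
  assumes "stage_length i \<le> l" "l < stage_length (Suc i)"
  shows "stage_of l = i"
  unfolding stage_of_def
proof (rule Least_equality)
  fix j assume "l < stage_length (Suc j)"
  then have "stage_length i < stage_length (Suc j)" using assms(1) by (rule le_less_trans[rotated])
  then show "i \<le> j" by (simp only: strict_mono_less[OF strict_mono_stage_length] less_Suc_eq_le)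
qed (rule assms(2))

lemma stage_of_le: "l < stage_length (Suc i) \<Longrightarrow> stage_of l \<le> i"
  unfolding stage_of_def by (rule Least_le)

lemma stage_of_multiples:
  "stage_of (stage_length i) = i" "stage_of (8 * stage_length i) = i" "stage_of (16 * stage_length i + 2) = i"
  using stage_length_gap[of i] by (intro stage_of_eq; linarith)+

text \<open>The matrix, the permutation and the secret bit of a stage.\<close>

type_synonym stage_data = "(nat \<Rightarrow> nat) \<times> (nat \<Rightarrow> nat) \<times> bool"

definition stage_labels :: "nat \<Rightarrow> stage_data \<Rightarrow> nat \<Rightarrow> nat" where
  "stage_labels n = (\<lambda>(A, G, b). G \<circ> coset_rep A n (8 * n))"

definition stage_accept :: "nat \<Rightarrow> stage_data \<Rightarrow> nat set" where
  "stage_accept n = (\<lambda>(A, G, b). if b then near_code A n (8 * n) n else {})"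

text \<open>The length \<open>16 n + 2\<close> of the verification queries is the number of qubits
  of the circuit, so an outcome can be submitted as it is.\<close>

definition separating_oracle :: "(nat \<Rightarrow> stage_data) \<Rightarrow> bits \<Rightarrow> bits" where
  "separating_oracle D w = (let l = length w; n = stage_length (stage_of l); d = D (stage_of l) in
     if l = 8 * n then False # False # bits_of_index (8 * n) (stage_labels n d (index_of_bits w))
     else if l = 16 * n + 2 then [take_bit (8 * n) (index_of_bits w) \<in> stage_accept n d]
     else if l = n then enc_circuit (sample_circuit n)
     else [])"

text \<open>Redefining one stage changes the oracle only at its label and verification lengths,
  which is the form required by \<open>stage_lower_bound\<close>.\<close>

lemma separating_oracle_update:
  "separating_oracle (D(i := d)) = label_oracle (separating_oracle D) (8 * stage_length i) (16 * stage_length i + 2)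
     (stage_labels (stage_length i) d) (stage_accept (stage_length i) d)"
proof
  fix w
  let ?n = "stage_length i"
  show "separating_oracle (D(i := d)) w = label_oracle (separating_oracle D) (8 * ?n) (16 * ?n + 2)
     (stage_labels ?n d) (stage_accept ?n d) w"
  proof (cases "length w = 8 * ?n \<or> length w = 16 * ?n + 2")
    case True
    then have "stage_of (length w) = i" using stage_of_multiples[of i] by (elim disjE) simp_all
    then show ?thesis using True unfolding separating_oracle_def label_oracle_def Let_def
      by (elim disjE) (simp_all only: fun_upd_same if_True if_False split: if_split, simp_all)
  next
    case False
    then show ?thesis
      by (cases "stage_of (length w) = i") (simp_all add: separating_oracle_def label_oracle_def Let_def)
  qed
qed

lemma separating_oracle_cong:
  assumes "\<And>j. j \<le> i \<Longrightarrow> D j = D' j" "length w < stage_length (Suc i)"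
  shows "separating_oracle D w = separating_oracle D' w"
  using assms(1)[OF stage_of_le[OF assms(2)]] by (simp add: separating_oracle_def Let_def)

lemma classical_separating_oracle: "classical_oracle (separating_oracle D)"
  unfolding classical_oracle_def
  by (rule exI[of _ "\<lambda>l. let n = stage_length (stage_of l) in
     if l = 8 * n then 8 * n + 2 else if l = 16 * n + 2 then 1 else if l = n then length (enc_circuit (sample_circuit n)) else 0"])
    (simp add: separating_oracle_def Let_def)

text \<open>One test input per stage is enough, since the language depends only on the length of the
  input.\<close>

definition fails_at :: "ptm \<Rightarrow> nat \<Rightarrow> nat \<Rightarrow> (nat \<Rightarrow> stage_data) \<Rightarrow> bool" where
  "fails_at M T i D \<longleftrightarrow> (let R = run M (separating_oracle D) no_oracle (replicate (stage_length i) True) T in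
     \<not> ((snd (snd (D i)) \<longrightarrow> measure_pmf.prob R (outputs M True) \<ge> 2 / 3) \<and>
        (\<not> snd (snd (D i)) \<longrightarrow> measure_pmf.prob R (outputs M False) \<ge> 2 / 3)))"

lemma run_cong_short:
  assumes M: "wf_ptm M" and eq: "\<And>w. length w < T \<Longrightarrow> Or w = Or' w"
  shows "run M Or no_oracle x T = run M Or' no_oracle x T"
  unfolding run_eq_coins
proof (rule map_pmf_cong[OF refl])
  fix cs assume "cs \<in> set_pmf (coins T)"
  then have "length cs = T" by (rule length_coins)
  then have "Or' w = Or w" if "w \<in> queried M Or cs (init_config M x)" for w
    using eq[of w] length_queried[OF M that] by simp
  then show "foldr (dstep M Or) cs (init_config M x) = foldr (dstep M Or') cs (init_config M x)"
    using queried_cong[of M Or cs "init_config M x" Or'] by metis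
qed

lemma fails_at_cong:
  assumes M: "wf_ptm M" and T: "T \<le> stage_length (Suc i)" and eq: "\<And>j. j \<le> i \<Longrightarrow> D j = D' j"
  shows "fails_at M T i D = fails_at M T i D'"
proof -
  have "run M (separating_oracle D) no_oracle x T = run M (separating_oracle D') no_oracle x T" for x
    by (rule run_cong_short[OF M], rule separating_oracle_cong[OF eq]) (use T in auto)
  then show ?thesis using eq[of i] by (simp add: fails_at_def)
qed

lemma exists_failing_stage:
  assumes M: "wf_ptm M" and T: "3 * (T * T + T) < 2 ^ stage_length i"
  shows "\<exists>d. fst (snd d) permutes {..<2 ^ (8 * stage_length i)} \<and> fails_at M T i (D(i := d))"
proof -
  let ?n = "stage_length i"
  let ?x = "replicate ?n True"
  obtain A G b where G: "G permutes {..<2 ^ (8 * ?n)}" and f: "\<not> ((b \<longrightarrow> measure_pmf.prob (run M (label_oracle (separating_oracle D) (8 * ?n) (16 * ?n + 2) (G \<circ> coset_rep A ?n (8 * ?n)) (if b then near_code A ?n (8 * ?n) ?n else {})) no_oracle ?x T) (outputs M True) \<ge> 2 / 3) \<and>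
      (\<not> b \<longrightarrow> measure_pmf.prob (run M (label_oracle (separating_oracle D) (8 * ?n) (16 * ?n + 2) (G \<circ> coset_rep A ?n (8 * ?n)) (if b then near_code A ?n (8 * ?n) ?n else {})) no_oracle ?x T) (outputs M False) \<ge> 2 / 3))"
    using stage_lower_bound[OF M T refl, of "separating_oracle D" "16 * ?n + 2" ?x] by (elim exE conjE)
  show ?thesis
  proof (rule exI[of _ "(A, G, b)"], rule conjI)
    show "fst (snd (A, G, b)) permutes {..<2 ^ (8 * ?n)}" using G by (simp only: fst_conv snd_conv)
    show "fails_at M T i (D(i := (A, G, b)))"
      unfolding fails_at_def Let_def separating_oracle_update stage_labels_def stage_accept_def prod.case fun_upd_same snd_conv
      by (rule f)
  qed
qed

text \<open>Stages are settled in order. A failure arranged at stage \<open>i\<close> persists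
  because it depends only on the data up to \<open>i\<close>.\<close>

lemma diagonal_choice:
  fixes Fail :: "nat \<Rightarrow> (nat \<Rightarrow> 'd) \<Rightarrow> bool"
  assumes ex: "\<And>D i. \<exists>d. P i d \<and> Fail i (D(i := d))"
    and cong: "\<And>D D' i. (\<And>j. j \<le> i \<Longrightarrow> D j = D' j) \<Longrightarrow> Fail i D = Fail i D'"
  shows "\<exists>D. \<forall>i. P i (D i) \<and> Fail i D"
proof -
  \<comment> \<open>\<open>E i\<close> has settled the stages below \<open>i\<close>; its
    \<open>undefined\<close> entries from \<open>i\<close> on are harmless, since
    \<open>Fail\<close> at a stage ignores later stages.\<close>
  define E where "E = rec_nat (\<lambda>_. undefined) (\<lambda>i D. D(i := SOME d. P i d \<and> Fail i (D(i := d))))"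
  define D where "D i = E (Suc i) i" for i
  have E: "E (Suc i) = (E i)(i := SOME d. P i d \<and> Fail i ((E i)(i := d)))" for i
    by (simp add: E_def)
  have P: "P i (E (Suc i) i) \<and> Fail i (E (Suc i))" for i
    using someI_ex[OF ex[of i "E i"]] unfolding E by simp
  have stable: "E (Suc (j + k)) j = E (Suc j) j" for j k
    by (induction k) (simp_all add: E)
  have "Fail i D = Fail i (E (Suc i))" for i
  proof (rule cong)
    fix j assume "j \<le> i"
    then obtain k where "i = j + k" using le_Suc_ex by blast
    then show "D j = E (Suc i) j" using stable[of j k] by (simp only: D_def)
  qed
  then show ?thesis using P by (intro exI[of _ D]) (simp add: D_def)
qed

text \<open>A pair of a machine and a polynomial is attacked at infinitely many stages, since the third
  component of the code is not used.\<close>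

definition stage_machine :: "nat \<Rightarrow> ptm" where
  "stage_machine i = norm_ptm (SOME M. wf_ptm M \<and> to_nat_on (norm_ptm ` Collect wf_ptm) (norm_ptm M) = fst (from_nat i :: nat \<times> nat list \<times> nat))"

definition stage_time :: "nat \<Rightarrow> nat" where
  "stage_time i = poly (Poly (fst (snd (from_nat i :: nat \<times> nat list \<times> nat)))) (stage_length i)"

text \<open>Vacuous when the code names no machine or the time bound is still too large for this
  stage, so that suitable data exist at every stage.\<close>

definition stage_fails :: "nat \<Rightarrow> (nat \<Rightarrow> stage_data) \<Rightarrow> bool" where
  "stage_fails i D \<longleftrightarrow> (wf_ptm (stage_machine i) \<and> 3 * (stage_time i * stage_time i + stage_time i) < 2 ^ stage_length i
     \<longrightarrow> fails_at (stage_machine i) (stage_time i) i D)"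

lemma exists_diagonal_data:
  "\<exists>D. \<forall>i. fst (snd (D i)) permutes {..<2 ^ (8 * stage_length i)} \<and> stage_fails i D"
proof (rule diagonal_choice)
  fix D :: "nat \<Rightarrow> stage_data" and i
  let ?S = "{..<(2::nat) ^ (8 * stage_length i)}"
  show "\<exists>d. fst (snd d) permutes ?S \<and> stage_fails i (D(i := d))"
  proof (cases "wf_ptm (stage_machine i) \<and> 3 * (stage_time i * stage_time i + stage_time i) < 2 ^ stage_length i")
    case True
    from exists_failing_stage[OF conjunct1[OF True] conjunct2[OF True], of D]
    obtain d where d: "fst (snd d) permutes ?S" "fails_at (stage_machine i) (stage_time i) i (D(i := d))"
      by (elim exE conjE)
    have "stage_fails i (D(i := d))" unfolding stage_fails_def using d(2) by (rule impI)
    with d(1) show ?thesis by (intro exI conjI)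
  next
    case False
    have "id permutes ?S" by (rule permutes_id)
    then have "fst (snd (id, id, True)) permutes ?S" by (simp only: fst_conv snd_conv)
    moreover have "stage_fails i (D(i := (id, id, True)))" unfolding stage_fails_def using False by (rule impI[OF notE])
    ultimately show ?thesis by (intro exI conjI)
  qed
next
  fix D D' :: "nat \<Rightarrow> stage_data" and i
  assume eq: "\<And>j. j \<le> i \<Longrightarrow> D j = D' j"
  have "fails_at (stage_machine i) (stage_time i) i D = fails_at (stage_machine i) (stage_time i) i D'"
    if "wf_ptm (stage_machine i)" "3 * (stage_time i * stage_time i + stage_time i) < 2 ^ stage_length i"
  proof (rule fails_at_cong[OF that(1) _ eq])
    \<comment> \<open>The time condition also keeps the run below the next stage length
      \<open>2 ^ stage_length i\<close>, which locality of the failure requires.\<close>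
    have "t < p" if "3 * (t * t + t) < p" for t p :: nat using that by simp
    from this[OF that(2)] show "stage_time i \<le> stage_length (Suc i)" unfolding stage_length.simps by (rule less_imp_le)
  qed
  then show "stage_fails i D = stage_fails i D'" unfolding stage_fails_def by blast
qed

text \<open>The left side is carried over to a real polynomial, where comparison of growth with
  \<open>2 ^ n\<close> applies.\<close>

lemma eventually_poly_small:
  fixes p :: "nat poly"
  shows "eventually (\<lambda>n. 3 * (poly p n * poly p n + poly p n) < 2 ^ n) sequentially"
proof -
  have real_poly: "\<exists>q. \<forall>n. real (poly r n) = poly q (real n)" for r :: "nat poly"
  proof (induction r)
    case (pCons a r)
    then obtain q where "\<forall>n. real (poly r n) = poly q (real n)" by blast
    then show ?case by (intro exI[of _ "pCons (real a) q"]) simp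
  qed (intro exI[of _ 0], simp)
  obtain q where "\<forall>n. real (poly ([:3:] * (p * p + p)) n) = poly q (real n)"
    using real_poly by blast
  then have q: "real (3 * (poly p n * poly p n + poly p n)) = poly q (real n)" for n
    by (simp only: poly_mult poly_add) (simp add: algebra_simps)
  have "eventually (\<lambda>n. norm (poly q (real n)) \<le> 1 / 2 * norm ((2::real) ^ n)) sequentially"
  proof (rule landau_o.smallD)
    have "(\<lambda>n. poly q (real n)) \<in> O(\<lambda>n. real n ^ degree q)"
      unfolding poly_altdef
    proof (rule big_sum_in_bigo)
      fix k assume "k \<in> {..degree q}"
      then have "(\<lambda>n. real n ^ k) \<in> O(\<lambda>n. real n ^ degree q)"
        by (intro bigoI[of _ 1] eventually_mono[OF eventually_ge_at_top[of 1]]) (simp add: power_increasing)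
      then show "(\<lambda>n. coeff q k * real n ^ k) \<in> O(\<lambda>n. real n ^ degree q)" by simp
    qed
    also have "(\<lambda>n. real n ^ degree q) \<in> o(\<lambda>n. 2 ^ n)" by real_asymp
    finally show "(\<lambda>n. poly q (real n)) \<in> o(\<lambda>n. 2 ^ n)" .
  qed simp
  then show ?thesis
  proof (rule eventually_mono)
    fix n assume "norm (poly q (real n)) \<le> 1 / 2 * norm ((2::real) ^ n)"
    then have "poly q (real n) \<le> 1 / 2 * 2 ^ n" by simp
    also have "\<dots> < 2 ^ n" by simp
    finally have "real (3 * (poly p n * poly p n + poly p n)) < real (2 ^ n)" unfolding q by simp
    then show "3 * (poly p n * poly p n + poly p n) < 2 ^ n" by (simp only: of_nat_less_iff)
  qed
qed

section \<open>The separating language\<close>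

definition separating_language :: "(nat \<Rightarrow> stage_data) \<Rightarrow> bits set" where
  "separating_language D = {x. \<exists>i. length x = stage_length i \<and> snd (snd (D i))}"

lemma separating_language_iff:
  "length x = stage_length i \<Longrightarrow> x \<in> separating_language D \<longleftrightarrow> snd (snd (D i))"
  using strict_mono_eq[OF strict_mono_stage_length] by (auto simp: separating_language_def)

lemma stage_machine_eq:
  assumes "wf_ptm M" "fst (from_nat i :: nat \<times> nat list \<times> nat) = to_nat_on (norm_ptm ` Collect wf_ptm) (norm_ptm M)"
  shows "stage_machine i = norm_ptm M"
proof -
  let ?S = "norm_ptm ` Collect wf_ptm"
  have S: "countable ?S" using countable_norm_ptms by (rule countable_subset[rotated]) auto
  let ?P = "\<lambda>M'. wf_ptm M' \<and> to_nat_on ?S (norm_ptm M') = fst (from_nat i :: nat \<times> nat list \<times> nat)"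
  have P: "?P (SOME M'. ?P M')" by (rule someI[of ?P M]) (simp add: assms)
  show ?thesis
    unfolding stage_machine_def
    by (rule inj_onD[OF inj_on_to_nat_on[OF S]]) (use P assms in auto)
qed

lemma separating_language_not_BPP:
  assumes "\<And>i. stage_fails i D"
  shows "separating_language D \<notin> BPP (separating_oracle D)"
proof
  assume "separating_language D \<in> BPP (separating_oracle D)"
  then obtain M p where M: "wf_ptm M"
    and dec: "\<And>x. let T = poly p (length x); E = run M (separating_oracle D) no_oracle x T in
       (\<forall>c \<in> set_pmf E. c \<in> outputs M True \<union> outputs M False \<and> time_used c \<le> T) \<and>
       (x \<in> separating_language D \<longrightarrow> measure_pmf.prob E (outputs M True) \<ge> 2 / 3) \<and>
       (x \<notin> separating_language D \<longrightarrow> measure_pmf.prob E (outputs M False) \<ge> 2 / 3)"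
    unfolding BPP_def decides_poly_time_def by blast
  define a where "a = to_nat_on (norm_ptm ` Collect wf_ptm) (norm_ptm M)"
  define code where "code k = to_nat (a, coeffs p, k)" for k :: nat
  obtain N0 where N0: "\<And>n. n \<ge> N0 \<Longrightarrow> 3 * (poly p n * poly p n + poly p n) < 2 ^ n"
    using eventually_poly_small[of p] unfolding eventually_sequentially by blast
  have "inj code" by (rule injI) (simp add: code_def)
  then have "infinite (range code)" by (rule range_inj_infinite)
  then obtain k where "N0 \<le> code k" unfolding infinite_nat_iff_unbounded_le by blast
  moreover define i where "i = code k"
  \<comment> \<open>Large codes thus mean long inputs, beyond the threshold \<open>N0\<close> for
    the polynomial.\<close>
  moreover have "i \<le> stage_length i" by (rule strict_mono_imp_increasing[OF strict_mono_stage_length])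
  ultimately have small: "3 * (poly p (stage_length i) * poly p (stage_length i) + poly p (stage_length i)) < 2 ^ stage_length i"
    by (intro N0) simp
  have fi: "(from_nat i :: nat \<times> nat list \<times> nat) = (a, coeffs p, k)" by (simp add: i_def code_def)
  have mi: "stage_machine i = norm_ptm M" by (rule stage_machine_eq[OF M]) (simp add: fi a_def)
  have ti: "stage_time i = poly p (stage_length i)" by (simp add: stage_time_def fi)
  have "fails_at (norm_ptm M) (poly p (stage_length i)) i D"
    using assms[of i] wf_norm_ptm[OF M] small unfolding stage_fails_def mi ti by blast
  then show False
    using dec[of "replicate (stage_length i) True"] separating_language_iff[of "replicate (stage_length i) True" i D]
    unfolding fails_at_def Let_def prob_outputs_norm_ptm[OF M] length_replicate by blast
qed

section \<open>The oracle at a single stage\<close>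

context
  fixes D :: "nat \<Rightarrow> stage_data" and i :: nat and n K :: nat
  assumes perm: "fst (snd (D i)) permutes {..<2 ^ (8 * stage_length i)}"
    and n: "n = stage_length i" and K: "K = 8 * n"
begin

lemma oracle_at_labels:
  "length w = K \<Longrightarrow> separating_oracle D w = False # False # bits_of_index K (stage_labels n (D i) (index_of_bits w))"
  using stage_of_multiples[of i] by (simp add: separating_oracle_def Let_def K n)

lemma oracle_at_verification:
  assumes "length w = 16 * n + 2"
  shows "separating_oracle D w = [take_bit K (index_of_bits w) \<in> stage_accept n (D i)]"
proof -
  have "stage_of (length w) = i" unfolding assms n by (rule stage_of_multiples)
  moreover have "length w \<noteq> 8 * n" using assms by simp
  ultimately show ?thesis using assms by (simp add: separating_oracle_def Let_def K n)
qed

lemma oracle_at_input: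
  assumes "length w = n"
  shows "separating_oracle D w = enc_circuit (sample_circuit n)"
proof -
  have "stage_of (length w) = i" unfolding assms n by (rule stage_of_multiples)
  moreover have "length w \<noteq> 8 * n" "length w \<noteq> 16 * n + 2" using assms stage_length_ge[of i] n by auto
  ultimately show ?thesis using assms by (simp add: separating_oracle_def Let_def n)
qed

lemma out_len_labels: "out_len (separating_oracle D) K = K + 2"
  unfolding out_len_def by (subst oracle_at_labels) simp_all

text \<open>The permutation, the binary notation and the leading zeros are all injective, so a label
  determines the coset representative and nothing finer.\<close>

lemma oracle_value_cosets:
  assumes a: "a < 2 ^ K" and b: "b < 2 ^ K"
  shows "oracle_value (separating_oracle D) K a = oracle_value (separating_oracle D) K b \<longleftrightarrow> coset_eq (fst (D i)) n K a b"
proof -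
  obtain A G c where d: "D i = (A, G, c)" by (cases "D i")
  have G: "G permutes {..<2 ^ K}" using perm unfolding d K n by simp
  define lab where "lab x = G (coset_rep A n K x)" for x
  have less: "lab x < 2 ^ K" if "x < 2 ^ K" for x
  proof -
    have "coset_rep A n K x \<in> {..<2 ^ K}" using coset_rep_le[of A n K x] that by simp
    then show ?thesis using permutes_in_image[OF G] unfolding lab_def by simp
  qed
  have v: "oracle_value (separating_oracle D) K x = index_of_bits (False # False # bits_of_index K (lab x))" if "x < 2 ^ K" for x
    unfolding oracle_value_def oracle_at_labels[OF length_bits_of_index] index_of_bits_of_index take_bit_nat_eq_self[OF that]
    by (simp add: stage_labels_def d lab_def K)
  have "oracle_value (separating_oracle D) K a = oracle_value (separating_oracle D) K b \<longleftrightarrow>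
      False # False # bits_of_index K (lab a) = False # False # bits_of_index K (lab b)"
    unfolding v[OF a] v[OF b] by (rule inj_on_eq_iff[OF inj_on_index_of_bits[of "K + 2"]]) simp_all
  also have "\<dots> \<longleftrightarrow> bits_of_index K (lab a) = bits_of_index K (lab b)" by simp
  also have "\<dots> \<longleftrightarrow> lab a = lab b"
    using index_of_bits_of_index[of K] take_bit_nat_eq_self[OF less[OF a]] take_bit_nat_eq_self[OF less[OF b]] by metis
  also have "\<dots> \<longleftrightarrow> coset_rep A n K a = coset_rep A n K b"
    unfolding lab_def by (rule inj_eq[OF permutes_inj[OF G]])
  also have "\<dots> \<longleftrightarrow> coset_eq (fst (D i)) n K a b" by (simp add: coset_rep_eq_iff d)
  finally show ?thesis .
qed

lemma sampling_succeeds: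
  shows "set_pmf (noisy_outcome (1 / 256) (16 * n + 2) (sample_layers (separating_oracle D) (16 * n + 2) (4 * n))) \<subseteq> {s. length s = 16 * n + 2}"
    and "measure_pmf.prob (noisy_outcome (1 / 256) (16 * n + 2) (sample_layers (separating_oracle D) (16 * n + 2) (4 * n)))
      {s. take_bit K (index_of_bits s) \<in> near_code (fst (D i)) n K n} \<ge> 2 / 3"
proof -
  let ?O = "separating_oracle D" and ?N = "16 * n + 2"
  have len: "length (?O s) = K + 2" if "length s = K" for s using oracle_at_labels[OF that] by simp
  have h: "K = 2 * (4 * n)" "K + (K + 2) \<le> ?N" "0 \<le> (1 / 256 :: real)" "1 / 256 \<le> (1 :: real)" by (simp_all add: K)
  show "set_pmf (noisy_outcome (1 / 256) ?N (sample_layers ?O ?N (4 * n))) \<subseteq> {s. length s = ?N}"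
    by (rule set_noisy_outcome[OF sample_psd[OF h(1,2) len oracle_value_cosets h(3,4)] sample_trace[OF h(1,2) len oracle_value_cosets h(3,4)]])
  define \<delta> :: real where "\<delta> = real K * ((1 - (1 - 1 / 256) ^ 4) / 2) / (real n + 1)"
  have prob: "(1 - 1 / 2 ^ n) * (1 - \<delta>) \<le> measure_pmf.prob (noisy_outcome (1 / 256) ?N (sample_layers ?O ?N (4 * n)))
      {s. take_bit K (index_of_bits s) \<in> near_code (fst (D i)) n K n}"
    by (rule sample_near_code[OF h(1,2) len oracle_value_cosets h(3,4) \<delta>_def])
  \<comment> \<open>Four rounds at rate \<open>1 / 256\<close> flip a bit with probability at most
    \<open>1 / 128\<close>, so at most \<open>n / 16\<close> of the \<open>8 n\<close> bits in
    expectation; Markov's inequality with radius \<open>n\<close> loses at most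
    \<open>1 / 16\<close>.\<close>
  have d: "15 / 16 \<le> 1 - \<delta>"
  proof -
    have "(1 - (1 - 1 / 256 :: real) ^ 4) / 2 \<le> 1 / 128" by (simp add: power_divide)
    then have "real K * ((1 - (1 - 1 / 256) ^ 4) / 2) \<le> real K * (1 / 128)" by (rule mult_left_mono) simp
    also have "\<dots> \<le> (real n + 1) * (1 / 16)" by (simp add: K)
    finally have "\<delta> \<le> (real n + 1) * (1 / 16) / (real n + 1)"
      unfolding \<delta>_def by (rule divide_right_mono) simp
    also have "\<dots> = 1 / 16" by (rule nonzero_mult_div_cancel_left) linarith
    finally show ?thesis by linarith
  qed
  \<comment> \<open>The loss from \<open>u = 0\<close>, small because every stage length is at least
    8.\<close>
  have e: "255 / 256 \<le> 1 - (1 / 2 ^ n :: real)"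
  proof -
    have "(2::real) ^ 8 \<le> 2 ^ n" using stage_length_ge[of i] n by (intro power_increasing) auto
    then have "1 / 2 ^ n \<le> 1 / (2::real) ^ 8" by (intro divide_left_mono) auto
    then show ?thesis by simp
  qed
  have "255 / 256 * (15 / 16) \<le> (1 - 1 / 2 ^ n) * (1 - \<delta>)"
    by (rule mult_mono[OF e d order_trans[OF _ e]]) simp_all
  from order_trans[OF this prob] have "255 / 256 * (15 / 16) \<le> measure_pmf.prob (noisy_outcome (1 / 256) ?N (sample_layers ?O ?N (4 * n)))
      {s. take_bit K (index_of_bits s) \<in> near_code (fst (D i)) n K n}"
    .
  then show "2 / 3 \<le> measure_pmf.prob (noisy_outcome (1 / 256) ?N (sample_layers ?O ?N (4 * n)))
      {s. take_bit K (index_of_bits s) \<in> near_code (fst (D i)) n K n}" by simp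
qed

end

lemma prob_eq_1_pmf: "(\<And>s. s \<in> set_pmf p \<Longrightarrow> P s) \<Longrightarrow> measure_pmf.prob p {s. P s} = 1"
  by (simp add: measure_pmf.prob_eq_1 AE_measure_pmf_iff)

lemma separating_language_NISQ:
  assumes perm: "\<And>i. fst (snd (D i)) permutes {..<2 ^ (8 * stage_length i)}"
  shows "separating_language D \<in> NISQ (separating_oracle D)"
proof -
  let ?O = "separating_oracle D" and ?M = sampling_machine and ?L = "separating_language D"
  obtain B where B: "\<And>n. length (enc_circuit (sample_circuit n)) \<le> B * (n + 1) ^ 2"
    using length_enc_sample_circuit by blast
  \<comment> \<open>\<open>2 * B\<close> pays for copying the code of the circuit; 200 covers the
    linear costs, including the time \<open>3 * (16 * n + 2)\<close> of the noisy query.\<close>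
  define C where "C = 2 * B + 200"
  define p where "p = [:C, 2 * C, C:]"
  have p: "poly p l = C * (l + 1) ^ 2" for l by (simp add: p_def power2_eq_square algebra_simps)
  have C: "poly p l \<ge> 2 * (B * (l + 1) ^ 2) + 200 * (l + 1)" for l
  proof -
    have "l + 1 \<le> (l + 1) ^ 2" by (simp add: power2_eq_square)
    then have "200 * (l + 1) \<le> 200 * (l + 1) ^ 2" by simp
    then show ?thesis unfolding p C_def by (simp add: add_mult_distrib)
  qed
  have "(\<forall>c \<in> set_pmf (run ?M ?O (nqc (1 / 256) ?O) x (poly p (length x))).
        c \<in> outputs ?M True \<union> outputs ?M False \<and> time_used c \<le> poly p (length x)) \<and>
     (x \<in> ?L \<longrightarrow> measure_pmf.prob (run ?M ?O (nqc (1 / 256) ?O) x (poly p (length x))) (outputs ?M True) \<ge> 2 / 3) \<and>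
     (x \<notin> ?L \<longrightarrow> measure_pmf.prob (run ?M ?O (nqc (1 / 256) ?O) x (poly p (length x))) (outputs ?M False) \<ge> 2 / 3)" for x
  proof (cases "\<exists>i. length x = stage_length i")
    case True
    then obtain i where i: "length x = stage_length i" ..
    define n where "n = stage_length i"
    let ?P = "noisy_outcome (1 / 256) (16 * n + 2) (sample_layers ?O (16 * n + 2) (4 * n))"
    have w: "enc_circuit (sample_circuit n) = ?O x"
      by (rule oracle_at_input[where D = D and i = i, OF perm n_def refl, symmetric]) (simp add: i n_def)
    have R: "nqc (1 / 256) ?O (enc_circuit (sample_circuit n)) = (?P, (16 * n + 2) * 3)"
      by (rule nqc_sample_circuit[OF out_len_labels[where D = D and i = i, OF perm n_def refl]])
    note succ = sampling_succeeds[where D = D and i = i, OF perm n_def refl]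
    have S: "\<forall>s\<in>set_pmf (fst (nqc (1 / 256) ?O (enc_circuit (sample_circuit n)))). length s \<le> 16 * n + 2"
      using succ(1) unfolding R by auto
    have T: "2 * length x + 2 * length (enc_circuit (sample_circuit n)) + 2 * (16 * n + 2)
        + snd (nqc (1 / 256) ?O (enc_circuit (sample_circuit n))) + 20 \<le> poly p (length x)"
      using B[of n] C[of n] unfolding R i n_def[symmetric] by simp
    have ver: "accepting (?O s) \<longleftrightarrow> take_bit (8 * n) (index_of_bits s) \<in> stage_accept n (D i)" if "s \<in> set_pmf ?P" for s
      using oracle_at_verification[where D = D and i = i, OF perm n_def refl, of s] succ(1) that by (auto simp: accepting_def)
    note run = run_sampling_machine[where R = "nqc (1 / 256) ?O" and Or = ?O and x = x, OF w S T]
    have "measure_pmf.prob ?P {s. accepting (?O s) = True} \<ge> 2 / 3" if "snd (snd (D i))"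
    proof -
      have "stage_accept n (D i) = near_code (fst (D i)) n (8 * n) n"
        using that by (cases "D i") (simp add: stage_accept_def)
      then have "measure_pmf.prob ?P {s. accepting (?O s) = True} = measure_pmf.prob ?P {s. take_bit (8 * n) (index_of_bits s) \<in> near_code (fst (D i)) n (8 * n) n}"
        by (intro measure_pmf.finite_measure_eq_AE) (use ver in \<open>auto simp: AE_measure_pmf_iff\<close>)
      then show ?thesis using succ(2) by simp
    qed
    \<comment> \<open>The error is one-sided: with secret bit false no outcome is accepted.\<close>
    moreover have "measure_pmf.prob ?P {s. accepting (?O s) = False} \<ge> 2 / 3" if "\<not> snd (snd (D i))"
    proof -
      have "stage_accept n (D i) = {}" using that by (cases "D i") (simp add: stage_accept_def)
      then have "measure_pmf.prob ?P {s. accepting (?O s) = False} = 1"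
        using ver by (intro prob_eq_1_pmf) simp
      then show ?thesis by simp
    qed
    ultimately show ?thesis
      using run(1) unfolding run(2) R fst_conv separating_language_iff[OF i] by blast
  next
    case False
    \<comment> \<open>The running time bound and rejection must hold for these inputs too. The
      oracle answers with a label, a single bit or the empty string; none of these is a code, so the
      noisy query is free and returns the empty string.\<close>
    define w where "w = ?O x"
    have x: "x \<notin> ?L" using False by (auto simp: separating_language_def)
    have "length w \<le> length x + 2 \<and> nqc (1 / 256) ?O w = (return_pmf [], 0)"
    proof -
      let ?n = "stage_length (stage_of (length x))"
      have n: "8 \<le> ?n" by (rule stage_length_ge)
      have x_n: "length x \<noteq> ?n" using False by blast
      show ?thesis
      proof (cases "length x = 8 * ?n")
        case True
        define v where "v = bits_of_index (8 * ?n) (stage_labels ?n (D (stage_of (length x))) (index_of_bits x))"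
        have w: "w = False # False # v"
          unfolding w_def separating_oracle_def Let_def if_P[OF True] v_def ..
        have v: "length v = length x" unfolding v_def length_bits_of_index by (rule True[symmetric])
        moreover have "0 < length x" using n True by linarith
        ultimately have "v \<noteq> []" by auto
        then show ?thesis unfolding w by (simp add: nqc_False_False v)
      next
        case no_label: False
        show ?thesis
        proof (cases "length x = 16 * ?n + 2")
          case True
          have "length w = 1"
            unfolding w_def separating_oracle_def Let_def if_not_P[OF no_label] if_P[OF True] by simp
          then show ?thesis by (simp add: nqc_short)
        next
          case False
          have "w = []"
            unfolding w_def separating_oracle_def Let_def if_not_P[OF no_label] if_not_P[OF False] if_not_P[OF x_n] ..
          then show ?thesis by (simp add: nqc_short)
        qed
      qed
    qed
    then have l: "length w \<le> length x + 2" and R: "nqc (1 / 256) ?O w = (return_pmf [], 0)" by auto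
    have S: "\<forall>s\<in>set_pmf (fst (nqc (1 / 256) ?O w)). length s \<le> 0"
      unfolding R by simp
    have T: "2 * length x + 2 * length w + 2 * 0 + snd (nqc (1 / 256) ?O w) + 20 \<le> poly p (length x)"
      using C[of "length x"] l unfolding R by simp
    \<comment> \<open>Length 0 belongs to stage 0 but is none of its three special lengths.\<close>
    have "?O [] = []"
      using stage_length_ge[of "stage_of 0"] by (auto simp: separating_oracle_def Let_def)
    then have "\<not> accepting (?O [])" by (simp add: accepting_def)
    then have "measure_pmf.prob (return_pmf []) {s. accepting (?O s) = False} = 1"
      by (intro prob_eq_1_pmf) simp
    then show ?thesis
      using run_sampling_machine(1)[where R = "nqc (1 / 256) ?O" and Or = ?O and x = x, OF w_def S T] x unfolding run_sampling_machine(2)[where R = "nqc (1 / 256) ?O" and Or = ?O and x = x, OF w_def S T] R fst_conv by simp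
  qed
  then have "decides_poly_time ?M ?O (nqc (1 / 256) ?O) ?L"
    unfolding decides_poly_time_def Let_def by (intro exI[of _ p] allI)
  then show ?thesis
    unfolding NISQ_def using wf_sampling_machine by (intro CollectI exI[of _ "1 / 256"]) auto
qed

theorem theorem2p2:
  shows "\<exists>O1. classical_oracle O1 \<and> BPP O1 \<subset> NISQ O1"
proof -
  obtain D where D: "\<And>i. fst (snd (D i)) permutes {..<2 ^ (8 * stage_length i)}" "\<And>i. stage_fails i D"
    using exists_diagonal_data by blast
  have "BPP (separating_oracle D) \<subset> NISQ (separating_oracle D)"
    using BPP_subset_NISQ separating_language_NISQ[OF D(1)] separating_language_not_BPP[OF D(2)] by blast
  then show ?thesis using classical_separating_oracle by blast
qed

end
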